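(* Let $\mathcal{B}$ be a reflexive separable Banach space or a Hilbert space, let $\mathrm{Z}:\mathcal{B}\supset\mathcal{D}(\mathrm{Z})\to\mathcal{B}$ be a linear operator with $\mathcal{D}(\mathrm{Z})$ dense in $\mathcal{B}$, and let $t>0$. Then $\mathrm{Z}$ is closable and its closure is a generator of a $C_0$-semigroup if and only if there exists $\mathrm{F}:[0,\infty)\to\mathcal{L}(\mathcal{B})$ such that: (i) $\mathrm{F}(0)=\mathrm{I}$ and there exist $a\in\mathbb{R}$, $M\ge 1$ such that $\|\mathrm{F}(s/n)^m\|\le M\exp(as\frac{m}{n})$ for all $n,m\in\mathbb{N}$ and $s\ge 0$. (ii) $\mathcal{D}(\mathrm{F}'(0))\supset\mathcal{D}(\mathrm{Z})$ and $\mathrm{F}'(0)f=\mathrm{Z}f$ for $f\in\mathcal{D}(\mathrm{Z})$. (iii) $\mathcal{D}({\mathrm{F}^*}'(0))$ is weak-$*$ dense in $\mathcal{B}^*$. (iv) There exists a dense linear subspace $\mathbf{A}\subseteq\mathcal{D}(\mathrm{Z})$ (dense in $\mathcal{B}$) such that for any $f\in\mathbf{A}$, $s\ge 0$ there exists a sequence $\{f_n\}_{n=1}^\infty$, $f_n\in\mathcal{D}(\mathrm{Z})$, satisfying $\lim_{n\to\infty}\|\mathrm{F}(t/n)^{[ns]}f-f_n\|=0$ and such that $\{\mathrm{Z}f_n\}_{n=1}^\infty$ is a bounded sequence. Furthermore, if conditions (i)–(iv) are satisfied, then $\exp(s\overline{\mathrm{Z}})f=\lim_{n\to\infty}\mathrm{F}(s/n)^n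 f$, $s>0$, for all $f\in\mathcal{B}$.
   Context: $\mathcal{L}(\mathbf{E})$ is the space of bounded linear operators on a Banach space $\mathbf{E}$. For $\mathrm{S}:[0,\infty)\to\mathcal{L}(\mathbf{E})$, the (strong) derivative at $0$ is the linear operator $\mathrm{S}'(0)\psi=\lim_{h\to 0}h^{-1}(\mathrm{S}(h)\psi-\mathrm{S}(0)\psi)$ (norm limit, $h>0$), whose domain $\mathcal{D}(\mathrm{S}'(0))$ is the set of all $\psi\in\mathbf{E}$ for which the limit exists. For $\mathrm{F}:[0,\infty)\to\mathcal{L}(\mathcal{B})$, $\mathrm{F}^*$ is the function $s\mapsto(\mathrm{F}(s))^*\in\mathcal{L}(\mathcal{B}^* )$, and ${\mathrm{F}^*}'(0)$ is its strong derivative at $0$ (norm of $\mathcal{B}^*$). $\overline{\mathrm{Z}}$ is the closure of $\mathrm{Z}$, $\exp(s\overline{\mathrm{Z}})$ the $C_0$-semigroup it generates, and $[x]$ the integer part of $x$. *)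

theory Defs
  imports "HOL-Analysis.Analysis"
begin

(* Scalar fields.  Up to isomorphism the only instances of this class are the reals and the
   complex numbers: expanding (norm (1 + z))^2 shows that z + conj z is real, so that every z is
   a root of the real quadratic X^2 - (z + conj z) X + (norm z)^2.  Proving a theorem for an
   arbitrary 'k of this class covers real and complex Banach spaces at the same time. *)
class rc_field = real_normed_field + banach +
  fixes rc_conj :: "'a \<Rightarrow> 'a"
  assumes rc_conj_add: "rc_conj (x + y) = rc_conj x + rc_conj y"
    and rc_conj_mult: "rc_conj (x * y) = rc_conj x * rc_conj y"
    and rc_mult_conj: "x * rc_conj x = (norm x)\<^sup>2 *\<^sub>R 1"

instantiation real :: rc_field
begin

definition rc_conj_real :: "real \<Rightarrow> real" where
  "rc_conj_real x = x"

instance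
  by standard (simp_all add: rc_conj_real_def power2_eq_square)

end

instantiation complex :: rc_field
begin

definition rc_conj_complex :: "complex \<Rightarrow> complex" where
  "rc_conj_complex z = cnj z"

instance
  by standard (simp_all add: rc_conj_complex_def scaleR_conv_of_real flip: complex_norm_square)

end

(* A normed space over 'k.  The library type classes only provide the real structure, so the
   scalar multiplication is a parameter, required to extend the real one.  Completeness is
   expressed by putting 'a in the class banach. *)
locale rc_normed_space = vector_space smul
  for smul :: "'k::rc_field \<Rightarrow> 'a::real_normed_vector \<Rightarrow> 'a" +
  assumes smul_of_real: "smul (of_real r) x = r *\<^sub>R x"
    and norm_smul: "norm (smul c x) = norm c * norm x"

lemma rc_normed_space_scaleR: "rc_normed_space (scaleR :: real \<Rightarrow> 'a::real_normed_vector \<Rightarrow> 'a)"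
  by unfold_locales (simp_all add: algebra_simps)

lemma rc_normed_space_mult: "rc_normed_space ((*) :: 'k::rc_field \<Rightarrow> 'k \<Rightarrow> 'k)"
  by unfold_locales (simp_all add: algebra_simps norm_mult scaleR_conv_of_real)

(* blinfun only enforces real linearity, hence the homogeneity condition. *)
definition bounded_operators :: "('k::rc_field \<Rightarrow> 'a::real_normed_vector \<Rightarrow> 'a) \<Rightarrow> ('a \<Rightarrow>\<^sub>L 'a) set" where
  "bounded_operators smul = {T. \<forall>c x. blinfun_apply T (smul c x) = smul c (blinfun_apply T x)}"

definition dual_space :: "('k::rc_field \<Rightarrow> 'a::real_normed_vector \<Rightarrow> 'a) \<Rightarrow> ('a \<Rightarrow>\<^sub>L 'k) set" where
  "dual_space smul = {\<phi>. \<forall>c x. blinfun_apply \<phi> (smul c x) = c * blinfun_apply \<phi> x}"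

(* The initial topology on the dual for the evaluations at points: euclidean on the function
   type is the topology of pointwise convergence. *)
definition weak_star_topology :: "('k::rc_field \<Rightarrow> 'a::real_normed_vector \<Rightarrow> 'a) \<Rightarrow> ('a \<Rightarrow>\<^sub>L 'k) topology" where
  "weak_star_topology smul = pullback_topology (dual_space smul) blinfun_apply euclidean"

(* Surjectivity of the canonical map into the bidual.  An element of the bidual is represented
   by a map \<Phi> of which only the values on dual_space smul matter; the functional c \<phi> is
   blinfun_mult_right c o_L \<phi>. *)
definition reflexive_space :: "('k::rc_field \<Rightarrow> 'a::real_normed_vector \<Rightarrow> 'a) \<Rightarrow> bool" where
  "reflexive_space smul \<longleftrightarrow>
    (\<forall>\<Phi> :: ('a \<Rightarrow>\<^sub>L 'k) \<Rightarrow> 'k.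
       (\<forall>\<phi>\<in>dual_space smul. \<forall>\<psi>\<in>dual_space smul. \<Phi> (\<phi> + \<psi>) = \<Phi> \<phi> + \<Phi> \<psi>) \<and>
       (\<forall>c. \<forall>\<phi>\<in>dual_space smul. \<Phi> (blinfun_mult_right c o\<^sub>L \<phi>) = c * \<Phi> \<phi>) \<and>
       (\<exists>C. \<forall>\<phi>\<in>dual_space smul. norm (\<Phi> \<phi>) \<le> C * norm \<phi>)
       \<longrightarrow> (\<exists>x. \<forall>\<phi>\<in>dual_space smul. \<Phi> \<phi> = blinfun_apply \<phi> x))"

definition hilbert_space :: "('k::rc_field \<Rightarrow> 'a::banach \<Rightarrow> 'a) \<Rightarrow> bool" where
  "hilbert_space smul \<longleftrightarrow>
    (\<exists>ip :: 'a \<Rightarrow> 'a \<Rightarrow> 'k.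
       (\<forall>x y z. ip (x + y) z = ip x z + ip y z) \<and>
       (\<forall>c x y. ip (smul c x) y = c * ip x y) \<and>
       (\<forall>x y. ip y x = rc_conj (ip x y)) \<and>
       (\<forall>x. ip x x = of_real ((norm x)\<^sup>2)))"

(* Unbounded operators are given by a domain D and a map Z whose values outside D are
   irrelevant; closures, generators and derivatives are given by their graphs. *)
definition linear_operator :: "('k::rc_field \<Rightarrow> 'a::real_normed_vector \<Rightarrow> 'a) \<Rightarrow> 'a set \<Rightarrow> ('a \<Rightarrow> 'a) \<Rightarrow> bool" where
  "linear_operator smul D Z \<longleftrightarrow>
    module.subspace smul D \<and>
    (\<forall>x\<in>D. \<forall>y\<in>D. Z (x + y) = Z x + Z y) \<and>
    (\<forall>c. \<forall>x\<in>D. Z (smul c x) = smul c (Z x))"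

definition operator_graph :: "'a set \<Rightarrow> ('a \<Rightarrow> 'a) \<Rightarrow> ('a \<times> 'a) set" where
  "operator_graph D Z = {(x, Z x) | x. x \<in> D}"

definition closable :: "('a::real_normed_vector \<times> 'a) set \<Rightarrow> bool" where
  "closable G \<longleftrightarrow> single_valued (closure G)"

definition strong_derivative0 :: "'e set \<Rightarrow> (real \<Rightarrow> 'e \<Rightarrow> 'e) \<Rightarrow> ('e::real_normed_vector \<times> 'e) set" where
  "strong_derivative0 E S =
    {(\<psi>, \<eta>). \<psi> \<in> E \<and> \<eta> \<in> E \<and> ((\<lambda>h. (1 / h) *\<^sub>R (S h \<psi> - S 0 \<psi>)) \<longlongrightarrow> \<eta>) (at_right 0)}"

(* Functions on [0, \<infinity>) are functions on real of which only the values at s \<ge> 0 are used. *)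
definition C0_semigroup :: "('k::rc_field \<Rightarrow> 'a::real_normed_vector \<Rightarrow> 'a) \<Rightarrow> (real \<Rightarrow> 'a \<Rightarrow>\<^sub>L 'a) \<Rightarrow> bool" where
  "C0_semigroup smul T \<longleftrightarrow>
    (\<forall>s\<ge>0. T s \<in> bounded_operators smul) \<and>
    T 0 = id_blinfun \<and>
    (\<forall>r\<ge>0. \<forall>s\<ge>0. T (r + s) = T r o\<^sub>L T s) \<and>
    (\<forall>x. ((\<lambda>s. blinfun_apply (T s) x) \<longlongrightarrow> x) (at_right 0))"

definition generator :: "(real \<Rightarrow> 'a::real_normed_vector \<Rightarrow>\<^sub>L 'a) \<Rightarrow> ('a \<times> 'a) set" where
  "generator T = strong_derivative0 UNIV (\<lambda>s. blinfun_apply (T s))"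

definition generates :: "('k::rc_field \<Rightarrow> 'a::real_normed_vector \<Rightarrow> 'a) \<Rightarrow> ('a \<times> 'a) set \<Rightarrow> (real \<Rightarrow> 'a \<Rightarrow>\<^sub>L 'a) \<Rightarrow> bool" where
  "generates smul G T \<longleftrightarrow> C0_semigroup smul T \<and> generator T = G"

definition blinfun_power :: "('a::real_normed_vector \<Rightarrow>\<^sub>L 'a) \<Rightarrow> nat \<Rightarrow> 'a \<Rightarrow>\<^sub>L 'a" where
  "blinfun_power A m = (blinfun_compose A ^^ m) id_blinfun"

definition blinfun_adjoint :: "('a::real_normed_vector \<Rightarrow>\<^sub>L 'a) \<Rightarrow> ('a \<Rightarrow>\<^sub>L 'k::real_normed_vector) \<Rightarrow> ('a \<Rightarrow>\<^sub>L 'k)" where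
  "blinfun_adjoint A \<phi> = \<phi> o\<^sub>L A"

definition power_bound :: "(real \<Rightarrow> 'a::real_normed_vector \<Rightarrow>\<^sub>L 'a) \<Rightarrow> bool" where
  "power_bound F \<longleftrightarrow>
    F 0 = id_blinfun \<and>
    (\<exists>a M. M \<ge> 1 \<and>
      (\<forall>n\<ge>1. \<forall>m. \<forall>s\<ge>0.
         norm (blinfun_power (F (s / real n)) m) \<le> M * exp (a * s * (real m / real n))))"

definition derivative_extends :: "(real \<Rightarrow> 'a::real_normed_vector \<Rightarrow>\<^sub>L 'a) \<Rightarrow> 'a set \<Rightarrow> ('a \<Rightarrow> 'a) \<Rightarrow> bool" where
  "derivative_extends F D Z \<longleftrightarrow>
    operator_graph D Z \<subseteq> strong_derivative0 UNIV (\<lambda>s. blinfun_apply (F s))"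

definition adjoint_derivative_dense :: "('k::rc_field \<Rightarrow> 'a::real_normed_vector \<Rightarrow> 'a) \<Rightarrow> (real \<Rightarrow> 'a \<Rightarrow>\<^sub>L 'a) \<Rightarrow> bool" where
  "adjoint_derivative_dense smul F \<longleftrightarrow>
    weak_star_topology smul closure_of
      Domain (strong_derivative0 (dual_space smul) (\<lambda>s. blinfun_adjoint (F s))) = dual_space smul"

definition approximate_orbits :: "('k::rc_field \<Rightarrow> 'a::real_normed_vector \<Rightarrow> 'a) \<Rightarrow> 'a set \<Rightarrow> ('a \<Rightarrow> 'a) \<Rightarrow> real \<Rightarrow> (real \<Rightarrow> 'a \<Rightarrow>\<^sub>L 'a) \<Rightarrow> bool" where
  "approximate_orbits smul D Z t F \<longleftrightarrow>
    (\<exists>A. module.subspace smul A \<and> A \<subseteq> D \<and> closure A = UNIV \<and>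
      (\<forall>f\<in>A. \<forall>s\<ge>0. \<exists>g :: nat \<Rightarrow> 'a.
         (\<forall>n\<ge>1. g n \<in> D) \<and>
         (\<lambda>n. norm (blinfun_apply (blinfun_power (F (t / real n)) (nat \<lfloor>real n * s\<rfloor>)) f - g n))
           \<longlonglongrightarrow> 0 \<and>
         bounded ((\<lambda>n. Z (g n)) ` {1..})))"

definition chernoff_family :: "('k::rc_field \<Rightarrow> 'a::real_normed_vector \<Rightarrow> 'a) \<Rightarrow> 'a set \<Rightarrow> ('a \<Rightarrow> 'a) \<Rightarrow> real \<Rightarrow> (real \<Rightarrow> 'a \<Rightarrow>\<^sub>L 'a) \<Rightarrow> bool" where
  "chernoff_family smul D Z t F \<longleftrightarrow>
    (\<forall>s\<ge>0. F s \<in> bounded_operators smul) \<and>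
    power_bound F \<and>
    derivative_extends F D Z \<and>
    adjoint_derivative_dense smul F \<and>
    approximate_orbits smul D Z t F"

end

(* The weak limits of the discrete orbits F(t/n)^[ns] f along a free ultrafilter form
   a curve u; hypothesis (iv), the weak closedness of a closed subspace and the weak-* density of
   the domain of the adjoint derivative show that u(s) lies in the domain of the closure of Z and
   that u is a weak solution of u' = Zu.  Since u is norm Lipschitz, its moving averages
   (1/d) int_s^(s+d) u are classical C^1 solutions, and for these consistency on D and stability
   alone give norm convergence F(h)^k v(0) -> v(s) as h -> 0, hk -> s.  As their initial values
   are dense, F(h)^k converges strongly to a semigroup, and invariance of the set of classical
   solutions identifies its generator with the closure of Z; no resolvent is needed.  The orbits
   of a semigroup generated by the closure of Z are classical solutions too, which gives the
   product formula.  Conversely one takes F = exp(s Z) itself; then phi o V_h o V_h with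
   V_h = int_0^h exp(s Z) ds lies in the domain of the adjoint derivative. *)
theory Submission
  imports Defs
begin

section \<open>The Hahn-Banach theorem for real functionals\<close>

text \<open>Hypothesis (iv) concerns only the step sizes \<open>t / n\<close>, whereas the product
  formula needs \<open>s / n\<close> for every \<open>s\<close>. Curves bridge the gap: the mesh
  \<open>t / n\<close> only serves to produce solutions of u' = Zu, and once a solution is known,
  consistency and stability force every other mesh to follow it. The obstacle is the regularity of
  the weak limit u. Its candidate derivative is a weak limit chosen separately at each time, with no
  known measurability in time, so it is never integrated. Differentiation takes place on the scalar
  functions \<psi>(u(s)) with \<psi> in the domain of the adjoint derivative, and only the Lipschitz
  curve u is integrated. Such \<psi> approximate every functional in norm, because reflexivity turns
  a separating subspace of the dual into a norm dense one. That weak limits, averages and generator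
  derivatives lie in the closure of the graph is tested with pairs (f, g) of functionals such that f
  x + g y = 0 on the graph; this works before anything is known about closability. The analysis
  itself is over the reals; the scalar field enters through reflexivity, the dual domain and
  homogeneity.\<close>

definition sublinear :: "('a::real_vector \<Rightarrow> real) \<Rightarrow> bool" where
  "sublinear p \<longleftrightarrow> (\<forall>x y. p (x + y) \<le> p x + p y) \<and> (\<forall>c x. c \<ge> 0 \<longrightarrow> p (c *\<^sub>R x) = c * p x)"

lemma sublinear_add: "sublinear p \<Longrightarrow> p (x + y) \<le> p x + p y"
  by (simp add: sublinear_def)

lemma sublinear_scaleR: "sublinear p \<Longrightarrow> c \<ge> 0 \<Longrightarrow> p (c *\<^sub>R x) = c * p x"
  by (simp add: sublinear_def)

lemma sublinear_zero: "sublinear p \<Longrightarrow> p 0 = 0"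
  using sublinear_scaleR[of p 0 0] by simp

lemma sublinear_uminus_ge: "sublinear p \<Longrightarrow> - p (- x) \<le> p x"
  using sublinear_add[of p x "- x"] sublinear_zero[of p] by simp

text \<open>A minimal sublinear \<open>q\<close> must agree with its directional modification below, which at \<open>- y\<close> is at
  most \<open>- q y\<close>; hence \<open>q\<close> is odd, and an odd sublinear functional is linear.\<close>

lemma sublinear_directional:
  fixes q :: "'a::real_vector \<Rightarrow> real" and y :: 'a
  assumes q: "sublinear q"
  defines "r \<equiv> \<lambda>x. INF t\<in>{0..}. q (x + t *\<^sub>R y) - t * q y"
  shows "sublinear r" "r x \<le> q x" "r (- y) \<le> - q y"
proof -
  \<comment> \<open>Subadditivity at \<open>x + t *\<^sub>R y\<close> and \<open>- x\<close> bounds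
    the infimum from below, so \<open>r\<close> is finite.\<close>
  have lower: "- q (- x) \<le> q (x + t *\<^sub>R y) - t * q y" if "t \<ge> 0" for x t
    using sublinear_add[OF q, of "x + t *\<^sub>R y" "- x"] sublinear_scaleR[OF q, of t y] that by simp
  have bdd: "bdd_below ((\<lambda>t. q (x + t *\<^sub>R y) - t * q y) ` {0..})" for x
    using lower by (auto intro!: bdd_belowI2[where m = "- q (- x)"])
  have r_le: "r x \<le> q (x + t *\<^sub>R y) - t * q y" if "t \<ge> 0" for x t
    unfolding r_def using bdd[of x] that by (intro cINF_lower) auto
  have r_ge: "b \<le> r x" if "\<And>t. t \<ge> 0 \<Longrightarrow> b \<le> q (x + t *\<^sub>R y) - t * q y" for b x
    unfolding r_def using that by (intro cINF_greatest) auto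
  have le: "r x \<le> q x" for x
    using r_le[of 0 x] by simp
  then show "r x \<le> q x" .
  show "r (- y) \<le> - q y"
    using r_le[of 1 "- y"] sublinear_zero[OF q] by simp
  have add: "r (u + v) \<le> r u + r v" for u v
  proof -
    have "r (u + v) - (q (u + s *\<^sub>R y) - s * q y) \<le> q (v + t *\<^sub>R y) - t * q y"
      if "s \<ge> 0" "t \<ge> 0" for s t
    proof -
      have "r (u + v) \<le> q (u + v + (s + t) *\<^sub>R y) - (s + t) * q y"
        using that by (intro r_le) auto
      also have "u + v + (s + t) *\<^sub>R y = (u + s *\<^sub>R y) + (v + t *\<^sub>R y)"
        by (simp add: algebra_simps)
      finally show ?thesis
        using sublinear_add[OF q, of "u + s *\<^sub>R y" "v + t *\<^sub>R y"] by (simp add: algebra_simps)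
    qed
    then have "r (u + v) - (q (u + s *\<^sub>R y) - s * q y) \<le> r v" if "s \<ge> 0" for s
      using that by (intro r_ge) auto
    then have "r (u + v) - r v \<le> r u"
      by (intro r_ge) (auto simp: algebra_simps)
    then show ?thesis by simp
  qed
  have le_scale: "r (c *\<^sub>R x) \<le> c * r x" if "c > 0" for c x
  proof -
    have "r (c *\<^sub>R x) / c \<le> q (x + t *\<^sub>R y) - t * q y" if "t \<ge> 0" for t
    proof -
      have "r (c *\<^sub>R x) \<le> q (c *\<^sub>R x + (c * t) *\<^sub>R y) - (c * t) * q y"
        using that \<open>c > 0\<close> by (intro r_le) auto
      also have "c *\<^sub>R x + (c * t) *\<^sub>R y = c *\<^sub>R (x + t *\<^sub>R y)"
        by (simp add: algebra_simps)
      finally show ?thesis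
        using \<open>c > 0\<close> sublinear_scaleR[OF q, of c "x + t *\<^sub>R y"] by (simp add: field_simps)
    qed
    then have "r (c *\<^sub>R x) / c \<le> r x"
      by (intro r_ge)
    then show ?thesis using that by (simp add: field_simps)
  qed
  have zero: "r 0 = 0"
    using le[of 0] sublinear_zero[OF q] r_ge[of 0 0] sublinear_scaleR[OF q] by force
  have "r (c *\<^sub>R x) = c * r x" if "c \<ge> 0" for c x
  proof (cases "c = 0")
    case False
    with that have c: "c > 0" by simp
    have "r ((1 / c) *\<^sub>R (c *\<^sub>R x)) \<le> (1 / c) * r (c *\<^sub>R x)"
      using c by (intro le_scale) auto
    then have "c * r x \<le> r (c *\<^sub>R x)"
      using c by (simp add: field_simps)
    with le_scale[OF c, of x] show ?thesis by simp
  qed (simp add: zero)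
  with add show "sublinear r"
    by (auto simp: sublinear_def)
qed

lemma minimal_sublinear_linear:
  fixes q :: "'a::real_vector \<Rightarrow> real"
  assumes q: "sublinear q" and minimal: "\<And>r. sublinear r \<Longrightarrow> (\<forall>x. r x \<le> q x) \<Longrightarrow> r = q"
  shows "linear q"
proof -
  have neg: "q (- y) = - q y" for y
  proof -
    define r where "r x = (INF t\<in>{0..}. q (x + t *\<^sub>R y) - t * q y)" for x
    note r = sublinear_directional[OF q, where y = y, folded r_def]
    have "r = q"
      using r(1,2) by (intro minimal) auto
    with r(3) have "q (- y) \<le> - q y" by simp
    with sublinear_uminus_ge[OF q, of y] show ?thesis by simp
  qed
  show ?thesis
  proof (rule linearI)
    fix x y
    have "q x \<le> q (x + y) + q (- y)"
      using sublinear_add[OF q, of "x + y" "- y"] by simp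
    with neg[of y] sublinear_add[OF q, of x y] show "q (x + y) = q x + q y" by simp
  next
    fix c x
    show "q (c *\<^sub>R x) = c *\<^sub>R q x"
    proof (cases "c \<ge> 0")
      case False
      then have "q (c *\<^sub>R x) = - q ((- c) *\<^sub>R x)"
        using neg[of "c *\<^sub>R x"] by simp
      also have "\<dots> = c * q x"
        using False sublinear_scaleR[OF q, of "- c" x] by simp
      finally show ?thesis by simp
    qed (simp add: sublinear_scaleR[OF q])
  qed
qed

text \<open>Zorn's lemma is applied to the sublinear functionals below \<open>p\<close>, ordered
  downwards, instead of extending a functional from subspace to subspace; a minimal element is
  already linear.\<close>

lemma exists_linear_below_sublinear:
  fixes p :: "'a::real_vector \<Rightarrow> real"
  assumes p: "sublinear p"
  shows "\<exists>f. linear f \<and> (\<forall>x. f x \<le> p x)"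
proof -
  let ?A = "{q. sublinear q \<and> (\<forall>x. q x \<le> p x)}"
  let ?P = "\<lambda>(q :: 'a \<Rightarrow> real) r. \<forall>x. r x \<le> q x"
  have "\<exists>m\<in>?A. \<forall>a\<in>?A. ?P m a \<longrightarrow> a = m"
  proof (rule predicate_Zorn)
    show "partial_order_on ?A (relation_of ?P ?A)"
      by (rule partial_order_on_relation_ofI) (auto intro: order_trans simp: fun_eq_iff order_eq_iff)
  next
    fix C assume C: "C \<in> Chains (relation_of ?P ?A)"
    show "\<exists>u\<in>?A. \<forall>a\<in>C. ?P a u"
    proof (cases "C = {}")
      case True
      with p show ?thesis by auto
    next
      case False
      have CA: "sublinear q" "q x \<le> p x" if "q \<in> C" for q x
        using C that by (auto simp: Chains_def relation_of_def)
      have total: "(\<forall>x. q x \<le> r x) \<or> (\<forall>x. r x \<le> q x)" if "q \<in> C" "r \<in> C" for q r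
        using C that by (auto simp: Chains_def relation_of_def)
      define u where "u x = (INF q\<in>C. q x)" for x
      \<comment> \<open>A lower bound common to all members keeps the infimum over the chain
        finite.\<close>
      have "- p (- x) \<le> q x" if "q \<in> C" for q x
        using sublinear_uminus_ge[OF CA(1)[OF that], of x] CA(2)[OF that, of "- x"] by simp
      then have bdd: "bdd_below ((\<lambda>q. q x) ` C)" for x
        by (auto intro!: bdd_belowI2)
      have u_le: "u x \<le> q x" if "q \<in> C" for q x
        unfolding u_def using bdd that by (intro cINF_lower)
      have u_ge: "b \<le> u x" if "\<And>q. q \<in> C \<Longrightarrow> b \<le> q x" for b x
        unfolding u_def using that False by (intro cINF_greatest) auto
      have add: "u (x + y) \<le> u x + u y" for x y
      proof -
        have "u (x + y) \<le> q x + r y" if qr: "q \<in> C" "r \<in> C" for q r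
        proof -
          \<comment> \<open>The smaller of the two members of the chain bounds both terms at once;
            this is what makes the infimum subadditive.\<close>
          obtain s where s: "s \<in> C" "s x \<le> q x" "s y \<le> r y"
            using total[OF qr] qr by blast
          then show ?thesis
            using u_le[OF s(1), of "x + y"] sublinear_add[OF CA(1)[OF s(1)], of x y] by simp
        qed
        then have "u (x + y) - q x \<le> u y" if "q \<in> C" for q
          using that by (intro u_ge) (metis diff_le_eq add.commute)
        then have "u (x + y) - u y \<le> u x"
          by (intro u_ge) (metis diff_le_eq add.commute)
        then show ?thesis by simp
      qed
      have "u (c *\<^sub>R x) = c * u x" if "c \<ge> 0" for c x
      proof (cases "c = 0")
        case True
        have "(\<lambda>q. q (c *\<^sub>R x)) ` C = {0}"
          using False True CA(1) by (auto simp: sublinear_zero image_iff)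
        with True show ?thesis by (simp add: u_def)
      next
        case c: False
        with that have c: "c > 0" by simp
        show ?thesis
        proof (rule antisym)
          have "u (c *\<^sub>R x) / c \<le> u x"
          proof (rule u_ge)
            fix q assume q: "q \<in> C"
            show "u (c *\<^sub>R x) / c \<le> q x"
              using c u_le[OF q, of "c *\<^sub>R x"] sublinear_scaleR[OF CA(1)[OF q], of c x]
              by (simp add: field_simps)
          qed
          then show "u (c *\<^sub>R x) \<le> c * u x" using c by (simp add: field_simps)
          show "c * u x \<le> u (c *\<^sub>R x)"
            using c u_le[of _ x] CA(1) by (intro u_ge) (simp add: sublinear_scaleR)
        qed
      qed
      with add have "sublinear u" by (auto simp: sublinear_def)
      moreover have "u x \<le> p x" for x
        using False u_le CA(2) by (meson ex_in_conv order_trans)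
      ultimately show ?thesis using u_le by auto
    qed
  qed
  then obtain m where m: "sublinear m" "\<forall>x. m x \<le> p x"
    and min: "\<And>a. sublinear a \<Longrightarrow> (\<forall>x. a x \<le> p x) \<Longrightarrow> (\<forall>x. a x \<le> m x) \<Longrightarrow> a = m"
    by auto
  have "linear m"
  proof (rule minimal_sublinear_linear[OF m(1)])
    fix r assume r: "sublinear r" "\<forall>x. r x \<le> m x"
    then show "r = m"
      using m(2) by (intro min) (auto intro: order_trans)
  qed
  with m(2) show ?thesis by auto
qed

text \<open>The linear functional is taken below the directional modification of \<open>p\<close> at
  \<open>y\<close> instead of below \<open>p\<close> itself: its value at \<open>- y\<close> is then
  at most \<open>- p y\<close>, which forces equality at \<open>y\<close>.\<close>

lemma hahn_banach_sublinear:
  fixes p :: "'a::real_vector \<Rightarrow> real"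
  assumes p: "sublinear p"
  shows "\<exists>f. linear f \<and> (\<forall>x. f x \<le> p x) \<and> f y = p y"
proof -
  define r where "r x = (INF t\<in>{0..}. p (x + t *\<^sub>R y) - t * p y)" for x
  note r = sublinear_directional[OF p, where y = y, folded r_def]
  obtain f where f: "linear f" "\<forall>x. f x \<le> r x"
    using exists_linear_below_sublinear[OF r(1)] by blast
  have fp: "f x \<le> p x" for x
    using f(2) r(2)[of x] order_trans by blast
  have "f (- y) \<le> - p y"
    using f(2) r(3) order_trans by blast
  then have "p y \<le> f y"
    using linear_neg[OF f(1), of y] by simp
  with fp[of y] have "f y = p y" by simp
  with f(1) fp show ?thesis by blast
qed

text \<open>The distance to a subspace is the quotient seminorm. As a majorant it makes a functional
  vanish on \<open>Y\<close> and have norm at most one at the same time.\<close>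

lemma sublinear_infdist_subspace:
  fixes Y :: "'a::real_normed_vector set"
  assumes Y: "subspace Y"
  shows "sublinear (\<lambda>x. infdist x Y)"
proof -
  have ne: "Y \<noteq> {}" using subspace_0[OF Y] by auto
  have le: "infdist x Y \<le> norm (x - y)" if "y \<in> Y" for x y
    using infdist_le[OF that, of x] by (simp add: dist_norm)
  have ge: "b \<le> infdist x Y" if "\<And>y. y \<in> Y \<Longrightarrow> b \<le> norm (x - y)" for b x
    using that ne by (auto simp: infdist_def dist_norm intro!: cINF_greatest)
  have add: "infdist (x + x') Y \<le> infdist x Y + infdist x' Y" for x x'
  proof -
    have "infdist (x + x') Y \<le> norm (x - y) + norm (x' - y')" if "y \<in> Y" "y' \<in> Y" for y y'
      using le[OF subspace_add[OF Y that], of "x + x'"] norm_triangle_ineq[of "x - y" "x' - y'"]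
      by (simp add: algebra_simps)
    then have "infdist (x + x') Y - norm (x - y) \<le> infdist x' Y" if "y \<in> Y" for y
      using that by (intro ge) (auto simp: algebra_simps)
    then have "infdist (x + x') Y - infdist x' Y \<le> infdist x Y"
      by (intro ge) (auto simp: algebra_simps)
    then show ?thesis by simp
  qed
  have scale: "infdist (c *\<^sub>R x) Y \<le> c * infdist x Y" if c: "c > 0" for c x
  proof -
    have "infdist (c *\<^sub>R x) Y / c \<le> infdist x Y"
    proof (rule ge)
      fix y assume "y \<in> Y"
      then have "infdist (c *\<^sub>R x) Y \<le> norm (c *\<^sub>R x - c *\<^sub>R y)"
        by (intro le subspace_scale[OF Y])
      also have "\<dots> = c * norm (x - y)"
        using c by (simp flip: scaleR_diff_right)
      finally show "infdist (c *\<^sub>R x) Y / c \<le> norm (x - y)"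
        using c by (simp add: field_simps)
    qed
    then show ?thesis using c by (simp add: field_simps)
  qed
  have "infdist (c *\<^sub>R x) Y = c * infdist x Y" if "c \<ge> 0" for c x
  proof (cases "c = 0")
    case True
    with subspace_0[OF Y] show ?thesis by simp
  next
    case False
    with that have c: "c > 0" by simp
    have "infdist ((1 / c) *\<^sub>R (c *\<^sub>R x)) Y \<le> (1 / c) * infdist (c *\<^sub>R x) Y"
      using c by (intro scale) auto
    then have "c * infdist x Y \<le> infdist (c *\<^sub>R x) Y"
      using c by (simp add: field_simps)
    with scale[OF c, of x] show ?thesis by simp
  qed
  with add show ?thesis by (auto simp: sublinear_def)
qed

lemma hahn_banach_infdist:
  fixes Y :: "'a::real_normed_vector set"
  assumes Y: "subspace Y"
  shows "\<exists>f :: 'a \<Rightarrow>\<^sub>L real. (\<forall>x. \<bar>f x\<bar> \<le> infdist x Y) \<and> f z = infdist z Y"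
proof -
  note sub = sublinear_infdist_subspace[OF Y]
  obtain f where f: "linear f" "\<And>x. f x \<le> infdist x Y" "f z = infdist z Y"
    using hahn_banach_sublinear[OF sub, of z] by auto
  have inf_neg: "infdist (- x) Y \<le> infdist x Y" for x
  proof -
    have "infdist (- x) Y \<le> dist x y" if "y \<in> Y" for y
      using infdist_le[OF subspace_neg[OF Y that], of "- x"] by (simp add: dist_minus)
    then show ?thesis
      using subspace_0[OF Y] by (auto simp: infdist_def[of x] intro!: cINF_greatest)
  qed
  have abs_f: "\<bar>f x\<bar> \<le> infdist x Y" for x
    using f(2)[of x] f(2)[of "- x"] inf_neg[of x] linear_neg[OF f(1), of x] by simp
  have "infdist x Y \<le> norm x" for x
    using infdist_le[OF subspace_0[OF Y], of x] by simp
  then have "bounded_linear f"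
    using f(1) abs_f by (intro bounded_linear_intro[where K = 1])
      (auto simp: linear_add linear_scale intro: order_trans)
  then show ?thesis
    using abs_f f(3) by (intro exI[of _ "Blinfun f"]) (simp add: bounded_linear_Blinfun_apply)
qed

lemma hahn_banach_closed_subspace:
  fixes Y :: "'a::real_normed_vector set"
  assumes Y: "subspace Y" "closed Y" and z: "\<And>f :: 'a \<Rightarrow>\<^sub>L real. (\<forall>y\<in>Y. f y = 0) \<Longrightarrow> f z = 0"
  shows "z \<in> Y"
proof -
  obtain f :: "'a \<Rightarrow>\<^sub>L real" where f: "\<forall>x. \<bar>f x\<bar> \<le> infdist x Y" "f z = infdist z Y"
    using hahn_banach_infdist[OF Y(1), of z] by blast
  have "\<forall>y\<in>Y. f y = 0"
    using f(1) by (metis abs_le_zero_iff infdist_zero)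
  then have "infdist z Y = 0"
    using z f(2) by metis
  with Y show ?thesis
    using in_closed_iff_infdist_zero subspace_0 by blast
qed

lemma exists_norming_functional:
  fixes z :: "'a::real_normed_vector"
  shows "\<exists>f :: 'a \<Rightarrow>\<^sub>L real. (\<forall>x. \<bar>f x\<bar> \<le> norm x) \<and> f z = norm z"
  using hahn_banach_infdist[OF subspace_single_0, of z] by simp

text \<open>A functional on the product splits into \<open>f x + g y\<close> by restriction to the
  axes. Closed linear relations are thereby recognised by their annihilating pairs, a test that is
  stable under weak limits in both coordinates.\<close>

lemma hahn_banach_closed_relation:
  fixes G :: "('a::real_normed_vector \<times> 'b::real_normed_vector) set"
  assumes G: "subspace G" "closed G"
    and xy: "\<And>f g. (\<forall>(x, y)\<in>G. blinfun_apply f x + blinfun_apply g y = (0::real)) \<Longrightarrow> f x + g y = 0"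
  shows "(x, y) \<in> G"
proof (rule hahn_banach_closed_subspace[OF G])
  fix h :: "('a \<times> 'b) \<Rightarrow>\<^sub>L real" assume h: "\<forall>p\<in>G. blinfun_apply h p = 0"
  define f where "f = Blinfun (\<lambda>x. h (x, 0))"
  define g where "g = Blinfun (\<lambda>y. h (0, y))"
  have f: "f x = h (x, 0)" for x
    unfolding f_def by (subst bounded_linear_Blinfun_apply)
      (auto intro!: bounded_linear_compose[OF blinfun.bounded_linear_right] bounded_linear_intros bounded_linear_Pair)
  have g: "g y = h (0, y)" for y
    unfolding g_def by (subst bounded_linear_Blinfun_apply)
      (auto intro!: bounded_linear_compose[OF blinfun.bounded_linear_right] bounded_linear_Pair
        bounded_linear_ident bounded_linear_zero)
  have fg: "f x + g y = h (x, y)" for x y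
    by (simp add: f g flip: blinfun.add_right)
  show "blinfun_apply h (x, y) = 0"
    using xy[of f g] h by (auto simp: fg)
qed

section \<open>Reduction of reflexivity to real scalars\<close>

text \<open>The real part by polarization, from \<open>|1 + z|^2 = 1 + 2 Re z + |z|^2\<close>; the
  formula serves real and complex scalars alike.\<close>

definition rc_re :: "'k::rc_field \<Rightarrow> real" where
  "rc_re z = ((norm (1 + z))\<^sup>2 - 1 - (norm z)\<^sup>2) / 2"

lemma rc_conj_0 [simp]: "rc_conj (0::'k::rc_field) = 0"
  using rc_conj_add[of "0::'k" 0] by simp

lemma rc_conj_minus: "rc_conj (- z) = - rc_conj (z::'k::rc_field)"
  using rc_conj_add[of z "- z"] by (simp add: eq_neg_iff_add_eq_0 add.commute)

lemma rc_conj_of_real [simp]: "rc_conj (of_real r :: 'k::rc_field) = of_real r"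
proof (cases "r = 0")
  case False
  have "of_real r * rc_conj (of_real r :: 'k) = of_real r * of_real r"
    unfolding rc_mult_conj by (simp add: scaleR_conv_of_real power2_eq_square)
  with False show ?thesis by simp
qed simp

lemma rc_conj_1 [simp]: "rc_conj (1::'k::rc_field) = 1"
  using rc_conj_of_real[of 1] by simp

lemma norm_rc_conj [simp]: "norm (rc_conj z) = norm (z::'k::rc_field)"
proof (cases "z = 0")
  case False
  have "norm (z * rc_conj z) = norm z * norm z"
    unfolding rc_mult_conj by (simp add: power2_eq_square)
  with False show ?thesis by (simp add: norm_mult)
qed simp

lemma rc_conj_conj [simp]: "rc_conj (rc_conj z) = (z::'k::rc_field)"
proof (cases "z = 0")
  case False
  have "rc_conj z * rc_conj (rc_conj z) = z * rc_conj z"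
    by (simp add: rc_mult_conj)
  moreover have "rc_conj z \<noteq> 0"
    using False by (metis norm_eq_zero norm_rc_conj)
  ultimately show ?thesis by (metis mult.commute mult_cancel_left)
qed simp

lemma of_real_rc_re: "of_real (2 * rc_re z) = z + rc_conj (z::'k::rc_field)"
proof -
  have "(of_real ((norm (1 + z))\<^sup>2) :: 'k) = (1 + z) * rc_conj (1 + z)"
    by (simp add: rc_mult_conj scaleR_conv_of_real)
  also have "\<dots> = 1 + (z + rc_conj z) + z * rc_conj z"
    by (simp add: rc_conj_add algebra_simps)
  also have "\<dots> = 1 + (z + rc_conj z) + of_real ((norm z)\<^sup>2)"
    by (simp add: rc_mult_conj scaleR_conv_of_real)
  finally have "(of_real ((norm (1 + z))\<^sup>2 - 1 - (norm z)\<^sup>2) :: 'k) = z + rc_conj z"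
    by simp
  moreover have "2 * rc_re z = (norm (1 + z))\<^sup>2 - 1 - (norm z)\<^sup>2"
    by (simp add: rc_re_def)
  ultimately show ?thesis by (simp only:)
qed

lemma rc_re_unique: "z + rc_conj z = of_real (2 * r) \<Longrightarrow> rc_re (z::'k::rc_field) = r"
  by (metis mult_left_cancel of_real_eq_iff of_real_rc_re zero_neq_numeral)

lemma rc_re_add: "rc_re (z + w) = rc_re z + rc_re (w::'k::rc_field)"
  by (rule rc_re_unique)
    (simp only: rc_conj_add distrib_left of_real_add of_real_rc_re, simp add: algebra_simps)

lemma rc_re_of_real_mult: "rc_re (of_real r * z) = r * rc_re (z::'k::rc_field)"
proof (rule rc_re_unique)
  have "of_real r * z + rc_conj (of_real r * z) = of_real r * (z + rc_conj z)"
    by (simp add: rc_conj_mult algebra_simps)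
  also have "\<dots> = of_real r * of_real (2 * rc_re z)"
    by (simp only: of_real_rc_re)
  finally show "of_real r * z + rc_conj (of_real r * z) = of_real (2 * (r * rc_re z))"
    by (simp add: algebra_simps)
qed

lemma rc_re_of_real [simp]: "rc_re (of_real r :: 'k::rc_field) = r"
  by (rule rc_re_unique) simp

lemma rc_re_scaleR: "rc_re (r *\<^sub>R z) = r * rc_re (z::'k::rc_field)"
  by (simp add: scaleR_conv_of_real rc_re_of_real_mult)

lemma abs_rc_re_le: "\<bar>rc_re z\<bar> \<le> norm (z::'k::rc_field)"
proof -
  have "norm (of_real (2 * rc_re z) :: 'k) \<le> norm z + norm (rc_conj z)"
    unfolding of_real_rc_re by (rule norm_triangle_ineq)
  then show ?thesis by simp
qed

lemma bounded_linear_rc_re: "bounded_linear (rc_re :: 'k::rc_field \<Rightarrow> real)"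
  by (rule bounded_linear_intro[where K = 1]) (auto simp: rc_re_add rc_re_scaleR abs_rc_re_le)

lemma rc_re_diff: "rc_re (z - w) = rc_re z - rc_re (w::'k::rc_field)"
  by (rule linear_diff[OF bounded_linear.linear[OF bounded_linear_rc_re]])

lemma rc_re_conj [simp]: "rc_re (rc_conj z) = rc_re (z::'k::rc_field)"
  by (rule rc_re_unique) (simp only: of_real_rc_re rc_conj_conj add.commute)

lemma rc_re_conj_mult_self: "rc_re (rc_conj z * z) = (norm (z::'k::rc_field))\<^sup>2"
  by (subst mult.commute) (simp add: rc_mult_conj scaleR_conv_of_real del: of_real_power)

text \<open>The factor \<open>rc_conj (z - w)\<close> turns the difference into its squared norm.
  Scalars that are defined through the real parts of their multiples, as in the reflexivity argument
  below, are compared in this way.\<close>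

lemma rc_eqI:
  assumes "\<And>c. rc_re (c * z) = rc_re (c * (w::'k::rc_field))"
  shows "z = w"
proof -
  have "rc_re (rc_conj (z - w) * (z - w)) = 0"
    using assms[of "rc_conj (z - w)"]
    by (simp only: right_diff_distrib rc_re_diff)
  then show ?thesis by (simp add: rc_re_conj_mult_self)
qed

text \<open>If conjugation is trivial, every element is its own real part. Otherwise some
  \<open>w - rc_conj w\<close> is nonzero and purely imaginary; scaled to norm one it is an
  imaginary unit, because \<open>i * rc_conj i = 1\<close> and
  \<open>rc_conj i = - i\<close>.\<close>

lemma rc_field_cases [case_names Real Complex]:
  obtains "\<And>z :: 'k::rc_field. z = of_real (rc_re z)"
  | i :: "'k::rc_field" where "i * i = -1" "\<And>z :: 'k::rc_field. z = of_real (rc_re z) + of_real (rc_re (- (i * z))) * i"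
proof (cases "\<forall>z :: 'k. rc_conj z = z")
  case True
  have "z = of_real (rc_re z)" for z :: 'k
    using of_real_rc_re[of z] True by (simp add: mult.commute)
  then show ?thesis by (rule that)
next
  case False
  then obtain w :: 'k where w: "rc_conj w \<noteq> w" by blast
  define d where "d = w - rc_conj w"
  define i where "i = of_real (1 / norm d) * d"
  have "d \<noteq> 0" using w by (simp add: d_def)
  have "rc_conj d = - d"
    using rc_conj_add[of w "- rc_conj w"] by (simp add: d_def rc_conj_minus)
  then have conj: "rc_conj i = - i"
    by (simp add: i_def rc_conj_mult del: of_real_divide)
  have "norm i = 1"
    using \<open>d \<noteq> 0\<close> by (simp add: i_def norm_mult norm_divide)
  then have ii: "i * i = - 1"
    using rc_mult_conj[of i] conj by (simp add: minus_equation_iff)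
  have "z = of_real (rc_re z) + of_real (rc_re (- (i * z))) * i" for z :: 'k
  proof -
    have "of_real (2 * rc_re z) + of_real (2 * rc_re (- (i * z))) * i
      = z + rc_conj z + (- (i * z) + i * rc_conj z) * i"
      by (simp only: of_real_rc_re) (simp add: rc_conj_minus rc_conj_mult conj)
    also have "\<dots> = z + rc_conj z - (i * i) * (z - rc_conj z)"
      by (simp add: algebra_simps)
    also have "\<dots> = 2 * z"
      by (simp add: ii)
    finally have "2 * (of_real (rc_re z) + of_real (rc_re (- (i * z))) * i) = 2 * z"
      by (simp add: algebra_simps)
    then show ?thesis by (metis mult_left_cancel zero_neq_numeral)
  qed
  with ii show ?thesis by (rule that)
qed

definition rc_re_blinfun :: "('a::real_normed_vector \<Rightarrow>\<^sub>L 'k::rc_field) \<Rightarrow> ('a \<Rightarrow>\<^sub>L real)" where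
  "rc_re_blinfun \<phi> = Blinfun rc_re o\<^sub>L \<phi>"

lemma rc_re_blinfun_apply [simp]: "blinfun_apply (rc_re_blinfun \<phi>) x = rc_re (blinfun_apply \<phi> x)"
  by (simp add: rc_re_blinfun_def bounded_linear_Blinfun_apply[OF bounded_linear_rc_re])

lemma norm_rc_re_blinfun: "norm (rc_re_blinfun \<phi>) \<le> norm \<phi>"
  by (rule norm_blinfun_bound)
    (auto intro: order_trans[OF abs_rc_re_le] norm_blinfun)

lemma bounded_linear_rc_re_blinfun:
  "bounded_linear (rc_re_blinfun :: ('a::real_normed_vector \<Rightarrow>\<^sub>L 'k::rc_field) \<Rightarrow> 'a \<Rightarrow>\<^sub>L real)"
proof (rule bounded_linear_intro[where K = 1])
  show "rc_re_blinfun (\<phi> + \<psi>) = rc_re_blinfun \<phi> + rc_re_blinfun \<psi>" for \<phi> \<psi> :: "'a \<Rightarrow>\<^sub>L 'k"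
    by (rule blinfun_eqI) (simp add: blinfun.add_left rc_re_add)
  show "rc_re_blinfun (c *\<^sub>R \<phi>) = c *\<^sub>R rc_re_blinfun \<phi>" for c and \<phi> :: "'a \<Rightarrow>\<^sub>L 'k"
    by (rule blinfun_eqI) (simp add: blinfun.scaleR_left rc_re_scaleR)
qed (use norm_rc_re_blinfun in simp)

lemma norm_smul_functional:
  fixes \<phi> :: "'a::real_normed_vector \<Rightarrow>\<^sub>L 'k::rc_field"
  shows "norm (blinfun_mult_right c o\<^sub>L \<phi>) \<le> norm c * norm \<phi>"
proof (rule norm_blinfun_bound)
  fix x
  have "norm (c * blinfun_apply \<phi> x) \<le> norm c * (norm \<phi> * norm x)"
    unfolding norm_mult by (intro mult_left_mono norm_blinfun) simp
  then show "norm (blinfun_apply (blinfun_mult_right c o\<^sub>L \<phi>) x) \<le> norm c * norm \<phi> * norm x"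
    by (simp add: mult.assoc)
qed simp

lemma dual_space_scaleR [simp]: "dual_space (scaleR :: real \<Rightarrow> 'a::real_normed_vector \<Rightarrow> 'a) = UNIV"
  by (auto simp: dual_space_def blinfun.scaleR_right)

context rc_normed_space
begin

lemma bounded_linear_smul: "bounded_linear (smul c)"
  by (rule bounded_linear_intro[where K = "norm c"])
    (auto simp: scale_right_distrib norm_smul mult.commute scale_left_commute simp flip: smul_of_real)

text \<open>A complex functional is recovered from its real part \<open>u\<close> as \<open>u(x) - i u(i x)\<close>.\<close>

lemma dual_space_real_part:
  fixes u :: "'a \<Rightarrow>\<^sub>L real"
  shows "\<exists>\<phi>\<in>dual_space smul. \<forall>x. rc_re (blinfun_apply \<phi> x) = u x"
proof (cases rule: rc_field_cases[where 'k = 'k])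
  case Real
  have bl: "bounded_linear (\<lambda>x. of_real (u x) :: 'k)"
    by (intro bounded_linear_compose[OF bounded_linear_of_real] blinfun.bounded_linear_right)
  define \<phi> where "\<phi> = Blinfun (\<lambda>x. of_real (u x) :: 'k)"
  have \<phi>: "blinfun_apply \<phi> x = of_real (u x)" for x
    unfolding \<phi>_def by (simp add: bounded_linear_Blinfun_apply bl)
  have "u (smul c x) = rc_re c * u x" for c x
    using Real[of c] by (metis smul_of_real blinfun.scaleR_right real_scaleR_def)
  then have "blinfun_apply \<phi> (smul c x) = c * blinfun_apply \<phi> x" for c x
    using Real[of c] by (metis \<phi> of_real_mult)
  then show ?thesis
    by (intro bexI[of _ \<phi>]) (auto simp: \<phi> dual_space_def)
next
  case (Complex i)
  have bl: "bounded_linear (\<lambda>x. of_real (u x) - of_real (u (smul i x)) * i)"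
    by (intro bounded_linear_sub bounded_linear_compose[OF bounded_linear_of_real]
        bounded_linear_compose[OF bounded_linear_mult_left]
        bounded_linear_compose[OF blinfun.bounded_linear_right bounded_linear_smul]
        blinfun.bounded_linear_right)
  define \<phi> where "\<phi> = Blinfun (\<lambda>x. of_real (u x) - of_real (u (smul i x)) * i)"
  have \<phi>: "blinfun_apply \<phi> x = of_real (u x) - of_real (u (smul i x)) * i" for x
    unfolding \<phi>_def by (simp add: bounded_linear_Blinfun_apply bl)
  \<comment> \<open>Since \<open>- (i * i) = 1\<close>, the decomposition of \<open>i\<close> itself
    reads \<open>i = rc_re i + i\<close>, so its real part vanishes.\<close>
  have "i = of_real (rc_re i) + of_real (rc_re (- (i * i))) * i"
    by (rule Complex(2))
  then have "rc_re i = 0"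
    using rc_re_of_real[of 1, where 'k = 'k] by (simp add: Complex(1))
  then have re: "rc_re (blinfun_apply \<phi> x) = u x" for x
    by (simp add: \<phi> rc_re_diff rc_re_of_real_mult)
  have real: "blinfun_apply \<phi> (r *\<^sub>R x) = of_real r * blinfun_apply \<phi> x" for r x
    by (simp add: blinfun.scaleR_right scaleR_conv_of_real)
  have imag: "blinfun_apply \<phi> (smul i x) = i * blinfun_apply \<phi> x" for x
  proof -
    have "smul i (smul i x) = - x"
      by (simp add: Complex(1))
    then have "blinfun_apply \<phi> (smul i x) = of_real (u (smul i x)) + of_real (u x) * i"
      by (simp add: \<phi> blinfun.minus_right)
    also have "\<dots> = i * of_real (u x) - (i * i) * of_real (u (smul i x))"
      by (simp add: Complex(1))
    also have "\<dots> = i * blinfun_apply \<phi> x"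
      by (simp add: \<phi> algebra_simps)
    finally show ?thesis .
  qed
  have "blinfun_apply \<phi> (smul c x) = c * blinfun_apply \<phi> x" for c x
  proof -
    define a b where "a = rc_re c" and "b = rc_re (- (i * c))"
    have c: "c = of_real a + of_real b * i"
      unfolding a_def b_def by (rule Complex(2))
    have "smul c x = a *\<^sub>R x + b *\<^sub>R smul i x"
      unfolding c by (simp add: scale_left_distrib flip: smul_of_real)
    then have "blinfun_apply \<phi> (smul c x) = of_real a * blinfun_apply \<phi> x + of_real b * (i * blinfun_apply \<phi> x)"
      by (simp add: blinfun.add_right real imag)
    also have "\<dots> = c * blinfun_apply \<phi> x"
      unfolding c by (simp add: algebra_simps)
    finally show ?thesis .
  qed
  with re show ?thesis
    by (intro bexI[of _ \<phi>]) (auto simp: dual_space_def)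
qed

lemma smul_dual_space: "\<phi> \<in> dual_space smul \<Longrightarrow> blinfun_mult_right c o\<^sub>L \<phi> \<in> dual_space smul"
  by (simp add: dual_space_def mult.left_commute)

text \<open>A real bidual element \<open>\<Phi>\<close> is lifted to a scalar-valued
  \<open>\<Psi>\<close>, determined by requiring that the real part of
  \<open>c * \<Psi> \<phi>\<close> is \<open>\<Phi>\<close> at the real part of
  \<open>c \<phi>\<close>. Reflexivity represents \<open>\<Psi>\<close> by a point, and as every
  real functional is the real part of an element of the dual, the same point represents
  \<open>\<Phi>\<close>.\<close>

lemma real_reflexive:
  assumes refl: "reflexive_space smul"
  shows "reflexive_space (scaleR :: real \<Rightarrow> 'a \<Rightarrow> 'a)"
  unfolding reflexive_space_def dual_space_scaleR
proof (intro allI impI, elim conjE exE)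
  fix \<Phi> :: "('a \<Rightarrow>\<^sub>L real) \<Rightarrow> real" and C
  assume add: "\<forall>\<phi>\<in>UNIV. \<forall>\<psi>\<in>UNIV. \<Phi> (\<phi> + \<psi>) = \<Phi> \<phi> + \<Phi> \<psi>"
    and scale: "\<forall>c. \<forall>\<phi>\<in>UNIV. \<Phi> (blinfun_mult_right c o\<^sub>L \<phi>) = c * \<Phi> \<phi>"
    and bound: "\<forall>\<phi>\<in>UNIV. norm (\<Phi> \<phi>) \<le> C * norm \<phi>"
  have scale': "\<Phi> (c *\<^sub>R \<phi>) = c * \<Phi> \<phi>" for c \<phi>
  proof -
    have "blinfun_mult_right c o\<^sub>L \<phi> = c *\<^sub>R \<phi>"
      by (rule blinfun_eqI) (simp add: blinfun.scaleR_left)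
    moreover have "\<Phi> (blinfun_mult_right c o\<^sub>L \<phi>) = c * \<Phi> \<phi>"
      using scale by blast
    ultimately show ?thesis by (simp only:)
  qed
  have C: "\<bar>\<Phi> \<phi>\<bar> \<le> \<bar>C\<bar> * norm \<phi>" for \<phi>
    using bound mult_right_mono[of C "\<bar>C\<bar>" "norm \<phi>"] by (force intro: order_trans)
  \<comment> \<open>The scalar field is regarded as a normed space over itself, so that rebuilding a
    functional \<open>\<theta>\<close> from its real part also yields the values of
    \<open>\<Psi>\<close>, namely \<open>\<theta> 1\<close>.\<close>
  interpret K: rc_normed_space "(*) :: 'k \<Rightarrow> 'k \<Rightarrow> 'k"
    by (rule rc_normed_space_mult)
  have ex: "\<forall>\<phi> :: 'a \<Rightarrow>\<^sub>L 'k. \<exists>z :: 'k. \<forall>c. rc_re (c * z) = \<Phi> (rc_re_blinfun (blinfun_mult_right c o\<^sub>L \<phi>))"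
  proof
    fix \<phi> :: "'a \<Rightarrow>\<^sub>L 'k"
    let ?u = "\<lambda>c. \<Phi> (rc_re_blinfun (blinfun_mult_right c o\<^sub>L \<phi>))"
    have "bounded_linear ?u"
    proof (rule bounded_linear_intro[where K = "\<bar>C\<bar> * norm \<phi>"])
      fix c d :: 'k and r
      have "rc_re_blinfun (blinfun_mult_right (c + d) o\<^sub>L \<phi>)
        = rc_re_blinfun (blinfun_mult_right c o\<^sub>L \<phi>) + rc_re_blinfun (blinfun_mult_right d o\<^sub>L \<phi>)"
        by (rule blinfun_eqI) (simp add: blinfun.add_left rc_re_add algebra_simps)
      then show "?u (c + d) = ?u c + ?u d"
        using add by simp
      have "rc_re_blinfun (blinfun_mult_right (r *\<^sub>R c) o\<^sub>L \<phi>)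
        = r *\<^sub>R rc_re_blinfun (blinfun_mult_right c o\<^sub>L \<phi>)"
        by (rule blinfun_eqI) (simp add: blinfun.scaleR_left rc_re_scaleR)
      then show "?u (r *\<^sub>R c) = r *\<^sub>R ?u c"
        by (simp add: scale')
      have "norm (rc_re_blinfun (blinfun_mult_right c o\<^sub>L \<phi>)) \<le> norm c * norm \<phi>"
        by (rule order_trans[OF norm_rc_re_blinfun norm_smul_functional])
      then have "\<bar>C\<bar> * norm (rc_re_blinfun (blinfun_mult_right c o\<^sub>L \<phi>)) \<le> \<bar>C\<bar> * (norm c * norm \<phi>)"
        by (rule mult_left_mono) simp
      with C[of "rc_re_blinfun (blinfun_mult_right c o\<^sub>L \<phi>)"]
      show "norm (?u c) \<le> norm c * (\<bar>C\<bar> * norm \<phi>)" by (simp add: mult.left_commute)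
    qed
    then have u: "blinfun_apply (Blinfun ?u) = ?u"
      by (rule bounded_linear_Blinfun_apply)
    obtain \<theta> where \<theta>: "\<theta> \<in> dual_space ((*) :: 'k \<Rightarrow> 'k \<Rightarrow> 'k)"
      "\<forall>c. rc_re (blinfun_apply \<theta> c) = blinfun_apply (Blinfun ?u) c"
      using K.dual_space_real_part by blast
    have "blinfun_apply \<theta> (c * 1) = c * blinfun_apply \<theta> 1" for c
      using \<theta>(1) unfolding dual_space_def by blast
    then have "rc_re (c * blinfun_apply \<theta> 1) = ?u c" for c
      using \<theta>(2)[rule_format, of c] unfolding u by (metis mult.right_neutral)
    then show "\<exists>z :: 'k. \<forall>c. rc_re (c * z) = ?u c" by blast
  qed
  obtain \<Psi> :: "('a \<Rightarrow>\<^sub>L 'k) \<Rightarrow> 'k"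
    where \<Psi>': "\<forall>\<phi> c. rc_re (c * \<Psi> \<phi>) = \<Phi> (rc_re_blinfun (blinfun_mult_right c o\<^sub>L \<phi>))"
    using choice[OF ex] by blast
  note \<Psi> = \<Psi>'[rule_format]
  have "\<Psi> (\<phi> + \<psi>) = \<Psi> \<phi> + \<Psi> \<psi>" for \<phi> \<psi>
  proof (rule rc_eqI)
    fix c
    have "rc_re_blinfun (blinfun_mult_right c o\<^sub>L (\<phi> + \<psi>))
        = rc_re_blinfun (blinfun_mult_right c o\<^sub>L \<phi>) + rc_re_blinfun (blinfun_mult_right c o\<^sub>L \<psi>)"
      by (rule blinfun_eqI) (simp add: blinfun.add_left rc_re_add algebra_simps)
    then show "rc_re (c * \<Psi> (\<phi> + \<psi>)) = rc_re (c * (\<Psi> \<phi> + \<Psi> \<psi>))"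
      using add by (simp add: \<Psi> distrib_left rc_re_add)
  qed
  moreover have "\<Psi> (blinfun_mult_right d o\<^sub>L \<phi>) = d * \<Psi> \<phi>" for d \<phi>
  proof (rule rc_eqI)
    fix c
    have "blinfun_mult_right c o\<^sub>L (blinfun_mult_right d o\<^sub>L \<phi>) = blinfun_mult_right (c * d) o\<^sub>L \<phi>"
      by (rule blinfun_eqI) (simp add: mult.assoc)
    then show "rc_re (c * \<Psi> (blinfun_mult_right d o\<^sub>L \<phi>)) = rc_re (c * (d * \<Psi> \<phi>))"
      by (simp add: \<Psi> flip: mult.assoc)
  qed
  moreover have "norm (\<Psi> \<phi>) \<le> \<bar>C\<bar> * norm \<phi>" for \<phi>
  proof (cases "\<Psi> \<phi> = 0")
    case False
    \<comment> \<open>With this factor the real part becomes the squared norm of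
      \<open>\<Psi> \<phi>\<close>; one factor cancels and the bound carries over with the constant
      \<open>\<bar>C\<bar>\<close>.\<close>
    define c where "c = rc_conj (\<Psi> \<phi>)"
    have "norm (rc_re_blinfun (blinfun_mult_right c o\<^sub>L \<phi>)) \<le> norm c * norm \<phi>"
      by (rule order_trans[OF norm_rc_re_blinfun norm_smul_functional])
    then have "\<bar>C\<bar> * norm (rc_re_blinfun (blinfun_mult_right c o\<^sub>L \<phi>)) \<le> \<bar>C\<bar> * (norm c * norm \<phi>)"
      by (rule mult_left_mono) simp
    moreover have "(norm (\<Psi> \<phi>))\<^sup>2 \<le> \<bar>C\<bar> * norm (rc_re_blinfun (blinfun_mult_right c o\<^sub>L \<phi>))"
      using C[of "rc_re_blinfun (blinfun_mult_right c o\<^sub>L \<phi>)"]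
      by (simp add: c_def flip: \<Psi> rc_re_conj_mult_self)
    ultimately have "norm (\<Psi> \<phi>) * norm (\<Psi> \<phi>) \<le> norm (\<Psi> \<phi>) * (\<bar>C\<bar> * norm \<phi>)"
      by (simp add: c_def power2_eq_square mult.left_commute)
    with False show ?thesis by simp
  qed simp
  ultimately have "\<exists>x. \<forall>\<phi>\<in>dual_space smul. \<Psi> \<phi> = blinfun_apply \<phi> x"
    using refl[unfolded reflexive_space_def, rule_format, of \<Psi>] by blast
  then obtain x where x: "\<And>\<phi>. \<phi> \<in> dual_space smul \<Longrightarrow> \<Psi> \<phi> = blinfun_apply \<phi> x"
    by blast
  have "\<Phi> u = u x" for u
  proof -
    obtain \<phi> where \<phi>: "\<phi> \<in> dual_space smul" "\<And>x. rc_re (blinfun_apply \<phi> x) = u x"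
      using dual_space_real_part[of u] by blast
    then have "rc_re_blinfun (blinfun_mult_right 1 o\<^sub>L \<phi>) = u"
      by (intro blinfun_eqI) simp
    then show ?thesis
      using \<Psi>[of 1 \<phi>] x[OF \<phi>(1)] \<phi>(2) by simp
  qed
  then show "\<exists>x. \<forall>\<phi>\<in>UNIV. \<Phi> \<phi> = blinfun_apply \<phi> x" by blast
qed

end

section \<open>Riesz representation and reflexivity of Hilbert spaces\<close>

lemma real_hilbert_space:
  assumes "rc_normed_space (smul :: 'k::rc_field \<Rightarrow> 'a::banach \<Rightarrow> 'a)" "hilbert_space smul"
  shows "hilbert_space (scaleR :: real \<Rightarrow> 'a \<Rightarrow> 'a)"
proof -
  interpret rc_normed_space smul by fact
  obtain ip :: "'a \<Rightarrow> 'a \<Rightarrow> 'k" where ip: "\<And>x y z. ip (x + y) z = ip x z + ip y z"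
    "\<And>c x y. ip (smul c x) y = c * ip x y" "\<And>x y. ip y x = rc_conj (ip x y)"
    "\<And>x. ip x x = of_real ((norm x)\<^sup>2)"
    using assms(2) unfolding hilbert_space_def by blast
  have "ip (c *\<^sub>R x) y = of_real c * ip x y" for c x y
    by (simp add: ip(2) flip: smul_of_real)
  then have scale: "rc_re (ip (c *\<^sub>R x) y) = c * rc_re (ip x y)" for c x y
    by (simp only: rc_re_of_real_mult)
  have add: "rc_re (ip (x + y) z) = rc_re (ip x z) + rc_re (ip y z)" for x y z
    by (simp only: ip(1) rc_re_add)
  have sym: "rc_re (ip y x) = rc_re (ip x y)" for x y
    by (subst ip(3)) (rule rc_re_conj)
  have self: "rc_re (ip x x) = (norm x)\<^sup>2" for x
    by (simp only: ip(4) rc_re_of_real)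
  show ?thesis
    unfolding hilbert_space_def rc_conj_real_def of_real_eq_id id_apply
    by (intro exI[of _ "\<lambda>x y. rc_re (ip x y)"] conjI allI) (fact add scale sym self)+
qed

text \<open>The representing vector minimises \<open>|x|^2 - 2 u x\<close>. The parallelogram
  identity makes a minimising sequence Cauchy, and the vanishing first variation at its limit is the
  representation.\<close>

lemma riesz_representation:
  fixes u :: "'a::banach \<Rightarrow>\<^sub>L real" and ip :: "'a \<Rightarrow> 'a \<Rightarrow> real"
  assumes add: "\<And>x y z. ip (x + y) z = ip x z + ip y z"
    and scale: "\<And>c x y. ip (c *\<^sub>R x) y = c * ip x y"
    and sym: "\<And>x y. ip y x = ip x y"
    and self: "\<And>x. ip x x = (norm x)\<^sup>2"
  shows "\<exists>x. \<forall>y. u y = ip x y"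
proof -
  have norm_add: "(norm (x + y))\<^sup>2 = (norm x)\<^sup>2 + 2 * ip x y + (norm y)\<^sup>2" for x y
    unfolding self[symmetric]
    using sym[of x y] sym[of x "x + y"] sym[of y "x + y"] add[of x y "x + y"] add[of x y x] add[of x y y]
    by linarith
  have scale2: "ip x (c *\<^sub>R y) = c * ip x y" for c x y
    using scale sym by metis
  define J where "J x = (norm x)\<^sup>2 - 2 * u x" for x
  \<comment> \<open>Completing the square: \<open>J x\<close> is at least
    \<open>(|x| - |u|)^2 - |u|^2\<close>.\<close>
  have J_ge: "- (norm u)\<^sup>2 \<le> J x" for x
  proof -
    have "0 \<le> (norm x - norm u)\<^sup>2" by simp
    moreover have "u x \<le> norm u * norm x"
      using norm_blinfun[of u x] by simp
    ultimately show ?thesis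
      by (simp add: J_def power2_diff algebra_simps)
  qed
  define m where "m = (INF x. J x)"
  have m_le: "m \<le> J x" for x
    unfolding m_def by (intro cINF_lower bdd_belowI2[OF J_ge]) simp
  have "\<exists>x. J x < m + inverse (real (Suc n))" for n
  proof (rule ccontr)
    assume "\<not> ?thesis"
    then have "m + inverse (real (Suc n)) \<le> m"
      by (subst (2) m_def, intro cINF_greatest) (auto simp: not_less)
    moreover have "0 < inverse (real (Suc n))" by simp
    ultimately show False by linarith
  qed
  then obtain X where X: "\<And>n. J (X n) < m + inverse (real (Suc n))" by metis
  have parallelogram: "(norm (x - y))\<^sup>2 \<le> 2 * (J x - m) + 2 * (J y - m)" for x y
  proof -
    have p1: "(norm (x - y))\<^sup>2 = (norm x)\<^sup>2 - 2 * ip x y + (norm y)\<^sup>2"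
      using norm_add[of x "- y"] scale2[of x "-1" y] by simp
    have p2: "(norm ((1/2) *\<^sub>R (x + y)))\<^sup>2 = (norm (x + y))\<^sup>2 / 4"
      by (simp add: power_divide)
    have p3: "u ((1/2) *\<^sub>R (x + y)) = (u x + u y) / 2"
      by (simp add: blinfun.scaleR_right blinfun.add_right del: scaleR_right_distrib)
    have "(norm (x - y))\<^sup>2 = 2 * J x + 2 * J y - 4 * J ((1/2) *\<^sub>R (x + y))"
      unfolding J_def p1 p2 p3 norm_add[of x y] by (simp add: field_simps)
    with m_le[of "(1/2) *\<^sub>R (x + y)"] show ?thesis by simp
  qed
  have "Cauchy X"
  proof (rule metric_CauchyI)
    fix e :: real assume e: "e > 0"
    obtain N where N: "inverse (real (Suc N)) < e\<^sup>2 / 4"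
      using e reals_Archimedean[of "e\<^sup>2 / 4"] by auto
    have small: "J (X n) - m < e\<^sup>2 / 4" if "n \<ge> N" for n
    proof -
      have "inverse (real (Suc n)) \<le> inverse (real (Suc N))"
        using that by (simp add: field_simps)
      with N X[of n] show ?thesis by linarith
    qed
    have "dist (X n) (X k) < e" if "n \<ge> N" "k \<ge> N" for n k
    proof -
      have "(norm (X n - X k))\<^sup>2 < e\<^sup>2"
        using parallelogram[of "X n" "X k"] small[OF that(1)] small[OF that(2)] by (simp add: field_simps)
      with e show ?thesis
        by (simp add: dist_norm power_less_imp_less_base)
    qed
    then show "\<exists>M. \<forall>m\<ge>M. \<forall>n\<ge>M. dist (X m) (X n) < e" by blast
  qed
  then obtain x where x: "X \<longlonglongrightarrow> x"
    using Cauchy_convergent convergent_def by blast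
  have "(\<lambda>n. J (X n)) \<longlonglongrightarrow> J x"
    unfolding J_def by (intro tendsto_intros x)
  moreover have "(\<lambda>n. m + inverse (real (Suc n))) \<longlonglongrightarrow> m + 0"
    by (intro tendsto_intros LIMSEQ_inverse_real_of_nat)
  ultimately have Jx: "J x \<le> m"
    using X by (auto intro: LIMSEQ_le less_imp_le)
  have "u y = ip x y" for y
  proof -
    define c where "c = ip x y - u y"
    \<comment> \<open>The summand 1 keeps the divisor positive even for \<open>y = 0\<close>. With
      the step \<open>s = - c / N\<close> minimality yields \<open>s * s * (N + 1) \<le> 0\<close>,
      so \<open>s\<close> and with it \<open>c\<close> vanish.\<close>
    define N where "N = (norm y)\<^sup>2 + 1"
    define s where "s = - c / N"
    have "N > 0" by (simp add: N_def add_nonneg_pos)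
    have "J x \<le> J (x + s *\<^sub>R y)"
      using Jx m_le order_trans by blast
    then have *: "0 \<le> s * s * (norm y)\<^sup>2 + 2 * (s * c)"
      unfolding J_def norm_add
      by (simp add: scale2 blinfun.add_right blinfun.scaleR_right c_def power2_eq_square algebra_simps)
    have sc: "s * c = - (s * s * N)"
      using \<open>N > 0\<close> by (simp add: s_def field_simps)
    have "s * s * (N + 1) \<le> 0"
      using * unfolding sc by (simp add: N_def algebra_simps)
    then have "s = 0"
      using \<open>N > 0\<close> by (auto simp: mult_le_0_iff)
    with \<open>N > 0\<close> show ?thesis by (simp add: s_def c_def)
  qed
  then show ?thesis by blast
qed

text \<open>Riesz representation is used twice: it identifies the dual with the space, so that a
  bidual element becomes a functional on the space, and this functional is represented
  again.\<close>

lemma hilbert_space_reflexive: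
  assumes "hilbert_space (scaleR :: real \<Rightarrow> 'a::banach \<Rightarrow> 'a)"
  shows "reflexive_space (scaleR :: real \<Rightarrow> 'a \<Rightarrow> 'a)"
proof -
  obtain ip :: "'a \<Rightarrow> 'a \<Rightarrow> real" where ip: "\<And>x y z. ip (x + y) z = ip x z + ip y z"
    "\<And>c x y. ip (c *\<^sub>R x) y = c * ip x y" "\<And>x y. ip y x = ip x y" "\<And>x. ip x x = (norm x)\<^sup>2"
    using assms unfolding hilbert_space_def rc_conj_real_def of_real_eq_id id_apply by blast
  note riesz = riesz_representation[of ip, OF ip]
  have ip_add2: "ip z (x + y) = ip z x + ip z y" and ip_scale2: "ip z (c *\<^sub>R x) = c * ip z x" for x y z c
    using ip(1,2,3) by metis+
  have cauchy_schwarz: "\<bar>ip x y\<bar> \<le> norm x * norm y" for x y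
  proof (cases "x = 0")
    case True
    then show ?thesis using ip(2)[of 0 0 y] by simp
  next
    case False
    \<comment> \<open>A multiple of the part of \<open>y\<close> orthogonal to \<open>x\<close>,
      scaled so that no division occurs; its squared norm is nonnegative.\<close>
    have "ip (ip x y *\<^sub>R x - (norm x)\<^sup>2 *\<^sub>R y) (ip x y *\<^sub>R x - (norm x)\<^sup>2 *\<^sub>R y)
      = (norm x)\<^sup>2 * ((norm x)\<^sup>2 * (norm y)\<^sup>2 - (ip x y)\<^sup>2)"
    proof -
      have d: "ip (a - b) c = ip a c - ip b c" "ip c (a - b) = ip c a - ip c b" for a b c
        using ip(1)[of "a - b" b c] ip_add2[of c "a - b" b] by simp_all
      show ?thesis
        using ip(3)[of x y] by (simp only: d ip(2) ip_scale2) (simp add: ip(4) power2_eq_square algebra_simps)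
    qed
    then have "0 \<le> (norm x)\<^sup>2 * ((norm x)\<^sup>2 * (norm y)\<^sup>2 - (ip x y)\<^sup>2)"
      unfolding ip(4) by (metis zero_le_power2)
    then have "(ip x y)\<^sup>2 \<le> (norm x * norm y)\<^sup>2"
      using False by (simp add: zero_le_mult_iff power_mult_distrib)
    then show ?thesis
      by (metis abs_le_square_iff abs_mult abs_norm_cancel)
  qed
  have bl: "bounded_linear (ip x)" for x
    by (rule bounded_linear_intro[where K = "norm x"])
      (use cauchy_schwarz[of x] in \<open>auto simp: ip_add2 ip_scale2 mult.commute[of _ "norm x"]\<close>)
  then have B: "blinfun_apply (Blinfun (ip x)) y = ip x y" for x y
    by (simp add: bounded_linear_Blinfun_apply)
  show ?thesis
    unfolding reflexive_space_def dual_space_scaleR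
  proof (intro allI impI, elim conjE exE)
    fix \<Phi> :: "('a \<Rightarrow>\<^sub>L real) \<Rightarrow> real" and C
    assume add: "\<forall>\<phi>\<in>UNIV. \<forall>\<psi>\<in>UNIV. \<Phi> (\<phi> + \<psi>) = \<Phi> \<phi> + \<Phi> \<psi>"
      and scale: "\<forall>c. \<forall>\<phi>\<in>UNIV. \<Phi> (blinfun_mult_right c o\<^sub>L \<phi>) = c * \<Phi> \<phi>"
      and bound: "\<forall>\<phi>\<in>UNIV. norm (\<Phi> \<phi>) \<le> C * norm \<phi>"
    let ?u = "\<lambda>y. \<Phi> (Blinfun (ip y))"
    have "bounded_linear ?u"
    proof (rule bounded_linear_intro[where K = "\<bar>C\<bar>"])
      fix x y r
      have "Blinfun (ip (x + y)) = Blinfun (ip x) + Blinfun (ip y)"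
        by (rule blinfun_eqI) (simp add: B blinfun.add_left ip(1))
      then show "?u (x + y) = ?u x + ?u y"
        using add by simp
      have "Blinfun (ip (r *\<^sub>R x)) = blinfun_mult_right r o\<^sub>L Blinfun (ip x)"
        by (rule blinfun_eqI) (simp add: B ip(2))
      then show "?u (r *\<^sub>R x) = r *\<^sub>R ?u x"
        using scale by simp
      have "norm (Blinfun (ip x)) \<le> norm x"
        by (rule norm_blinfun_bound) (use cauchy_schwarz in \<open>auto simp: B\<close>)
      then have "\<bar>C\<bar> * norm (Blinfun (ip x)) \<le> norm x * \<bar>C\<bar>"
        by (metis abs_ge_zero mult.commute mult_left_mono)
      moreover have "norm (?u x) \<le> C * norm (Blinfun (ip x))"
        using bound by blast
      moreover have "\<dots> \<le> \<bar>C\<bar> * norm (Blinfun (ip x))"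
        by (intro mult_right_mono) auto
      ultimately show "norm (?u x) \<le> norm x * \<bar>C\<bar>" by linarith
    qed
    then have u: "blinfun_apply (Blinfun ?u) = ?u"
      by (rule bounded_linear_Blinfun_apply)
    obtain x where x: "\<forall>y. blinfun_apply (Blinfun ?u) y = ip x y"
      using riesz by blast
    have "\<Phi> \<phi> = \<phi> x" for \<phi>
    proof -
      obtain y where y: "\<forall>z. \<phi> z = ip y z"
        using riesz by blast
      then have "\<phi> = Blinfun (ip y)"
        by (intro blinfun_eqI) (simp add: B)
      then have "\<Phi> \<phi> = ip x y"
        using x[rule_format, of y] unfolding u by simp
      then show ?thesis using y ip(3)[of x y] by simp
    qed
    then show "\<exists>x. \<forall>\<phi>\<in>UNIV. \<Phi> \<phi> = blinfun_apply \<phi> x" by blast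
  qed
qed

section \<open>Weak limits along fine filters\<close>

text \<open>A fine filter is as good as a free ultrafilter: the limits of \<open>\<phi>(x n)\<close> along it form an element
  of the bidual, so reflexivity yields weak limits without passing to subsequences, and separability
  is not needed.\<close>

definition fine_filter :: "nat filter \<Rightarrow> bool" where
  "fine_filter G \<longleftrightarrow> G \<noteq> bot \<and> (\<forall>c :: nat \<Rightarrow> real. bounded (range c) \<longrightarrow> (\<exists>l. (c \<longlongrightarrow> l) G))"

text \<open>Tychonoff's theorem handles all bounded sequences at once: \<open>n\<close> is sent to
  the family of all values \<open>c n\<close>, which lies in a product of compact intervals. A
  cluster point of this map along \<open>F\<close> becomes a limit when the preimages of its
  neighbourhoods are added to the filter.\<close>

lemma exists_fine_filter:
  fixes F :: "nat filter"
  assumes F: "F \<noteq> bot"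
  shows "\<exists>G. fine_filter G \<and> G \<le> F"
proof -
  define B :: "(nat \<Rightarrow> real) \<Rightarrow> real" where "B c = (SOME B. \<forall>n. \<bar>c n\<bar> \<le> B)" for c
  define X where "X = {c :: nat \<Rightarrow> real. bounded (range c)}"
  \<comment> \<open>Unbounded sequences get the constant coordinate 0, so that every factor of the
    product is compact.\<close>
  define e :: "nat \<Rightarrow> (nat \<Rightarrow> real) \<Rightarrow> real" where "e n c = (if c \<in> X then c n else 0)" for n c
  define S :: "((nat \<Rightarrow> real) \<Rightarrow> real) set" where
    "S = PiE UNIV (\<lambda>c. if c \<in> X then {- B c..B c} else {0})"
  have B: "\<bar>c n\<bar> \<le> B c" if c: "c \<in> X" for c n
  proof -
    have "\<exists>B. \<forall>n. \<bar>c n\<bar> \<le> B"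
      using c by (auto simp: X_def bounded_iff)
    then have "\<forall>n. \<bar>c n\<bar> \<le> B c"
      unfolding B_def by (rule someI_ex)
    then show ?thesis by blast
  qed
  have "compactin (product_topology (\<lambda>_. euclidean) UNIV) S"
    unfolding S_def compactin_PiE by (auto simp: compactin_euclidean_iff)
  then have "compact S"
    by (simp add: euclidean_product_topology compactin_euclidean_iff)
  moreover have "filtermap e F \<noteq> bot"
    using F by (simp add: filtermap_bot_iff)
  moreover have "e n \<in> S" for n
    using B by (force simp: S_def e_def PiE_iff abs_le_iff minus_le_iff)
  then have "eventually (\<lambda>x. x \<in> S) (filtermap e F)"
    by (simp add: eventually_filtermap)
  ultimately obtain x where x: "inf (nhds x) (filtermap e F) \<noteq> bot"
    unfolding compact_filter by blast
  define G where "G = inf F (filtercomap e (nhds x))"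
  \<comment> \<open>If the refined filter were improper, \<open>e\<close> would eventually avoid a
    neighbourhood of \<open>x\<close> on a set of the filter \<open>F\<close>, against the choice of
    \<open>x\<close> as a cluster point.\<close>
  have "G \<noteq> bot"
  proof
    assume "G = bot"
    then obtain P Q where P: "eventually P F" and Q: "eventually Q (filtercomap e (nhds x))"
      and PQ: "\<And>n. P n \<Longrightarrow> Q n \<Longrightarrow> False"
      unfolding G_def trivial_limit_def eventually_inf by blast
    from Q obtain R where R: "eventually R (nhds x)" "\<And>n. R (e n) \<Longrightarrow> Q n"
      unfolding eventually_filtercomap by blast
    have "eventually (\<lambda>y. \<not> R y) (filtermap e F)"
      unfolding eventually_filtermap using P by eventually_elim (use PQ R(2) in blast)
    with R(1) have "eventually (\<lambda>_. False) (inf (nhds x) (filtermap e F))"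
      unfolding eventually_inf by blast
    with x show False by (simp add: trivial_limit_def)
  qed
  moreover have "\<exists>l. (c \<longlongrightarrow> l) G" if "bounded (range c)" for c :: "nat \<Rightarrow> real"
  proof -
    have lim: "filterlim e (nhds x) G"
      unfolding G_def by (rule filterlim_mono[OF filterlim_filtercomap]) auto
    have "((\<lambda>n. e n c) \<longlongrightarrow> x c) G"
    proof (rule topological_tendstoI)
      fix U :: "real set" assume U: "open U" "x c \<in> U"
      have "open ((\<lambda>y :: (nat \<Rightarrow> real) \<Rightarrow> real. y c) -` U)"
        by (intro open_vimage U continuous_on_product_coordinates)
      then show "eventually (\<lambda>n. e n c \<in> U) G"
        using topological_tendstoD[OF lim] U(2) by fastforce
    qed
    with that show ?thesis
      by (auto simp: e_def X_def)
  qed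
  ultimately show ?thesis
    by (intro exI[of _ G]) (auto simp: fine_filter_def G_def)
qed

lemma fine_filter_nontrivial: "fine_filter G \<Longrightarrow> G \<noteq> bot"
  by (simp add: fine_filter_def)

lemma weak_limit_exists:
  fixes x :: "nat \<Rightarrow> 'a::banach"
  assumes refl: "reflexive_space (scaleR :: real \<Rightarrow> 'a \<Rightarrow> 'a)"
    and G: "fine_filter G" and B: "\<And>n. norm (x n) \<le> B"
  shows "\<exists>y. \<forall>\<phi> :: 'a \<Rightarrow>\<^sub>L real. ((\<lambda>n. \<phi> (x n)) \<longlongrightarrow> \<phi> y) G"
proof -
  have bound: "\<bar>\<phi> (x n)\<bar> \<le> B * norm \<phi>" for \<phi> :: "'a \<Rightarrow>\<^sub>L real" and n
    using norm_blinfun[of \<phi> "x n"] mult_right_mono[OF B[of n], of "norm \<phi>"]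
    by (simp add: mult.commute)
  have "bounded (range (\<lambda>n. \<phi> (x n)))" for \<phi> :: "'a \<Rightarrow>\<^sub>L real"
    using bound[of \<phi>] by (auto simp: bounded_iff)
  then have "\<forall>\<phi> :: 'a \<Rightarrow>\<^sub>L real. \<exists>l. ((\<lambda>n. \<phi> (x n)) \<longlongrightarrow> l) G"
    using G by (auto simp: fine_filter_def)
  from choice[OF this] obtain \<Phi> :: "('a \<Rightarrow>\<^sub>L real) \<Rightarrow> real"
    where \<Phi>: "\<And>\<phi>. ((\<lambda>n. blinfun_apply \<phi> (x n)) \<longlongrightarrow> \<Phi> \<phi>) G"
    by blast
  have uniq: "\<Phi> \<phi> = l" if "((\<lambda>n. \<phi> (x n)) \<longlongrightarrow> l) G" for \<phi> :: "'a \<Rightarrow>\<^sub>L real" and l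
    using tendsto_unique[OF fine_filter_nontrivial[OF G] \<Phi> that] .
  have "\<Phi> (\<phi> + \<psi>) = \<Phi> \<phi> + \<Phi> \<psi>" for \<phi> \<psi>
    by (rule uniq) (auto simp: blinfun.add_left intro: tendsto_add \<Phi>)
  moreover have "\<Phi> (blinfun_mult_right c o\<^sub>L \<phi>) = c * \<Phi> \<phi>" for c \<phi>
    by (rule uniq) (auto intro: tendsto_mult_left \<Phi>)
  moreover have "norm (\<Phi> \<phi>) \<le> B * norm \<phi>" for \<phi>
    by (rule tendsto_upperbound[OF tendsto_norm[OF \<Phi>] _ fine_filter_nontrivial[OF G]])
      (use bound in auto)
  ultimately obtain y where "\<forall>\<phi>. \<Phi> \<phi> = blinfun_apply \<phi> y"
    using refl unfolding reflexive_space_def dual_space_scaleR by blast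
  with \<Phi> show ?thesis by metis
qed

text \<open>A norming functional of \<open>y\<close> transfers the bound: weak lower semicontinuity
  of the norm.\<close>

lemma weak_limit_norm_le:
  fixes x :: "nat \<Rightarrow> 'a::real_normed_vector"
  assumes x: "\<And>\<phi> :: 'a \<Rightarrow>\<^sub>L real. ((\<lambda>n. \<phi> (x n)) \<longlongrightarrow> \<phi> y) G" and G: "G \<noteq> bot"
    and B: "eventually (\<lambda>n. norm (x n) \<le> B) G"
  shows "norm y \<le> B"
proof -
  obtain \<phi> :: "'a \<Rightarrow>\<^sub>L real" where \<phi>: "\<forall>x. \<bar>\<phi> x\<bar> \<le> norm x" "\<phi> y = norm y"
    using exists_norming_functional[of y] by blast
  have "eventually (\<lambda>n. \<phi> (x n) \<le> B) G"
    using B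
  proof eventually_elim
    case (elim n)
    with \<phi>(1)[rule_format, of "x n"] show ?case by linarith
  qed
  then show ?thesis
    using tendsto_upperbound[OF x[of \<phi>] _ G] \<phi>(2) by simp
qed

lemma subspace_closure:
  fixes S :: "'a::real_normed_vector set"
  assumes S: "subspace S"
  shows "subspace (closure S)"
proof (rule subspaceI)
  show "0 \<in> closure S"
    using subspace_0[OF S] closure_subset by blast
next
  fix x y assume "x \<in> closure S" "y \<in> closure S"
  then obtain f g where "\<And>n. f n \<in> S" "f \<longlonglongrightarrow> x" "\<And>n. g n \<in> S" "g \<longlonglongrightarrow> y"
    by (auto simp: closure_sequential)
  then show "x + y \<in> closure S"
    unfolding closure_sequential
    by (intro exI[of _ "\<lambda>n. f n + g n"]) (auto intro: tendsto_add subspace_add[OF S])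
next
  fix c x assume "x \<in> closure S"
  then obtain f where "\<And>n. f n \<in> S" "f \<longlonglongrightarrow> x"
    by (auto simp: closure_sequential)
  then show "c *\<^sub>R x \<in> closure S"
    unfolding closure_sequential
    by (intro exI[of _ "\<lambda>n. c *\<^sub>R f n"]) (auto intro: tendsto_scaleR subspace_scale[OF S])
qed

text \<open>Reflexivity makes a norm-closed subspace of the dual weak-* closed.\<close>

lemma separating_subspace_dense:
  fixes Y :: "('a::banach \<Rightarrow>\<^sub>L real) set"
  assumes refl: "reflexive_space (scaleR :: real \<Rightarrow> 'a \<Rightarrow> 'a)"
    and Y: "subspace Y" and sep: "\<And>x. (\<forall>\<psi>\<in>Y. \<psi> x = 0) \<Longrightarrow> x = 0"
  shows "closure Y = UNIV"
proof -
  have "\<phi> \<in> closure Y" for \<phi>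
  proof (rule hahn_banach_closed_subspace[OF subspace_closure[OF Y] closed_closure])
    fix f :: "('a \<Rightarrow>\<^sub>L real) \<Rightarrow>\<^sub>L real" assume f: "\<forall>y\<in>closure Y. blinfun_apply f y = 0"
    have "\<exists>C. \<forall>\<phi>. norm (blinfun_apply f \<phi>) \<le> C * norm \<phi>"
      using norm_blinfun by blast
    moreover have "blinfun_apply f (blinfun_mult_right c o\<^sub>L \<phi>) = c * blinfun_apply f \<phi>" for c \<phi>
    proof -
      have "blinfun_mult_right c o\<^sub>L \<phi> = c *\<^sub>R \<phi>"
        by (rule blinfun_eqI) (simp add: blinfun.scaleR_left)
      then show ?thesis by (simp only: blinfun.scaleR_right real_scaleR_def)
    qed
    ultimately obtain x where x: "\<forall>\<phi>. blinfun_apply f \<phi> = blinfun_apply \<phi> x"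
      using refl[unfolded reflexive_space_def dual_space_scaleR, rule_format, of "blinfun_apply f"]
      by (auto simp: blinfun.add_right)
    have "x = 0"
      using f x closure_subset by (intro sep) force
    with x show "blinfun_apply f \<phi> = 0" by simp
  qed
  then show ?thesis by auto
qed

section \<open>Stable consistent approximation schemes\<close>

lemma blinfun_power_0 [simp]: "blinfun_power A 0 = id_blinfun"
  by (simp add: blinfun_power_def)

lemma blinfun_power_Suc_apply [simp]:
  "blinfun_apply (blinfun_power A (Suc m)) x = A (blinfun_power A m x)"
  by (simp add: blinfun_power_def)

lemma blinfun_power_add_apply:
  "blinfun_apply (blinfun_power A (m + n)) x = blinfun_power A m (blinfun_power A n x)"
  by (induction m) auto

lemma blinfun_power_commute:
  "blinfun_apply (blinfun_power A m) (A x) = A (blinfun_power A m x)"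
  by (induction m) auto

lemma norm_triangle3: "norm (x + y + z) \<le> norm x + norm y + norm (z :: 'a::real_normed_vector)"
  using norm_triangle_ineq[of "x + y" z] norm_triangle_ineq[of x y] by linarith

lemma norm_triangle3_diff: "norm (x + y - z) \<le> norm x + norm y + norm (z :: 'a::real_normed_vector)"
  using norm_triangle3[of x y "- z"] by simp

lemma eventually_at_right_0_less:
  fixes c :: real
  assumes "c > 0"
  shows "\<forall>\<^sub>F \<delta> in at_right 0. \<delta> < c"
  using assms by (auto simp: eventually_at_right_field)

text \<open>\<open>h * real k\<close> is the time reached by \<open>k\<close> steps of size
  \<open>h\<close>. A nonnegative rate makes the stability bound increase with time, so that
  \<open>bnd S\<close> below controls all iterates up to time \<open>S\<close>, uniformly in
  \<open>h\<close>.\<close>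

locale stable_scheme =
  fixes F :: "real \<Rightarrow> 'a::banach \<Rightarrow>\<^sub>L 'a" and D :: "'a set" and Z :: "'a \<Rightarrow> 'a" and M a :: real
  assumes M_ge: "M \<ge> 1" and a_ge: "a \<ge> 0"
    and stable: "\<And>h k. h \<ge> 0 \<Longrightarrow> norm (blinfun_power (F h) k) \<le> M * exp (a * (h * real k))"
    and subspace_D: "subspace D" and dense_D: "closure D = UNIV"
    and Z_add: "\<And>x y. x \<in> D \<Longrightarrow> y \<in> D \<Longrightarrow> Z (x + y) = Z x + Z y"
    and Z_scaleR: "\<And>c x. x \<in> D \<Longrightarrow> Z (c *\<^sub>R x) = c *\<^sub>R Z x"
    and consistent: "\<And>x. x \<in> D \<Longrightarrow> ((\<lambda>h. (1 / h) *\<^sub>R (F h x - x)) \<longlongrightarrow> Z x) (at_right 0)"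
begin

abbreviation iter :: "real \<Rightarrow> nat \<Rightarrow> 'a \<Rightarrow> 'a" where
  "iter h k \<equiv> blinfun_apply (blinfun_power (F h) k)"

definition dq :: "real \<Rightarrow> 'a \<Rightarrow> 'a" where
  "dq h x = (1 / h) *\<^sub>R (F h x - x)"

definition bnd :: "real \<Rightarrow> real" where
  "bnd S = M * exp (a * S)"

definition Gb :: "('a \<times> 'a) set" where
  "Gb = closure (operator_graph D Z)"

lemma bnd_ge_1: "S \<ge> 0 \<Longrightarrow> bnd S \<ge> 1"
  using M_ge a_ge mult_mono[of 1 M 1 "exp (a * S)"] by (simp add: bnd_def)

lemma norm_iter_le:
  assumes "h \<ge> 0" "h * real k \<le> S"
  shows "norm (iter h k x) \<le> bnd S * norm x"
proof -
  have "exp (a * (h * real k)) \<le> exp (a * S)"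
    using assms a_ge by (simp add: mult_left_mono)
  then have "M * exp (a * (h * real k)) \<le> bnd S"
    using M_ge by (simp add: bnd_def)
  with stable[OF assms(1), of k] have "norm (blinfun_power (F h) k) \<le> bnd S" by linarith
  then show ?thesis
    by (meson mult_right_mono norm_blinfun norm_ge_zero order_trans)
qed

lemma subspace_graph: "subspace (operator_graph D Z)"
proof (rule subspaceI)
  have "Z 0 = 0"
    using Z_scaleR[OF subspace_0[OF subspace_D], of 0] by simp
  then show "0 \<in> operator_graph D Z"
    using subspace_0[OF subspace_D] by (auto simp: operator_graph_def zero_prod_def)
qed (auto simp: operator_graph_def Z_add Z_scaleR intro: subspace_add[OF subspace_D] subspace_scale[OF subspace_D])

lemma subspace_Gb: "subspace Gb" and closed_Gb: "closed Gb"
  unfolding Gb_def by (auto intro: subspace_closure subspace_graph)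

lemma graph_Gb: "x \<in> D \<Longrightarrow> (x, Z x) \<in> Gb"
  unfolding Gb_def by (rule subsetD[OF closure_subset]) (auto simp: operator_graph_def)

lemma dq_tendsto: "x \<in> D \<Longrightarrow> ((\<lambda>h. dq h x) \<longlongrightarrow> Z x) (at_right 0)"
  unfolding dq_def by (rule consistent)

section \<open>Uniform first-order expansion of the iterates\<close>

lemma iter_Suc_diff:
  assumes "h \<noteq> 0"
  shows "iter h (Suc k) x - iter h k x = h *\<^sub>R iter h k (dq h x)"
  using assms by (simp add: dq_def blinfun.scaleR_right blinfun.diff_right blinfun_power_commute)

text \<open>\<open>F h\<close> commutes with its powers, so the difference quotient acts on the
  initial value, where consistency controls it, and stability handles the powers in front.\<close>

lemma iter_diff_sum:
  assumes "h \<noteq> 0"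
  shows "iter h k x - x = (\<Sum>i<k. h *\<^sub>R iter h i (dq h x))"
  using sum_lessThan_telescope[of "\<lambda>k. iter h k x" k] by (simp only: iter_Suc_diff[OF assms]) simp

lemma norm_iter_diff_le:
  assumes h: "h > 0" and S: "h * real k \<le> S"
  shows "norm (iter h k x - x) \<le> h * real k * (bnd S * norm (dq h x))"
proof -
  have "norm (iter h k x - x) \<le> (\<Sum>i<k. norm (h *\<^sub>R iter h i (dq h x)))"
    unfolding iter_diff_sum[OF less_imp_neq[OF h, symmetric]] by (rule norm_sum)
  also have "\<dots> \<le> (\<Sum>i<k. h * (bnd S * norm (dq h x)))"
  proof (rule sum_mono)
    fix i assume "i \<in> {..<k}"
    then have "h * real i \<le> h * real k"
      using h by simp
    with S have "h * real i \<le> S" by linarith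
    then have "norm (iter h i (dq h x)) \<le> bnd S * norm (dq h x)"
      using h by (intro norm_iter_le) auto
    then show "norm (h *\<^sub>R iter h i (dq h x)) \<le> h * (bnd S * norm (dq h x))"
      using h by simp
  qed
  finally show ?thesis by (simp add: mult_ac)
qed

lemma iter_small_domain:
  assumes x: "x \<in> D" and e: "e > 0"
  shows "\<forall>\<^sub>F \<delta> in at_right 0. \<forall>h>0. \<forall>k. h * real k \<le> \<delta> \<longrightarrow> norm (iter h k x - x) \<le> e"
proof -
  define B where "B = bnd 1 * (norm (Z x) + 1)"
  have "B > 0"
    using bnd_ge_1[of 1] by (simp add: B_def add_nonneg_pos)
  have "\<forall>\<^sub>F h in at_right 0. norm (dq h x) < norm (Z x) + 1"
    by (rule order_tendstoD[OF tendsto_norm[OF dq_tendsto[OF x]]]) simp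
  then obtain b where b: "b > 0" "\<And>h. 0 < h \<Longrightarrow> h < b \<Longrightarrow> norm (dq h x) < norm (Z x) + 1"
    by (auto simp: eventually_at_right_field)
  have "\<forall>\<^sub>F \<delta> in at_right 0. \<delta> < Min {b, 1, e / B}"
    using b(1) e \<open>B > 0\<close> by (intro eventually_at_right_0_less) auto
  then show ?thesis
  proof eventually_elim
    case (elim \<delta>)
    show ?case
    proof (intro allI impI)
      fix h :: real and k assume h: "h > 0" and hk: "h * real k \<le> \<delta>"
      show "norm (iter h k x - x) \<le> e"
      proof (cases k)
        \<comment> \<open>At least one step is taken, so \<open>h\<close> itself is at most
          \<open>\<delta>\<close> and the difference quotient is already under control; for
          \<open>k = 0\<close> a large \<open>h\<close> is harmless.\<close>
        case (Suc j)
        then have "h \<le> h * real k" using h by simp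
        with hk elim have "h < b" by simp
        have "h * real k \<le> 1" using hk elim by simp
        then have "norm (iter h k x - x) \<le> h * real k * (bnd 1 * norm (dq h x))"
          by (rule norm_iter_diff_le[OF h])
        also have "\<dots> \<le> h * real k * B"
          unfolding B_def using b(2)[OF h \<open>h < b\<close>] bnd_ge_1[of 1] h
          by (intro mult_left_mono) auto
        also have "\<dots> \<le> (e / B) * B"
          using hk elim \<open>B > 0\<close> by (intro mult_right_mono) auto
        finally show ?thesis using \<open>B > 0\<close> by simp
      qed (use e in simp)
    qed
  qed
qed

text \<open>Compactness reduces the claim to finitely many points of \<open>D\<close>, and stability
  carries the estimate to their neighbours. One \<open>\<delta>\<close> then serves all points of
  \<open>K\<close> and all step sizes.\<close>

lemma iter_small_compact:
  assumes K: "compact K" and e: "e > 0"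
  shows "\<forall>\<^sub>F \<delta> in at_right 0. \<forall>h>0. \<forall>k. h * real k \<le> \<delta> \<longrightarrow> (\<forall>y\<in>K. norm (iter h k y - y) \<le> e)"
proof -
  define C where "C = bnd 1"
  have C: "C \<ge> 1" unfolding C_def by (rule bnd_ge_1) simp
  define e' where "e' = e / (3 * C)"
  have e': "e' > 0" "e' \<le> e / 3" "C * e' = e / 3"
    using e C by (auto simp: e'_def field_simps)
  have "K \<subseteq> (\<Union>d\<in>D. ball d e')"
  proof
    fix y
    have "y \<in> closure D" using dense_D by simp
    then obtain d where "d \<in> D" "dist d y < e'"
      using e'(1) by (auto simp: closure_approachable)
    then show "y \<in> (\<Union>d\<in>D. ball d e')" by auto
  qed
  then obtain D' where D': "D' \<subseteq> D" "finite D'" "K \<subseteq> (\<Union>d\<in>D'. ball d e')"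
    using compactE_image[OF K, of D "\<lambda>d. ball d e'"] by auto
  have "\<forall>\<^sub>F \<delta> in at_right 0. \<forall>d\<in>D'. \<forall>h>0. \<forall>k. h * real k \<le> \<delta> \<longrightarrow> norm (iter h k d - d) \<le> e / 3"
    using D' e by (intro eventually_ball_finite ballI iter_small_domain) auto
  moreover have "\<forall>\<^sub>F \<delta> in at_right 0. \<delta> < (1::real)"
    by (intro eventually_at_right_0_less) auto
  ultimately show ?thesis
  proof eventually_elim
    case (elim \<delta>)
    show ?case
    proof (intro allI impI ballI)
      fix h :: real and k y assume h: "h > 0" and hk: "h * real k \<le> \<delta>" and y: "y \<in> K"
      obtain d where d: "d \<in> D'" "norm (y - d) < e'"
        using D'(3) y by (auto simp: dist_norm norm_minus_commute)
      have "norm (iter h k (y - d)) \<le> C * norm (y - d)"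
        unfolding C_def using h hk elim(2) by (intro norm_iter_le) auto
      also have "\<dots> \<le> C * e'"
        using C d(2) by (intro mult_left_mono) auto
      finally have 1: "norm (iter h k (y - d)) \<le> e / 3" using e' by simp
      have 2: "norm (iter h k d - d) \<le> e / 3"
        using elim(1) d(1) h hk by blast
      have "iter h k y - y = iter h k (y - d) + (iter h k d - d) - (y - d)"
        by (simp add: blinfun.diff_right)
      then have "norm (iter h k y - y) \<le> norm (iter h k (y - d)) + norm (iter h k d - d) + norm (y - d)"
        by (simp only: norm_triangle3_diff)
      with 1 2 d(2) e' show "norm (iter h k y - y) \<le> e" by simp
    qed
  qed
qed

text \<open>A point of \<open>Gb\<close> is replaced by a nearby \<open>(d, Z d)\<close>. The error
  in the second coordinate gets multiplied by the elapsed time, but the error in the first does not,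
  so it must be small compared with \<open>\<delta>\<close>. The finite cover of \<open>K\<close>
  therefore depends on \<open>\<delta>\<close>, and so does the range of admissible
  \<open>h\<close>: hence the nested quantifiers.\<close>

lemma local_expansion:
  assumes K: "compact K" "K \<subseteq> Gb" and e: "e > 0"
  shows "\<forall>\<^sub>F \<delta> in at_right 0. \<forall>\<^sub>F h in at_right 0. \<forall>m. h * real m \<le> \<delta> \<longrightarrow>
    (\<forall>(x, y)\<in>K. norm (iter h m x - x - (h * real m) *\<^sub>R y) \<le> e * \<delta>)"
proof -
  define C where "C = bnd 1"
  have C: "C \<ge> 1" unfolding C_def by (rule bnd_ge_1) simp
  \<comment> \<open>The total error is at most
    \<open>\<delta> * (3 * ((C + 1) * e') + e / 4)\<close>, which this choice turns into
    \<open>e * \<delta>\<close>.\<close>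
  define e' where "e' = e / (4 * (C + 1))"
  have e': "e' > 0" and e'_eq: "(C + 1) * e' = e / 4"
    using e C by (auto simp: e'_def field_simps)
  have "compact (snd ` K)"
    by (intro compact_continuous_image K continuous_intros)
  then have "\<forall>\<^sub>F \<delta> in at_right 0. \<forall>h>0. \<forall>k. h * real k \<le> \<delta> \<longrightarrow> (\<forall>y\<in>snd ` K. norm (iter h k y - y) \<le> e / 4)"
    using e by (intro iter_small_compact) auto
  moreover have "\<forall>\<^sub>F \<delta> in at_right 0. \<delta> < (1::real)"
    by (intro eventually_at_right_0_less) auto
  moreover have "\<forall>\<^sub>F \<delta> in at_right 0. \<delta> > (0::real)"
    by (rule eventually_at_right_less)
  ultimately show ?thesis
  proof eventually_elim
    case (elim \<delta>)
    let ?U = "\<lambda>d. ball d (e' * \<delta>) \<times> ball (Z d) e'"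
    have cover: "K \<subseteq> (\<Union>d\<in>D. ?U d)"
    proof
      fix p assume p: "p \<in> K"
      obtain x y where xy: "p = (x, y)" by (cases p)
      have "open (ball x (e' * \<delta>) \<times> ball y e')" by (intro open_Times open_ball)
      moreover have "p \<in> ball x (e' * \<delta>) \<times> ball y e'"
        using e' elim(3) by (simp add: xy)
      moreover have "p \<in> closure (operator_graph D Z)"
        using p K(2) by (auto simp: Gb_def)
      ultimately obtain q where "q \<in> operator_graph D Z" "q \<in> ball x (e' * \<delta>) \<times> ball y e'"
        unfolding closure_iff_nhds_not_empty by blast
      then show "p \<in> (\<Union>d\<in>D. ?U d)"
        by (auto simp: operator_graph_def xy dist_commute)
    qed
    have "open (?U d)" for d by (intro open_Times open_ball)
    from compactE_image[OF K(1) this cover]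
    obtain D' where D': "D' \<subseteq> D" "finite D'" "K \<subseteq> (\<Union>d\<in>D'. ?U d)" by blast
    have "\<forall>\<^sub>F h in at_right 0. \<forall>d\<in>D'. dist (dq h d) (Z d) < e'"
      using D' e' by (intro eventually_ball_finite ballI tendstoD dq_tendsto) auto
    moreover have "\<forall>\<^sub>F h in at_right 0. h > (0::real)"
      by (rule eventually_at_right_less)
    ultimately show ?case
    proof eventually_elim
      case h: (elim h)
      show ?case
      proof (intro allI impI ballI, clarify)
        fix m x y assume hm: "h * real m \<le> \<delta>" and xy: "(x, y) \<in> K"
        obtain d where d: "d \<in> D'" "norm (x - d) < e' * \<delta>" "norm (Z d - y) < e'"
          using D'(3) xy by (auto simp: dist_norm norm_minus_commute)
        have le1: "h * real i \<le> 1" if "i \<le> m" for i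
        proof -
          have "h * real i \<le> h * real m" using h(2) that by simp
          with hm elim(2) show ?thesis by simp
        qed
        have it: "norm (iter h i z) \<le> C * norm z" if "i \<le> m" for i z
          unfolding C_def using h(2) le1[OF that] by (intro norm_iter_le) auto
        have summand: "norm (h *\<^sub>R (iter h i (dq h d) - y)) \<le> h * (2 * (C * e') + e / 4)" if "i < m" for i
        proof -
          have "norm (iter h i (dq h d - Z d)) \<le> C * e'"
            using h(1)[rule_format, OF d(1)] that C
            by (intro order_trans[OF it mult_left_mono]) (auto simp: dist_norm)
          moreover have "norm (iter h i (Z d - y)) \<le> C * e'"
            using d(3) that C by (intro order_trans[OF it mult_left_mono]) auto
          moreover have "h * real i \<le> h * real m"
            using h(2) that by simp
          then have "h * real i \<le> \<delta>" using hm by simp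
          then have "norm (iter h i y - y) \<le> e / 4"
            using elim(1) h(2) xy by force
          moreover have "iter h i (dq h d) - y
              = iter h i (dq h d - Z d) + iter h i (Z d - y) + (iter h i y - y)"
            by (simp add: blinfun.diff_right)
          then have "norm (iter h i (dq h d) - y)
              \<le> norm (iter h i (dq h d - Z d)) + norm (iter h i (Z d - y)) + norm (iter h i y - y)"
            by (simp only: norm_triangle3)
          ultimately have "norm (iter h i (dq h d) - y) \<le> 2 * (C * e') + e / 4" by linarith
          then show ?thesis using h(2) by simp
        qed
        have "iter h m d - d - (h * real m) *\<^sub>R y = (\<Sum>i<m. h *\<^sub>R (iter h i (dq h d) - y))"
          using h(2) by (simp add: iter_diff_sum scaleR_diff_right sum_subtractf sum_constant_scaleR mult.commute)
        also have "norm \<dots> \<le> (\<Sum>i<m. h * (2 * (C * e') + e / 4))"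
          by (rule sum_norm_le) (use summand in auto)
        also have "\<dots> = (h * real m) * (2 * (C * e') + e / 4)" by simp
        also have "\<dots> \<le> \<delta> * (2 * (C * e') + e / 4)"
          using hm C e' e by (intro mult_right_mono) auto
        finally have 1: "norm (iter h m d - d - (h * real m) *\<^sub>R y) \<le> \<delta> * (2 * (C * e') + e / 4)" .
        have "norm (iter h m (x - d)) \<le> C * (e' * \<delta>)"
          using d(2) C by (intro order_trans[OF it mult_left_mono]) auto
        moreover have "iter h m x - x - (h * real m) *\<^sub>R y
            = iter h m (x - d) + (iter h m d - d - (h * real m) *\<^sub>R y) - (x - d)"
          by (simp add: blinfun.diff_right)
        then have "norm (iter h m x - x - (h * real m) *\<^sub>R y)
            \<le> norm (iter h m (x - d)) + norm (iter h m d - d - (h * real m) *\<^sub>R y) + norm (x - d)"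
          by (simp only: norm_triangle3_diff)
        ultimately have "norm (iter h m x - x - (h * real m) *\<^sub>R y)
            \<le> C * (e' * \<delta>) + e' * \<delta> + \<delta> * (2 * (C * e') + e / 4)"
          using 1 d(2) by linarith
        also have "\<dots> = \<delta> * (3 * ((C + 1) * e') + e / 4) - 2 * (\<delta> * e')"
          by (simp add: algebra_simps)
        also have "\<dots> \<le> e * \<delta>"
          unfolding e'_eq using elim(3) e' by (simp add: algebra_simps)
        finally show "norm (iter h m x - x - (h * real m) *\<^sub>R y) \<le> e * \<delta>" .
      qed
    qed
  qed
qed

text \<open>The derivative \<open>w\<close> is carried along because \<open>Gb\<close> is a closed
  relation that is not assumed to be single-valued, so \<open>v\<close> alone does not determine
  which pair is meant.\<close>

definition classical_solution :: "(real \<Rightarrow> 'a) \<Rightarrow> (real \<Rightarrow> 'a) \<Rightarrow> bool" where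
  "classical_solution v w \<longleftrightarrow> continuous_on {0..} w \<and>
    (\<forall>r\<ge>0. (v r, w r) \<in> Gb \<and> (v has_vector_derivative w r) (at r within {0..}))"

text \<open>The errors of the blocks are transported to the final time and added. Each is
  transported by one power of \<open>F h\<close>, bounded by \<open>bnd S\<close>, so that this
  constant enters once per block and is never compounded.\<close>

lemma iter_blocks:
  assumes h: "h > 0" and S: "S \<ge> 0"
    and block: "\<And>r p. p \<le> m \<Longrightarrow> 0 \<le> r \<Longrightarrow> r + h * real p \<le> S \<Longrightarrow> norm (iter h p (v r) - v (r + h * real p)) \<le> e"
  shows "k \<le> j * m \<Longrightarrow> 0 \<le> r \<Longrightarrow> r + h * real k \<le> S \<Longrightarrow>
    norm (iter h k (v r) - v (r + h * real k)) \<le> real j * (bnd S * e)"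
proof (induction j arbitrary: k r)
  case 0
  then show ?case by simp
next
  case (Suc j)
  have e: "e \<ge> 0"
    using block[of 0 0] S by simp
  have Ce: "e \<le> bnd S * e"
    using mult_right_mono[OF bnd_ge_1[OF S] e] by simp
  show ?case
  proof (cases "k \<le> m")
    case True
    have "norm (iter h k (v r) - v (r + h * real k)) \<le> bnd S * e"
      using block[OF True Suc.prems(2,3)] Ce by linarith
    moreover have "0 \<le> real j * (bnd S * e)"
      using order_trans[OF e Ce] by simp
    ultimately show ?thesis by (simp add: algebra_simps)
  next
    case False
    define l where "l = k - m"
    have k: "k = l + m" using False by (simp add: l_def)
    define q where "q = r + h * real m"
    have hl: "0 \<le> h * real l" and hm: "0 \<le> h * real m" using h by simp_all
    have qS: "q + h * real l \<le> S"
      using Suc.prems(3) by (simp add: q_def k algebra_simps)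
    have q0: "0 \<le> q" "r + h * real k = q + h * real l"
      using Suc.prems(2) hm by (simp_all add: q_def k algebra_simps)
    have "norm (iter h l (iter h m (v r) - v q)) \<le> bnd S * norm (iter h m (v r) - v q)"
      using h qS q0 by (intro norm_iter_le) auto
    also have "\<dots> \<le> bnd S * e"
      using block[of m r] Suc.prems(2) qS hl bnd_ge_1[OF S]
      by (intro mult_left_mono) (auto simp: q_def)
    finally have 1: "norm (iter h l (iter h m (v r) - v q)) \<le> bnd S * e" .
    have 2: "norm (iter h l (v q) - v (q + h * real l)) \<le> real j * (bnd S * e)"
      using Suc.prems(1) qS q0 by (intro Suc.IH) (auto simp: k)
    have eq: "iter h k (v r) - v (r + h * real k)
        = iter h l (iter h m (v r) - v q) + (iter h l (v q) - v (q + h * real l))"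
      unfolding q0(2) by (simp add: k blinfun_power_add_apply blinfun.diff_right)
    have "real (Suc j) * (bnd S * e) = bnd S * e + real j * (bnd S * e)"
      by (simp add: distrib_right)
    with 1 2 show ?thesis
      unfolding eq by (metis add_mono norm_triangle_le)
  qed
qed

lemma classical_solution_continuous:
  "classical_solution v w \<Longrightarrow> continuous_on {0..} v"
  unfolding classical_solution_def
  by (intro continuous_on_vector_derivative) auto

text \<open>Uniform continuity of \<open>w\<close> on the compact interval makes the remainder
  uniform in the base point.\<close>

lemma classical_solution_expansion:
  assumes v: "classical_solution v w" and S: "S \<ge> 0" and e: "e > 0"
  shows "\<forall>\<^sub>F \<delta> in at_right 0. \<forall>r q. 0 \<le> r \<longrightarrow> 0 \<le> q \<longrightarrow> q \<le> \<delta> \<longrightarrow> r + q \<le> S \<longrightarrow>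
    norm (v (r + q) - v r - q *\<^sub>R w r) \<le> e * \<delta>"
proof -
  have "uniformly_continuous_on {0..S} w"
    using v unfolding classical_solution_def
    by (intro compact_uniformly_continuous) (auto intro: continuous_on_subset)
  then obtain d where d: "d > 0" "\<And>r r'. r \<in> {0..S} \<Longrightarrow> r' \<in> {0..S} \<Longrightarrow> dist r' r < d \<Longrightarrow> dist (w r') (w r) < e"
    unfolding uniformly_continuous_on_def using e by metis
  have "\<forall>\<^sub>F \<delta> in at_right 0. \<delta> < d"
    using d(1) by (rule eventually_at_right_0_less)
  then show ?thesis
  proof eventually_elim
    case (elim \<delta>)
    show ?case
    proof (intro allI impI)
      fix r q assume rq: "0 \<le> r" "0 \<le> q" "q \<le> \<delta>" "r + q \<le> S"
      have "norm (v (r + q) - v r - ((r + q) - r) *\<^sub>R w r) \<le> norm ((r + q) - r) * e"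
      proof (rule vector_differentiable_bound_linearization[where S = "{r..r + q}"])
        fix x assume x: "x \<in> {r..r + q}"
        then have "(v has_vector_derivative w x) (at x within {0..})"
          using v rq(1) by (simp add: classical_solution_def)
        then show "(v has_vector_derivative w x) (at x within {r..r + q})"
          by (rule has_vector_derivative_within_subset) (use rq(1) in auto)
        show "norm (w x - w r) \<le> e"
          using d(2)[of r x] x rq elim by (simp add: dist_norm less_imp_le)
      qed (use rq in \<open>auto simp: closed_segment_eq_real_ivl\<close>)
      also have "\<dots> \<le> e * \<delta>"
        using rq e by (simp add: mult.commute mult_left_mono)
      finally show "norm (v (r + q) - v r - q *\<^sub>R w r) \<le> e * \<delta>" by simp
    qed
  qed
qed

text \<open>The curve of pairs \<open>(v r, w r)\<close> is a compact subset of \<open>Gb\<close>,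
  so iterates and solution share their first-order expansion over a block of time
  \<open>\<delta>\<close>, up to \<open>2 * (e1 * \<delta>)\<close>. About
  \<open>S / \<delta>\<close> blocks fill the interval, and the factor \<open>\<delta>\<close>
  cancels. Blocks rather than single steps are compared because the error is small relative to
  \<open>\<delta>\<close>, not to \<open>h\<close>.\<close>

lemma classical_solution_uniform_limit:
  assumes v: "classical_solution v w" and S: "S \<ge> 0" and e: "e > 0"
  shows "\<forall>\<^sub>F h in at_right 0. \<forall>k. h * real k \<le> S \<longrightarrow> norm (iter h k (v 0) - v (h * real k)) \<le> e"
proof -
  define C where "C = bnd S"
  have C: "C \<ge> 1" unfolding C_def by (rule bnd_ge_1[OF S])
  \<comment> \<open>The number of blocks times \<open>\<delta>\<close> is at most
    \<open>2 * (S + 1)\<close>, and each block contributes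
    \<open>2 * C * (e1 * \<delta>)\<close>.\<close>
  define e1 where "e1 = e / (4 * C * (S + 1))"
  have "4 * C * (S + 1) > 0"
    using C S by simp
  then have e1: "e1 > 0" "4 * C * (S + 1) * e1 = e"
    using e C S by (simp_all add: e1_def)
  define K where "K = (\<lambda>r. (v r, w r)) ` {0..S}"
  have "continuous_on {0..S} (\<lambda>r. (v r, w r))"
    using v classical_solution_continuous[OF v] unfolding classical_solution_def
    by (intro continuous_on_Pair) (auto intro: continuous_on_subset)
  then have "compact K"
    unfolding K_def by (intro compact_continuous_image) auto
  moreover have "K \<subseteq> Gb"
    using v by (auto simp: K_def classical_solution_def)
  ultimately have "\<forall>\<^sub>F \<delta> in at_right 0. \<forall>\<^sub>F h in at_right 0. \<forall>m. h * real m \<le> \<delta> \<longrightarrow>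
    (\<forall>(x, y)\<in>K. norm (iter h m x - x - (h * real m) *\<^sub>R y) \<le> e1 * \<delta>)"
    using e1(1) by (rule local_expansion)
  moreover have "\<forall>\<^sub>F \<delta> in at_right 0. \<delta> > (0::real)"
    by (rule eventually_at_right_less)
  moreover have "\<forall>\<^sub>F \<delta> in at_right 0. \<delta> < (1::real)"
    by (intro eventually_at_right_0_less) auto
  ultimately have "\<forall>\<^sub>F \<delta> in at_right 0. (\<forall>\<^sub>F h in at_right 0. \<forall>m. h * real m \<le> \<delta> \<longrightarrow>
      (\<forall>(x, y)\<in>K. norm (iter h m x - x - (h * real m) *\<^sub>R y) \<le> e1 * \<delta>)) \<and> 0 < \<delta> \<and> \<delta> < 1 \<and>
    (\<forall>r q. 0 \<le> r \<longrightarrow> 0 \<le> q \<longrightarrow> q \<le> \<delta> \<longrightarrow> r + q \<le> S \<longrightarrow> norm (v (r + q) - v r - q *\<^sub>R w r) \<le> e1 * \<delta>)"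
    using classical_solution_expansion[OF v S e1(1)] by eventually_elim blast
  then obtain \<delta> where \<delta>: "0 < \<delta>" "\<delta> < 1"
    and scheme: "\<forall>\<^sub>F h in at_right 0. \<forall>m. h * real m \<le> \<delta> \<longrightarrow>
      (\<forall>(x, y)\<in>K. norm (iter h m x - x - (h * real m) *\<^sub>R y) \<le> e1 * \<delta>)"
    and sol: "\<And>r q. 0 \<le> r \<Longrightarrow> 0 \<le> q \<Longrightarrow> q \<le> \<delta> \<Longrightarrow> r + q \<le> S \<Longrightarrow> norm (v (r + q) - v r - q *\<^sub>R w r) \<le> e1 * \<delta>"
    using eventually_happens'[OF trivial_limit_at_right_real] by blast
  have "\<forall>\<^sub>F h in at_right 0. h > (0::real)" by (rule eventually_at_right_less)
  moreover have "\<forall>\<^sub>F h in at_right 0. h < \<delta> / 2"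
    using \<delta> by (intro eventually_at_right_0_less) auto
  ultimately show ?thesis using scheme
  proof eventually_elim
    case (elim h)
    \<comment> \<open>The largest number of steps that fits into time \<open>\<delta>\<close>. Since
      \<open>h < \<delta> / 2\<close>, such a block lasts longer than \<open>\<delta> / 2\<close>,
      which limits the number of blocks.\<close>
    define m where "m = nat \<lfloor>\<delta> / h\<rfloor>"
    have fl: "real m = of_int \<lfloor>\<delta> / h\<rfloor>"
      using elim \<delta> by (simp add: m_def)
    have hm: "h * real m \<le> \<delta>" "\<delta> - h < h * real m"
    proof -
      have "real m \<le> \<delta> / h" "\<delta> / h - 1 < real m"
        unfolding fl by linarith+
      with elim(1) show "h * real m \<le> \<delta>" "\<delta> - h < h * real m"
        by (auto simp: field_simps)
    qed
    have "m > 0"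
      using hm(2) elim by (cases m) auto
    have block: "norm (iter h p (v r) - v (r + h * real p)) \<le> 2 * (e1 * \<delta>)"
      if "p \<le> m" "0 \<le> r" "r + h * real p \<le> S" for p r
    proof -
      have hp: "0 \<le> h * real p" "h * real p \<le> \<delta>"
        using elim(1) order_trans[OF mult_left_mono hm(1), of "real p"] that(1) by auto
      have "norm (v (r + h * real p) - v r - (h * real p) *\<^sub>R w r) \<le> e1 * \<delta>"
        using that hp by (intro sol) auto
      moreover have "(v r, w r) \<in> K"
        using that hp by (auto simp: K_def)
      then have "norm (iter h p (v r) - v r - (h * real p) *\<^sub>R w r) \<le> e1 * \<delta>"
        using elim(3) hp(2) by blast
      moreover have "iter h p (v r) - v (r + h * real p) = (iter h p (v r) - v r - (h * real p) *\<^sub>R w r)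
          - (v (r + h * real p) - v r - (h * real p) *\<^sub>R w r)"
        by simp
      ultimately show ?thesis
        using norm_triangle_ineq4[of "iter h p (v r) - v r - (h * real p) *\<^sub>R w r"
            "v (r + h * real p) - v r - (h * real p) *\<^sub>R w r"] by (simp only:)
    qed
    show ?case
    proof (intro allI impI)
      fix k assume hk: "h * real k \<le> S"
      \<comment> \<open>The additional block takes the remaining fewer than \<open>m\<close>
        steps.\<close>
      define j where "j = k div m + 1"
      have "k \<le> j * m"
        using \<open>m > 0\<close> dividend_less_div_times[of m k] by (simp add: j_def)
      then have "norm (iter h k (v 0) - v (0 + h * real k)) \<le> real j * (bnd S * (2 * (e1 * \<delta>)))"
        using elim(1) S block hk by (intro iter_blocks[where m = m]) auto
      also have "real j * \<delta> \<le> 2 * (S + 1)"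
      proof -
        have "j * m \<le> k + m"
          by (simp add: j_def)
        then have "h * (real j * real m) \<le> h * (real k + real m)"
          using elim(1) by (intro mult_left_mono) (simp_all flip: of_nat_mult of_nat_add)
        then have "real j * (h * real m) \<le> S + 1"
          using hk hm(1) \<delta>(2) by (simp add: algebra_simps)
        moreover have "real j * (\<delta> / 2) \<le> real j * (h * real m)"
          using hm(2) elim(2) by (intro mult_left_mono) auto
        ultimately show ?thesis by simp
      qed
      then have "real j * (bnd S * (2 * (e1 * \<delta>))) \<le> 2 * (S + 1) * (C * 2 * e1)"
        using C e1(1) mult_right_mono[of "real j * \<delta>" "2 * (S + 1)" "C * 2 * e1"]
        by (simp add: C_def algebra_simps)
      also have "\<dots> = e" using e1(2) by (simp add: algebra_simps)
      finally show "norm (iter h k (v 0) - v (h * real k)) \<le> e" by simp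
    qed
  qed
qed

text \<open>Convergence along all meshes at once: adding step counts then gives the semigroup law,
  and the choice of \<open>n\<close> steps of size \<open>s / n\<close> gives the product
  formula.\<close>

definition limit_at :: "'a \<Rightarrow> real \<Rightarrow> 'a \<Rightarrow> bool" where
  "limit_at f s x \<longleftrightarrow> (\<forall>h k. (\<forall>j. h j > 0) \<longrightarrow> h \<longlonglongrightarrow> 0 \<longrightarrow> (\<lambda>j. h j * real (k j)) \<longlonglongrightarrow> s \<longrightarrow>
    (\<lambda>j. iter (h j) (k j) f) \<longlonglongrightarrow> x)"

lemma limit_atD:
  "limit_at f s x \<Longrightarrow> (\<And>j. h j > 0) \<Longrightarrow> h \<longlonglongrightarrow> 0 \<Longrightarrow> (\<lambda>j. h j * real (k j)) \<longlonglongrightarrow> s \<Longrightarrow>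
    (\<lambda>j. iter (h j) (k j) f) \<longlonglongrightarrow> x"
  by (simp add: limit_at_def)

lemma classical_solution_limit_at:
  assumes v: "classical_solution v w" and s: "s \<ge> 0"
  shows "limit_at (v 0) s (v s)"
  unfolding limit_at_def
proof (intro allI impI)
  fix h :: "nat \<Rightarrow> real" and k
  assume h: "\<forall>j. h j > 0" "h \<longlonglongrightarrow> 0" and hk: "(\<lambda>j. h j * real (k j)) \<longlonglongrightarrow> s"
  have h_at: "filterlim h (at_right 0) sequentially"
    using h by (intro tendsto_imp_filterlim_at_right) auto
  have S: "\<forall>\<^sub>F j in sequentially. h j * real (k j) < s + 1"
    using hk by (rule order_tendstoD) simp
  have "(\<lambda>j. iter (h j) (k j) (v 0) - v (h j * real (k j))) \<longlonglongrightarrow> 0"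
  proof (rule tendstoI)
    fix e :: real assume "e > 0"
    then have "\<forall>\<^sub>F h in at_right 0. \<forall>k. h * real k \<le> s + 1 \<longrightarrow> norm (iter h k (v 0) - v (h * real k)) \<le> e / 2"
      using s by (intro classical_solution_uniform_limit[OF v]) auto
    then have "\<forall>\<^sub>F j in sequentially. \<forall>k. h j * real k \<le> s + 1 \<longrightarrow>
        norm (iter (h j) k (v 0) - v (h j * real k)) \<le> e / 2"
      using h_at by (rule eventually_compose_filterlim)
    with S show "\<forall>\<^sub>F j in sequentially. dist (iter (h j) (k j) (v 0) - v (h j * real (k j))) 0 < e"
    proof eventually_elim
      case (elim j)
      then have "norm (iter (h j) (k j) (v 0) - v (h j * real (k j))) \<le> e / 2" by auto
      with \<open>e > 0\<close> show ?case by (simp add: dist_norm)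
    qed
  qed
  moreover have "(\<lambda>j. v (h j * real (k j))) \<longlonglongrightarrow> v s"
  proof -
    have "(v \<longlongrightarrow> v s) (at s within {0..})"
      using classical_solution_continuous[OF v] s by (auto simp: continuous_on_def)
    moreover have "\<forall>\<^sub>F j in sequentially. h j * real (k j) \<in> {0..}"
      using h(1) by (auto simp: less_imp_le)
    ultimately show ?thesis
      using hk classical_solution_continuous[OF v] s
      by (intro continuous_on_tendsto_compose[of "{0..}" v]) auto
  qed
  ultimately show "(\<lambda>j. iter (h j) (k j) (v 0)) \<longlonglongrightarrow> v s"
    using tendsto_add[of "\<lambda>j. iter (h j) (k j) (v 0) - v (h j * real (k j))" 0 sequentially
        "\<lambda>j. v (h j * real (k j))" "v s"] by simp
qed

text \<open>A fixed admissible mesh that computes the limits. Rounding down keeps the elapsed time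
  at most \<open>s\<close>, so that the bounds for time \<open>s\<close> apply at every
  index.\<close>

definition step :: "nat \<Rightarrow> real" where "step j = 1 / real (Suc j)"

definition steps :: "real \<Rightarrow> nat \<Rightarrow> nat" where "steps s j = nat \<lfloor>s * real (Suc j)\<rfloor>"

lemma step_pos: "step j > 0"
  by (simp add: step_def)

lemma step_tendsto: "step \<longlonglongrightarrow> 0"
  unfolding step_def using LIMSEQ_inverse_real_of_nat by (simp add: inverse_eq_divide)

lemma step_steps_le: "s \<ge> 0 \<Longrightarrow> step j * real (steps s j) \<le> s"
  and step_steps_ge: "s \<ge> 0 \<Longrightarrow> s - step j \<le> step j * real (steps s j)"
proof -
  assume s: "s \<ge> 0"
  then have "real (steps s j) = of_int \<lfloor>s * real (Suc j)\<rfloor>"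
    by (simp add: steps_def)
  then have "real (steps s j) \<le> s * real (Suc j)" "s * real (Suc j) - 1 \<le> real (steps s j)"
    by linarith+
  then have "real (steps s j) / real (Suc j) \<le> s * real (Suc j) / real (Suc j)"
    "(s * real (Suc j) - 1) / real (Suc j) \<le> real (steps s j) / real (Suc j)"
    by (intro divide_right_mono; simp)+
  then show "step j * real (steps s j) \<le> s" "s - step j \<le> step j * real (steps s j)"
    by (simp_all add: step_def diff_divide_distrib del: of_nat_Suc)
qed

lemma step_steps_tendsto:
  assumes "s \<ge> 0"
  shows "(\<lambda>j. step j * real (steps s j)) \<longlonglongrightarrow> s"
proof (rule tendsto_sandwich)
  show "(\<lambda>j. s - step j) \<longlonglongrightarrow> s"
    using tendsto_diff[OF tendsto_const step_tendsto] by simp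
qed (use assms step_steps_le step_steps_ge in auto)

lemma limit_at_step:
  "limit_at f s x \<Longrightarrow> s \<ge> 0 \<Longrightarrow> (\<lambda>j. iter (step j) (steps s j) f) \<longlonglongrightarrow> x"
  by (rule limit_atD) (auto simp: step_pos step_tendsto step_steps_tendsto)

lemma limit_at_unique:
  "limit_at f s x \<Longrightarrow> limit_at f s y \<Longrightarrow> s \<ge> 0 \<Longrightarrow> x = y"
  by (rule LIMSEQ_unique[OF limit_at_step limit_at_step])

lemma limit_at_add: "limit_at f s x \<Longrightarrow> limit_at g s y \<Longrightarrow> limit_at (f + g) s (x + y)"
  unfolding limit_at_def by (auto simp: blinfun.add_right intro: tendsto_add)

lemma limit_at_diff: "limit_at f s x \<Longrightarrow> limit_at g s y \<Longrightarrow> limit_at (f - g) s (x - y)"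
  unfolding limit_at_def by (auto simp: blinfun.diff_right intro: tendsto_diff)

lemma limit_at_scaleR: "limit_at f s x \<Longrightarrow> limit_at (c *\<^sub>R f) s (c *\<^sub>R x)"
  unfolding limit_at_def by (auto simp: blinfun.scaleR_right intro: tendsto_intros)

lemma limit_at_norm:
  assumes "limit_at f s x" "s \<ge> 0"
  shows "norm x \<le> bnd s * norm f"
proof (rule tendsto_upperbound[OF tendsto_norm[OF limit_at_step[OF assms]]])
  show "\<forall>\<^sub>F j in sequentially. norm (iter (step j) (steps s j) f) \<le> bnd s * norm f"
    using assms(2) step_pos by (intro always_eventually allI norm_iter_le step_steps_le) (auto intro: less_imp_le)
qed simp

text \<open>Stability makes the iterates equicontinuous, so convergence passes from initial values
  to their limits.\<close>

lemma limit_at_exists_closure: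
  assumes s: "s \<ge> 0" and f: "f \<in> closure {f. \<exists>x. limit_at f s x}"
  shows "\<exists>x. limit_at f s x"
proof -
  obtain g where g: "\<And>n. \<exists>x. limit_at (g n) s x" "g \<longlonglongrightarrow> f"
    using f by (auto simp: closure_sequential)
  then obtain x where x: "\<And>n. limit_at (g n) s (x n)" by metis
  \<comment> \<open>The elapsed times only converge to \<open>s\<close> and may exceed it; one unit
    of room covers them eventually.\<close>
  define C where "C = bnd (s + 1)"
  have C: "C \<ge> 1" unfolding C_def using s by (intro bnd_ge_1) auto
  have "bnd s \<le> C"
    unfolding C_def bnd_def using M_ge a_ge by (intro mult_left_mono) (auto simp: mult_left_mono)
  then have lip: "norm (x n - x m) \<le> C * norm (g n - g m)" for n m
    using limit_at_norm[OF limit_at_diff[OF x x] s, of n m]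
    by (meson mult_right_mono norm_ge_zero order_trans)
  have "Cauchy x"
  proof (rule metric_CauchyI)
    fix e :: real assume "e > 0"
    then have "e / C > 0" using C by simp
    then obtain N where N: "\<And>m n. m \<ge> N \<Longrightarrow> n \<ge> N \<Longrightarrow> dist (g m) (g n) < e / C"
      using metric_CauchyD[OF LIMSEQ_imp_Cauchy[OF g(2)]] by metis
    have "dist (x m) (x n) < e" if "m \<ge> N" "n \<ge> N" for m n
      using N[OF that] lip[of m n] C by (simp add: dist_norm field_simps)
    then show "\<exists>M. \<forall>m\<ge>M. \<forall>n\<ge>M. dist (x m) (x n) < e" by blast
  qed
  then obtain y where y: "x \<longlonglongrightarrow> y"
    using Cauchy_convergent convergent_def by blast
  have "limit_at f s y"
    unfolding limit_at_def
  proof (intro allI impI)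
    fix h :: "nat \<Rightarrow> real" and k
    assume h: "\<forall>j. h j > 0" "h \<longlonglongrightarrow> 0" and hk: "(\<lambda>j. h j * real (k j)) \<longlonglongrightarrow> s"
    have S: "\<forall>\<^sub>F j in sequentially. h j * real (k j) < s + 1"
      using hk by (rule order_tendstoD) simp
    show "(\<lambda>j. iter (h j) (k j) f) \<longlonglongrightarrow> y"
    proof (rule tendstoI)
      fix e :: real assume e: "e > 0"
      have "\<forall>\<^sub>F n in sequentially. dist (g n) f < e / (3 * C)"
        using e C by (intro tendstoD g) auto
      moreover have "\<forall>\<^sub>F n in sequentially. dist (x n) y < e / 3"
        using e by (intro tendstoD y) auto
      ultimately have "\<forall>\<^sub>F n in sequentially. dist (g n) f < e / (3 * C) \<and> dist (x n) y < e / 3"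
        by eventually_elim blast
      then obtain n where n: "dist (g n) f < e / (3 * C)" "dist (x n) y < e / 3"
        using eventually_happens'[OF sequentially_bot] by blast
      have "(\<lambda>j. iter (h j) (k j) (g n)) \<longlonglongrightarrow> x n"
        using h hk by (intro limit_atD[OF x]) auto
      then have "\<forall>\<^sub>F j in sequentially. dist (iter (h j) (k j) (g n)) (x n) < e / 3"
        using e by (intro tendstoD) auto
      with S show "\<forall>\<^sub>F j in sequentially. dist (iter (h j) (k j) f) y < e"
      proof eventually_elim
        case (elim j)
        have "norm (iter (h j) (k j) (f - g n)) \<le> C * norm (f - g n)"
          unfolding C_def using h(1) elim(1) by (intro norm_iter_le) (auto simp: less_imp_le)
        moreover have "C * norm (f - g n) < e / 3"
          using n(1) C by (simp add: dist_norm norm_minus_commute field_simps)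
        moreover have "iter (h j) (k j) f - y
            = iter (h j) (k j) (f - g n) + (iter (h j) (k j) (g n) - x n) + (x n - y)"
          by (simp add: blinfun.diff_right)
        then have "norm (iter (h j) (k j) f - y)
            \<le> norm (iter (h j) (k j) (f - g n)) + norm (iter (h j) (k j) (g n) - x n) + norm (x n - y)"
          by (simp only: norm_triangle3)
        ultimately show ?case
          using elim(2) n(2) by (simp add: dist_norm)
      qed
    qed
  qed
  then show ?thesis by blast
qed

text \<open>With equal step sizes the counts for \<open>r\<close> and \<open>s\<close> add up to a
  mesh for \<open>r + s\<close>. Stability permits replacing the inner iterate by its limit before
  the outer iterates are applied.\<close>

lemma limit_at_compose:
  assumes fx: "limit_at f s x" and xy: "limit_at x r y" and fz: "limit_at f (r + s) z"
    and s: "s \<ge> 0" and r: "r \<ge> 0"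
  shows "z = y"
proof -
  let ?k = "steps s" and ?l = "steps r"
  have "(\<lambda>j. step j * real (?l j + ?k j)) \<longlonglongrightarrow> r + s"
    using tendsto_add[OF step_steps_tendsto[OF r] step_steps_tendsto[OF s]]
    by (simp add: algebra_simps)
  then have "(\<lambda>j. iter (step j) (?l j + ?k j) f) \<longlonglongrightarrow> z"
    by (intro limit_atD[OF fz]) (auto simp: step_pos step_tendsto)
  then have z: "(\<lambda>j. iter (step j) (?l j) (iter (step j) (?k j) f)) \<longlonglongrightarrow> z"
    by (simp add: blinfun_power_add_apply)
  have "(\<lambda>j. iter (step j) (?l j) (iter (step j) (?k j) f - x)) \<longlonglongrightarrow> 0"
  proof (rule Lim_null_comparison)
    show "\<forall>\<^sub>F j in sequentially. norm (iter (step j) (?l j) (iter (step j) (?k j) f - x))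
        \<le> bnd r * norm (iter (step j) (?k j) f - x)"
      using r step_pos by (intro always_eventually allI norm_iter_le step_steps_le) (auto intro: less_imp_le)
    show "(\<lambda>j. bnd r * norm (iter (step j) (?k j) f - x)) \<longlonglongrightarrow> 0"
      using limit_at_step[OF fx s] by (intro tendsto_mult_right_zero tendsto_norm_zero LIM_zero)
  qed
  then have "(\<lambda>j. iter (step j) (?l j) (iter (step j) (?k j) f - x) + iter (step j) (?l j) x) \<longlonglongrightarrow> 0 + y"
    using limit_at_step[OF xy r] by (rule tendsto_add)
  then have "(\<lambda>j. iter (step j) (?l j) (iter (step j) (?k j) f)) \<longlonglongrightarrow> y"
    by (simp add: blinfun.diff_right)
  with z show ?thesis by (rule LIMSEQ_unique)
qed

lemma limit_at_initial:
  assumes e: "e > 0"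
  shows "\<forall>\<^sub>F s in at_right 0. \<forall>x. limit_at f s x \<longrightarrow> norm (x - f) \<le> e"
proof -
  have "\<forall>\<^sub>F \<delta> in at_right 0. \<forall>h>0. \<forall>k. h * real k \<le> \<delta> \<longrightarrow> (\<forall>y\<in>{f}. norm (iter h k y - y) \<le> e)"
    using e by (intro iter_small_compact) auto
  moreover have "\<forall>\<^sub>F \<delta> in at_right 0. \<delta> > (0::real)"
    by (rule eventually_at_right_less)
  ultimately show ?thesis
  proof eventually_elim
    case (elim s)
    show ?case
    proof (intro allI impI)
      fix x assume x: "limit_at f s x"
      have "(\<lambda>j. norm (iter (step j) (steps s j) f - f)) \<longlonglongrightarrow> norm (x - f)"
        using x elim(2) by (intro tendsto_intros limit_at_step) auto
      then show "norm (x - f) \<le> e"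
        by (rule tendsto_upperbound)
          (use elim step_pos step_steps_le[of s] in auto)
    qed
  qed
qed

text \<open>\<open>local_expansion\<close> is used with \<open>\<delta> = s\<close> held fixed while
  the step size tends to 0.\<close>

lemma limit_at_derivative:
  assumes xy: "(x, y) \<in> Gb" and e: "e > 0"
  shows "\<forall>\<^sub>F s in at_right 0. \<forall>z. limit_at x s z \<longrightarrow> norm (z - x - s *\<^sub>R y) \<le> e * s"
proof -
  have "\<forall>\<^sub>F \<delta> in at_right 0. \<forall>\<^sub>F h in at_right 0. \<forall>m. h * real m \<le> \<delta> \<longrightarrow>
    (\<forall>(x, y)\<in>{(x, y)}. norm (iter h m x - x - (h * real m) *\<^sub>R y) \<le> e * \<delta>)"
    using xy e by (intro local_expansion) auto
  moreover have "\<forall>\<^sub>F \<delta> in at_right 0. \<delta> > (0::real)"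
    by (rule eventually_at_right_less)
  ultimately show ?thesis
  proof eventually_elim
    case (elim s)
    show ?case
    proof (intro allI impI)
      fix z assume z: "limit_at x s z"
      have "(\<lambda>j. norm (iter (step j) (steps s j) x - x - (step j * real (steps s j)) *\<^sub>R y))
          \<longlonglongrightarrow> norm (z - x - s *\<^sub>R y)"
        using z elim(2) by (intro tendsto_intros limit_at_step step_steps_tendsto) auto
      moreover have "filterlim step (at_right 0) sequentially"
        using step_tendsto step_pos by (intro tendsto_imp_filterlim_at_right) auto
      then have "\<forall>\<^sub>F j in sequentially. norm (iter (step j) (steps s j) x - x - (step j * real (steps s j)) *\<^sub>R y) \<le> e * s"
        by (rule eventually_mono[OF eventually_compose_filterlim[OF elim(1)]])
          (use step_steps_le[of s] elim(2) in auto)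
      ultimately show "norm (z - x - s *\<^sub>R y) \<le> e * s"
        by (rule tendsto_upperbound) simp
    qed
  qed
qed

section \<open>The limit semigroup and its generator\<close>

definition limit_semigroup :: "real \<Rightarrow> 'a \<Rightarrow>\<^sub>L 'a" where
  "limit_semigroup s = Blinfun (\<lambda>f. THE x. limit_at f s x)"

definition classical_initial :: "'a set" where
  "classical_initial = {v 0 | v w. classical_solution v w}"

context
  assumes dense: "closure classical_initial = UNIV"
begin

lemma limit_at_exists:
  assumes "s \<ge> 0"
  shows "\<exists>x. limit_at f s x"
proof (rule limit_at_exists_closure[OF assms])
  have "classical_initial \<subseteq> {f. \<exists>x. limit_at f s x}"
    using assms by (auto simp: classical_initial_def intro: classical_solution_limit_at)
  from closure_mono[OF this] show "f \<in> closure {f. \<exists>x. limit_at f s x}"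
    using dense by auto
qed

lemma limit_semigroup_limit_at:
  assumes s: "s \<ge> 0"
  shows "limit_at f s (limit_semigroup s f)"
proof -
  let ?T = "\<lambda>f. THE x. limit_at f s x"
  have T: "limit_at f s (?T f)" for f
  proof -
    obtain x where "limit_at f s x" using limit_at_exists[OF s] by blast
    then show ?thesis
      using limit_at_unique[OF _ _ s] by (intro theI[of "limit_at f s"]) auto
  qed
  have "bounded_linear ?T"
  proof (rule bounded_linear_intro[where K = "bnd s"])
    fix f g c
    show "?T (f + g) = ?T f + ?T g"
      by (rule limit_at_unique[OF T limit_at_add[OF T T] s])
    show "?T (c *\<^sub>R f) = c *\<^sub>R ?T f"
      by (rule limit_at_unique[OF T limit_at_scaleR[OF T] s])
    show "norm (?T f) \<le> norm f * bnd s"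
      using limit_at_norm[OF T s] by (simp add: mult.commute)
  qed
  then show ?thesis
    using T by (simp add: limit_semigroup_def bounded_linear_Blinfun_apply)
qed

lemma limit_semigroup_eq: "limit_at f s x \<Longrightarrow> s \<ge> 0 \<Longrightarrow> limit_semigroup s f = x"
  by (rule limit_at_unique[OF limit_semigroup_limit_at])

lemma limit_semigroup_0: "limit_semigroup 0 = id_blinfun"
proof (rule blinfun_eqI)
  fix f
  have "(\<lambda>j. iter (step j) (steps 0 j) f) \<longlonglongrightarrow> limit_semigroup 0 f"
    by (rule limit_at_step[OF limit_semigroup_limit_at]) auto
  moreover have "steps 0 j = 0" for j
    by (simp add: steps_def)
  ultimately show "limit_semigroup 0 f = id_blinfun f"
    by (simp add: LIMSEQ_const_iff)
qed

lemma limit_semigroup_C0: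
  assumes smul: "rc_normed_space smul" and F: "\<And>h. h \<ge> 0 \<Longrightarrow> F h \<in> bounded_operators smul"
  shows "C0_semigroup smul limit_semigroup"
  unfolding C0_semigroup_def
proof (intro conjI allI impI)
  fix s :: real assume s: "s \<ge> 0"
  have iter_smul: "iter h k (smul c x) = smul c (iter h k x)" if "h \<ge> 0" for h k c x
    using F[OF that] by (induction k) (auto simp: bounded_operators_def)
  have "limit_semigroup s (smul c x) = smul c (limit_semigroup s x)" for c x
  proof (rule limit_semigroup_eq[OF _ s])
    interpret rc_normed_space smul by fact
    show "limit_at (smul c x) s (smul c (limit_semigroup s x))"
      unfolding limit_at_def
    proof (intro allI impI)
      fix h :: "nat \<Rightarrow> real" and k
      assume h: "\<forall>j. h j > 0" "h \<longlonglongrightarrow> 0" and hk: "(\<lambda>j. h j * real (k j)) \<longlonglongrightarrow> s"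
      have "(\<lambda>j. smul c (iter (h j) (k j) x)) \<longlonglongrightarrow> smul c (limit_semigroup s x)"
        using h hk by (intro bounded_linear.tendsto[OF bounded_linear_smul]
            limit_atD[OF limit_semigroup_limit_at[OF s]]) auto
      with h(1) show "(\<lambda>j. iter (h j) (k j) (smul c x)) \<longlonglongrightarrow> smul c (limit_semigroup s x)"
        by (simp add: iter_smul less_imp_le)
    qed
  qed
  then show "limit_semigroup s \<in> bounded_operators smul"
    by (simp add: bounded_operators_def)
next
  fix r s :: real assume "r \<ge> 0" "s \<ge> 0"
  then show "limit_semigroup (r + s) = limit_semigroup r o\<^sub>L limit_semigroup s"
    by (intro blinfun_eqI)
      (auto intro!: limit_at_compose[OF limit_semigroup_limit_at limit_semigroup_limit_at limit_semigroup_limit_at])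
next
  fix x
  show "((\<lambda>s. limit_semigroup s x) \<longlongrightarrow> x) (at_right 0)"
  proof (rule tendstoI)
    fix e :: real assume e: "e > 0"
    have "\<forall>\<^sub>F s in at_right 0. \<forall>y. limit_at x s y \<longrightarrow> norm (y - x) \<le> e / 2"
      using e by (intro limit_at_initial) auto
    moreover have "\<forall>\<^sub>F s in at_right 0. s > (0::real)"
      by (rule eventually_at_right_less)
    ultimately show "\<forall>\<^sub>F s in at_right 0. dist (limit_semigroup s x) x < e"
    proof eventually_elim
      case (elim s)
      then have "norm (limit_semigroup s x - x) \<le> e / 2"
        using limit_semigroup_limit_at[of s x] by auto
      with e show ?case by (simp add: dist_norm)
    qed
  qed
qed (rule limit_semigroup_0)

lemma Gb_subset_generator: "Gb \<subseteq> generator limit_semigroup"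
proof clarify
  fix x y assume xy: "(x, y) \<in> Gb"
  have "((\<lambda>h. (1 / h) *\<^sub>R (limit_semigroup h x - x)) \<longlongrightarrow> y) (at_right 0)"
  proof (rule tendstoI)
    fix e :: real assume e: "e > 0"
    have "\<forall>\<^sub>F s in at_right 0. \<forall>z. limit_at x s z \<longrightarrow> norm (z - x - s *\<^sub>R y) \<le> e / 2 * s"
      using e by (intro limit_at_derivative xy) auto
    moreover have "\<forall>\<^sub>F s in at_right 0. s > (0::real)"
      by (rule eventually_at_right_less)
    ultimately show "\<forall>\<^sub>F s in at_right 0. dist ((1 / s) *\<^sub>R (limit_semigroup s x - x)) y < e"
    proof eventually_elim
      case (elim s)
      then have *: "norm (limit_semigroup s x - x - s *\<^sub>R y) \<le> e / 2 * s"
        using limit_semigroup_limit_at[of s x] by auto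
      have "(1 / s) *\<^sub>R (limit_semigroup s x - x) - y = (1 / s) *\<^sub>R (limit_semigroup s x - x - s *\<^sub>R y)"
        using elim(2) by (simp add: scaleR_diff_right)
      then have "norm ((1 / s) *\<^sub>R (limit_semigroup s x - x) - y) = norm (limit_semigroup s x - x - s *\<^sub>R y) / s"
        using elim(2) by simp
      also have "\<dots> \<le> e / 2"
        using * elim(2) by (simp add: field_simps)
      finally show ?case using e by (simp add: dist_norm)
    qed
  qed
  then show "(x, y) \<in> generator limit_semigroup"
    by (simp add: generator_def strong_derivative0_def limit_semigroup_0)
qed

lemma classical_solution_semigroup:
  "classical_solution v w \<Longrightarrow> s \<ge> 0 \<Longrightarrow> limit_semigroup s (v 0) = v s"
  by (rule limit_semigroup_eq[OF classical_solution_limit_at])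

text \<open>A pair \<open>(f, g)\<close> annihilating \<open>Gb\<close> must annihilate
  \<open>(x, y)\<close>. Along the orbit of a classical initial value \<open>z\<close>, the function
  \<open>g (T r z)\<close> has derivative \<open>- f (T r z)\<close>, so
  \<open>g (T \<delta> z - z)\<close> is close to \<open>- \<delta> * f z\<close>. This relation
  contains no derivative of the orbit any more and extends to \<open>x\<close> by density; division
  by \<open>\<delta>\<close> then gives the claim.\<close>

lemma generator_subset_Gb: "generator limit_semigroup \<subseteq> Gb"
proof clarify
  fix x y assume xy: "(x, y) \<in> generator limit_semigroup"
  let ?T = limit_semigroup
  have lim: "((\<lambda>h. (1 / h) *\<^sub>R (?T h x - x)) \<longlongrightarrow> y) (at_right 0)"
    using xy by (simp add: generator_def strong_derivative0_def limit_semigroup_0)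
  show "(x, y) \<in> Gb"
  proof (rule hahn_banach_closed_relation[OF subspace_Gb closed_Gb])
    fix f g :: "'a \<Rightarrow>\<^sub>L real"
    assume fg: "\<forall>(x, y)\<in>Gb. f x + g y = 0"
    define C where "C = bnd 1 + 1"
    have C: "C \<ge> 0" using bnd_ge_1[of 1] by (simp add: C_def)
    have small: "\<bar>f x + g y\<bar> \<le> norm f * e" if e: "e > 0" for e
    proof -
      have "\<forall>\<^sub>F s in at_right 0. \<forall>z. limit_at x s z \<longrightarrow> norm (z - x) \<le> e"
        using e by (intro limit_at_initial) auto
      then obtain b where b: "b > 0" "\<And>s. 0 < s \<Longrightarrow> s < b \<Longrightarrow> norm (?T s x - x) \<le> e"
        unfolding eventually_at_right_field by (meson limit_semigroup_limit_at less_imp_le)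
      have near: "norm (?T r z - z) \<le> C * norm (z - x) + e" if r: "0 \<le> r" "r < b" "r \<le> 1" for r z
      proof -
        have "norm (?T r x - x) \<le> e"
          using b(2)[of r] r e by (cases "r = 0") (auto simp: limit_semigroup_0)
        moreover have "norm (?T r (z - x)) \<le> bnd 1 * norm (z - x)"
        proof -
          have "norm (?T r (z - x)) \<le> bnd r * norm (z - x)"
            by (rule limit_at_norm[OF limit_semigroup_limit_at]) (use r in auto)
          also have "bnd r \<le> bnd 1"
            unfolding bnd_def using M_ge a_ge r by (intro mult_left_mono) (auto simp: mult_left_le)
          then have "bnd r * norm (z - x) \<le> bnd 1 * norm (z - x)"
            by (rule mult_right_mono) simp
          finally show ?thesis .
        qed
        moreover have "?T r z - z = ?T r (z - x) + (?T r x - x) - (z - x)"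
          by (simp add: blinfun.diff_right)
        then have "norm (?T r z - z) \<le> norm (?T r (z - x)) + norm (?T r x - x) + norm (z - x)"
          by (simp only: norm_triangle3_diff)
        ultimately show ?thesis by (simp add: C_def algebra_simps)
      qed
      have classical: "\<bar>g (?T \<delta> z - z) + \<delta> * f z\<bar> \<le> \<delta> * (norm f * (C * norm (z - x) + e))"
        if \<delta>: "0 < \<delta>" "\<delta> < b" "\<delta> \<le> 1" and z: "z \<in> classical_initial" for \<delta> z
      proof -
        obtain v w where v: "classical_solution v w" "v 0 = z"
          using z by (auto simp: classical_initial_def)
        have vT: "v r = ?T r z" if "r \<ge> 0" for r
          using classical_solution_semigroup[OF v(1) that] v(2) by simp
        \<comment> \<open>Annihilation expresses \<open>g (w r)\<close> through the orbit itself.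
          This is essential: as \<open>z\<close> tends to \<open>x\<close>, the orbits converge,
          while nothing is known about the derivatives.\<close>
        have gw: "g (w r) = - f (v r)" if "r \<ge> 0" for r
          using fg v(1) that unfolding classical_solution_def by fastforce
        have "norm (g (v \<delta>) - g (v 0) - (\<delta> - 0) *\<^sub>R g (w 0)) \<le> norm (\<delta> - 0) * (norm f * (C * norm (z - x) + e))"
        proof (rule vector_differentiable_bound_linearization[where S = "{0..\<delta>}" and f = "\<lambda>r. g (v r)"
              and f' = "\<lambda>r. g (w r)" and ?x0.0 = 0])
          fix r assume r: "r \<in> {0..\<delta>}"
          have "(v has_vector_derivative w r) (at r within {0..})"
            using v(1) r by (simp add: classical_solution_def)
          then have "(v has_vector_derivative w r) (at r within {0..\<delta>})"
            by (rule has_vector_derivative_within_subset) auto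
          then show "((\<lambda>r. g (v r)) has_vector_derivative g (w r)) (at r within {0..\<delta>})"
            by (rule bounded_linear.has_vector_derivative[OF blinfun.bounded_linear_right])
          have "g (w r) - g (w 0) = f (z - ?T r z)"
            using r v(2) by (simp add: gw vT blinfun.diff_right)
          then have "norm (g (w r) - g (w 0)) \<le> norm f * norm (?T r z - z)"
            using norm_blinfun[of f "z - ?T r z"] by (simp add: norm_minus_commute)
          also have "\<dots> \<le> norm f * (C * norm (z - x) + e)"
            using near[of r z] r \<delta> by (intro mult_left_mono) auto
          finally show "norm (g (w r) - g (w 0)) \<le> norm f * (C * norm (z - x) + e)" .
        qed (use \<delta> in \<open>auto simp: closed_segment_eq_real_ivl\<close>)
        then show ?thesis
          using gw[of 0] v(2) vT[of \<delta>] \<delta> by (simp add: blinfun.diff_right algebra_simps)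
      qed
      \<comment> \<open>\<open>\<delta>\<close> stays fixed while \<open>z\<close> tends to
        \<open>x\<close>, and tends to 0 only afterwards. The bound survives the first limit because
        \<open>z\<close> enters it only through its distance to \<open>x\<close>.\<close>
      have all: "\<bar>g (?T \<delta> x - x) + \<delta> * f x\<bar> \<le> \<delta> * (norm f * e)"
        if \<delta>: "0 < \<delta>" "\<delta> < b" "\<delta> \<le> 1" for \<delta>
      proof -
        have "x \<in> closure classical_initial" using dense by simp
        then obtain z where z: "\<And>n. z n \<in> classical_initial" "z \<longlonglongrightarrow> x"
          by (auto simp: closure_sequential)
        have "(\<lambda>n. \<bar>g (?T \<delta> (z n) - z n) + \<delta> * f (z n)\<bar>) \<longlonglongrightarrow> \<bar>g (?T \<delta> x - x) + \<delta> * f x\<bar>"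
          by (intro tendsto_intros z)
        moreover have "(\<lambda>n. \<delta> * (norm f * (C * norm (z n - x) + e))) \<longlonglongrightarrow> \<delta> * (norm f * (C * norm (x - x) + e))"
          by (intro tendsto_intros z)
        ultimately show ?thesis
          using classical[OF \<delta> z(1)] by (auto intro: LIMSEQ_le)
      qed
      have "((\<lambda>\<delta>. \<bar>g ((1 / \<delta>) *\<^sub>R (?T \<delta> x - x)) + f x\<bar>) \<longlongrightarrow> \<bar>g y + f x\<bar>) (at_right 0)"
        by (intro tendsto_intros lim)
      moreover have "\<forall>\<^sub>F \<delta> in at_right 0. \<bar>g ((1 / \<delta>) *\<^sub>R (?T \<delta> x - x)) + f x\<bar> \<le> norm f * e"
      proof -
        have "\<forall>\<^sub>F \<delta> in at_right 0. \<delta> < min b 1"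
          using b(1) by (intro eventually_at_right_0_less) auto
        moreover have "\<forall>\<^sub>F \<delta> in at_right 0. \<delta> > (0::real)"
          by (rule eventually_at_right_less)
        ultimately show ?thesis
        proof eventually_elim
          case (elim \<delta>)
          have "\<bar>g ((1 / \<delta>) *\<^sub>R (?T \<delta> x - x)) + f x\<bar> = \<bar>(g (?T \<delta> x - x) + \<delta> * f x) / \<delta>\<bar>"
            using elim by (simp add: blinfun.scaleR_right add_divide_distrib)
          also have "\<dots> = \<bar>g (?T \<delta> x - x) + \<delta> * f x\<bar> / \<delta>"
            using elim by simp
          also have "\<dots> \<le> norm f * e"
            using all[of \<delta>] elim by (simp add: field_simps)
          finally show ?case .
        qed
      qed
      ultimately have "\<bar>g y + f x\<bar> \<le> norm f * e"
        by (rule tendsto_upperbound) simp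
      then show ?thesis by (simp add: add.commute)
    qed
    have "\<bar>f x + g y\<bar> \<le> 0 + e" if e: "e > 0" for e
    proof -
      \<comment> \<open>The denominator \<open>norm f + 1\<close> covers the case
        \<open>f = 0\<close>.\<close>
      have "\<bar>f x + g y\<bar> \<le> norm f * (e / (norm f + 1))"
        using e by (intro small) (simp add: add_nonneg_pos)
      also have "\<dots> \<le> (norm f + 1) * (e / (norm f + 1))"
        using e by (intro mult_right_mono) auto
      also have "\<dots> = e"
        using add_nonneg_pos[OF norm_ge_zero[of f] zero_less_one] by simp
      finally show ?thesis by simp
    qed
    then have "\<bar>f x + g y\<bar> \<le> 0"
      by (rule field_le_epsilon)
    then show "f x + g y = 0" by simp
  qed
qed

theorem limit_semigroup_generates:
  assumes "rc_normed_space smul" and "\<And>h. h \<ge> 0 \<Longrightarrow> F h \<in> bounded_operators smul"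
  shows "generates smul Gb limit_semigroup"
  using limit_semigroup_C0[OF assms] Gb_subset_generator generator_subset_Gb
  by (auto simp: generates_def)

end

end

lemma functional_eqI:
  fixes x y :: "'a::real_normed_vector"
  assumes "\<And>\<phi> :: 'a \<Rightarrow>\<^sub>L real. \<phi> x = \<phi> y"
  shows "x = y"
proof -
  obtain \<phi> :: "'a \<Rightarrow>\<^sub>L real" where "\<phi> (x - y) = norm (x - y)"
    using exists_norming_functional[of "x - y"] by blast
  with assms[of \<phi>] show ?thesis by (simp add: blinfun.diff_right)
qed

lemma has_vector_derivative_quadratic:
  fixes f :: "real \<Rightarrow> 'b::real_normed_vector"
  assumes quad: "\<And>y. y \<in> S \<Longrightarrow> \<bar>y - x\<bar> \<le> 1 \<Longrightarrow> norm (f y - f x - (y - x) *\<^sub>R d) \<le> C * (y - x)\<^sup>2"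
  shows "(f has_vector_derivative d) (at x within S)"
  unfolding has_vector_derivative_def has_derivative_within
proof
  show "bounded_linear (\<lambda>h. h *\<^sub>R d)" by (rule bounded_linear_scaleR_left)
  show "((\<lambda>y. (1 / norm (y - x)) *\<^sub>R (f y - (f x + (y - x) *\<^sub>R d))) \<longlongrightarrow> 0) (at x within S)"
  proof (rule Lim_null_comparison)
    show "((\<lambda>y. C * \<bar>y - x\<bar>) \<longlongrightarrow> 0) (at x within S)"
      by (auto intro!: tendsto_eq_intros)
    have "\<forall>\<^sub>F y in at x within S. y \<in> S \<and> y \<noteq> x"
      by (auto simp: eventually_at_filter)
    moreover have "\<forall>\<^sub>F y in at x within S. dist y x < 1"
      by (rule tendstoD[OF tendsto_ident_at]) simp
    ultimately show "\<forall>\<^sub>F y in at x within S. norm ((1 / norm (y - x)) *\<^sub>R (f y - (f x + (y - x) *\<^sub>R d))) \<le> C * \<bar>y - x\<bar>"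
    proof eventually_elim
      case (elim y)
      then have "norm (f y - (f x + (y - x) *\<^sub>R d)) \<le> C * \<bar>y - x\<bar> * \<bar>y - x\<bar>"
        using quad[of y] by (simp add: dist_real_def power2_eq_square mult.assoc diff_diff_eq)
      moreover have "norm ((1 / norm (y - x)) *\<^sub>R (f y - (f x + (y - x) *\<^sub>R d)))
          = norm (f y - (f x + (y - x) *\<^sub>R d)) / \<bar>y - x\<bar>"
        by (simp only: norm_scaleR) simp
      moreover have "\<bar>y - x\<bar> > 0" using elim(1) by simp
      ultimately show ?case
        by (simp only: pos_divide_le_eq)
    qed
  qed
qed

section \<open>Difference quotients of the adjoint family\<close>

context stable_scheme
begin

definition dual_dq :: "real \<Rightarrow> ('a \<Rightarrow>\<^sub>L real) \<Rightarrow> ('a \<Rightarrow>\<^sub>L real)" where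
  "dual_dq h \<psi> = (1 / h) *\<^sub>R ((\<psi> o\<^sub>L F h) - \<psi>)"

text \<open>The domain of the strong derivative at 0 of the adjoint family, for the real dual and in
  the norm of the dual.\<close>

definition dual_domain :: "('a \<Rightarrow>\<^sub>L real) set" where
  "dual_domain = {\<psi>. \<exists>\<psi>'. ((\<lambda>h. dual_dq h \<psi>) \<longlongrightarrow> \<psi>') (at_right 0)}"

lemma dual_dq_apply: "blinfun_apply (dual_dq h \<psi>) x = \<psi> (dq h x)"
  by (simp add: dual_dq_def dq_def blinfun.scaleR_left blinfun.scaleR_right blinfun.diff_left blinfun.diff_right)

lemma subspace_dual_domain: "subspace dual_domain"
proof (rule subspaceI)
  have "dual_dq h 0 = 0" for h
    by (rule blinfun_eqI) (simp add: dual_dq_apply)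
  then show "0 \<in> dual_domain"
    by (auto simp: dual_domain_def)
next
  fix \<phi> \<psi> assume "\<phi> \<in> dual_domain" "\<psi> \<in> dual_domain"
  then obtain \<phi>' \<psi>' where "((\<lambda>h. dual_dq h \<phi>) \<longlongrightarrow> \<phi>') (at_right 0)" "((\<lambda>h. dual_dq h \<psi>) \<longlongrightarrow> \<psi>') (at_right 0)"
    by (auto simp: dual_domain_def)
  then have "((\<lambda>h. dual_dq h \<phi> + dual_dq h \<psi>) \<longlongrightarrow> \<phi>' + \<psi>') (at_right 0)"
    by (rule tendsto_add)
  moreover have "dual_dq h (\<phi> + \<psi>) = dual_dq h \<phi> + dual_dq h \<psi>" for h
    by (rule blinfun_eqI) (simp add: dual_dq_apply blinfun.add_left)
  ultimately show "\<phi> + \<psi> \<in> dual_domain"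
    by (auto simp: dual_domain_def)
next
  fix c \<phi> assume "\<phi> \<in> dual_domain"
  then obtain \<phi>' where "((\<lambda>h. dual_dq h \<phi>) \<longlongrightarrow> \<phi>') (at_right 0)"
    by (auto simp: dual_domain_def)
  then have "((\<lambda>h. c *\<^sub>R dual_dq h \<phi>) \<longlongrightarrow> c *\<^sub>R \<phi>') (at_right 0)"
    by (intro tendsto_intros)
  moreover have "dual_dq h (c *\<^sub>R \<phi>) = c *\<^sub>R dual_dq h \<phi>" for h
    by (rule blinfun_eqI) (simp add: dual_dq_apply blinfun.scaleR_left)
  ultimately show "c *\<^sub>R \<phi> \<in> dual_domain"
    by (auto simp: dual_domain_def)
qed

text \<open>The difference quotient may be put on the functional or on the point, with equal limits:
  on \<open>D\<close> the adjoint derivative acts as the adjoint of \<open>Z\<close>.\<close>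

lemma dual_derivative_on_D:
  assumes \<psi>: "((\<lambda>h. dual_dq h \<psi>) \<longlongrightarrow> \<psi>') (at_right 0)" and x: "x \<in> D"
  shows "\<psi>' x = \<psi> (Z x)"
proof (rule tendsto_unique[OF trivial_limit_at_right_real])
  show "((\<lambda>h. \<psi> (dq h x)) \<longlongrightarrow> \<psi>' x) (at_right 0)"
    unfolding dual_dq_apply[symmetric] by (intro blinfun.tendsto \<psi> tendsto_const)
  show "((\<lambda>h. \<psi> (dq h x)) \<longlongrightarrow> \<psi> (Z x)) (at_right 0)"
    by (intro blinfun.tendsto dq_tendsto x tendsto_const)
qed

lemma norm_iter_shift_diff_le:
  assumes h: "h > 0" and S: "h * real (k + l) \<le> S"
  shows "norm (iter h (k + l) f - iter h k f) \<le> bnd S * (h * real l * (bnd S * norm (dq h f)))"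
proof -
  have k: "h * real k \<le> S" and l: "h * real l \<le> S"
    using S h mult_left_mono[of "real k" "real (k + l)" h] mult_left_mono[of "real l" "real (k + l)" h]
    by linarith+
  have "iter h (k + l) f - iter h k f = iter h k (iter h l f - f)"
    by (simp add: blinfun_power_add_apply blinfun.diff_right)
  moreover have "norm (iter h k (iter h l f - f)) \<le> bnd S * norm (iter h l f - f)"
    using h k by (intro norm_iter_le) auto
  moreover have "0 \<le> S"
    using k h by (meson less_imp_le mult_nonneg_nonneg of_nat_0_le_iff order_trans)
  then have "bnd S * norm (iter h l f - f) \<le> bnd S * (h * real l * (bnd S * norm (dq h f)))"
    using bnd_ge_1[of S] by (intro mult_left_mono norm_iter_diff_le[OF h l]) auto
  ultimately show ?thesis by simp
qed

text \<open>The difference quotient of an iterate, about which little is known, is moved to the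
  functional, where it is close to \<open>\<psi>'\<close> in norm. The remaining error comes from
  the motion of the orbit, which is Lipschitz in time.\<close>

lemma functional_expansion:
  fixes \<psi> \<psi>' :: "'a \<Rightarrow>\<^sub>L real"
  assumes h: "h > 0" and S: "h * real (k + l) \<le> S"
  shows "\<bar>\<psi> (iter h (k + l) f) - \<psi> (iter h k f) - h * real l * \<psi>' (iter h k f)\<bar>
    \<le> h * real l * (norm (dual_dq h \<psi> - \<psi>') * (bnd S * norm f)
        + norm \<psi>' * (bnd S * (h * real l * (bnd S * norm (dq h f)))))"
proof -
  let ?B = "norm (dual_dq h \<psi> - \<psi>') * (bnd S * norm f)
        + norm \<psi>' * (bnd S * (h * real l * (bnd S * norm (dq h f))))"
  have hm: "h * real i \<le> h * real j" if "i \<le> j" for i j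
    using h that by (intro mult_left_mono) auto
  have "0 \<le> h * real (k + l)" using h by simp
  with S have S0: "0 \<le> S" by linarith
  have const: "(\<Sum>i<l. h * c) = h * real l * c" for c :: real
    by simp
  have step: "iter h (k + Suc i) f - iter h (k + i) f = h *\<^sub>R dq h (iter h (k + i) f)" for i
    using h by (simp add: dq_def)
  have "\<psi> (iter h (k + l) f) - \<psi> (iter h k f) = (\<Sum>i<l. \<psi> (iter h (k + Suc i) f) - \<psi> (iter h (k + i) f))"
    using sum_lessThan_telescope[of "\<lambda>i. \<psi> (iter h (k + i) f)" l] by simp
  also have "\<dots> = (\<Sum>i<l. h * blinfun_apply (dual_dq h \<psi>) (iter h (k + i) f))"
    by (simp only: blinfun.diff_right[symmetric] step blinfun.scaleR_right dual_dq_apply real_scaleR_def)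
  finally have eq: "\<psi> (iter h (k + l) f) - \<psi> (iter h k f) - h * real l * \<psi>' (iter h k f)
      = (\<Sum>i<l. h * (blinfun_apply (dual_dq h \<psi>) (iter h (k + i) f) - \<psi>' (iter h k f)))"
    by (simp add: sum_subtractf right_diff_distrib)
  have "norm (\<Sum>i<l. h * (blinfun_apply (dual_dq h \<psi>) (iter h (k + i) f) - \<psi>' (iter h k f)))
      \<le> (\<Sum>i<l. h * ?B)"
  proof (rule sum_norm_le)
    fix i assume i: "i \<in> {..<l}"
    have ki: "h * real (k + i) \<le> S"
      using i S hm[of "k + i" "k + l"] by simp
    have "norm (blinfun_apply (dual_dq h \<psi> - \<psi>') (iter h (k + i) f)) \<le> norm (dual_dq h \<psi> - \<psi>') * (bnd S * norm f)"
      using h ki by (intro order_trans[OF norm_blinfun] mult_left_mono norm_iter_le) auto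
    moreover have "norm (iter h (k + i) f - iter h k f) \<le> bnd S * (h * real l * (bnd S * norm (dq h f)))"
    proof -
      have "h * real i * (bnd S * norm (dq h f)) \<le> h * real l * (bnd S * norm (dq h f))"
        using i hm[of i l] bnd_ge_1[OF S0] by (intro mult_right_mono) auto
      then have "bnd S * (h * real i * (bnd S * norm (dq h f))) \<le> bnd S * (h * real l * (bnd S * norm (dq h f)))"
        using bnd_ge_1[OF S0] by (intro mult_left_mono) auto
      with norm_iter_shift_diff_le[OF h ki, of f] show ?thesis by linarith
    qed
    then have "norm (blinfun_apply \<psi>' (iter h (k + i) f - iter h k f))
        \<le> norm \<psi>' * (bnd S * (h * real l * (bnd S * norm (dq h f))))"
      by (intro order_trans[OF norm_blinfun] mult_left_mono) auto
    moreover have "blinfun_apply (dual_dq h \<psi>) (iter h (k + i) f) - \<psi>' (iter h k f)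
        = blinfun_apply (dual_dq h \<psi> - \<psi>') (iter h (k + i) f) + blinfun_apply \<psi>' (iter h (k + i) f - iter h k f)"
      by (simp add: blinfun.diff_left blinfun.diff_right)
    ultimately have "norm (blinfun_apply (dual_dq h \<psi>) (iter h (k + i) f) - \<psi>' (iter h k f)) \<le> ?B"
      by (metis (no_types, lifting) add_mono norm_triangle_le)
    then show "norm (h * (blinfun_apply (dual_dq h \<psi>) (iter h (k + i) f) - \<psi>' (iter h k f))) \<le> h * ?B"
      using h by (simp add: abs_mult)
  qed
  also have "(\<Sum>i<l. h * ?B) = h * real l * ?B"
    by (rule const)
  finally show ?thesis unfolding eq by (simp only: real_norm_def)
qed

end

section \<open>Weak limits of the discrete orbits\<close>

locale approximate_orbit = stable_scheme +
  fixes t :: real and f :: 'a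
  assumes refl: "reflexive_space (scaleR :: real \<Rightarrow> 'a \<Rightarrow> 'a)"
    and dual_dense: "closure dual_domain = UNIV"
    and t: "t > 0" and f: "f \<in> D"
    and orbit: "\<And>s. s \<ge> 0 \<Longrightarrow> \<exists>g. (\<forall>n\<ge>1. g n \<in> D) \<and>
      (\<lambda>n. norm (iter (t / real n) (nat \<lfloor>real n * s\<rfloor>) f - g n)) \<longlonglongrightarrow> 0 \<and>
      bounded ((\<lambda>n. Z (g n)) ` {1..})"
begin

text \<open>At \<open>n = 0\<close> the division convention gives step size 0; bounds that need only
  \<open>mesh n \<ge> 0\<close> hold there as well, positivity starts at
  \<open>n = 1\<close>.\<close>

definition mesh :: "nat \<Rightarrow> real" where "mesh n = t / real n"

text \<open>Hypothesis (iv) measures time in units of \<open>t\<close>: \<open>[n s]\<close> steps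
  of size \<open>t / n\<close> reach time about \<open>t * s\<close>. Dividing \<open>r\<close> by
  \<open>t\<close> makes \<open>r\<close> the elapsed time.\<close>

definition count :: "nat \<Rightarrow> real \<Rightarrow> nat" where "count n r = nat \<lfloor>real n * (r / t)\<rfloor>"

definition orb :: "nat \<Rightarrow> real \<Rightarrow> 'a" where "orb n r = iter (mesh n) (count n r) f"

lemma mesh_nonneg: "mesh n \<ge> 0"
  using t by (simp add: mesh_def)

lemma mesh_pos: "n \<ge> 1 \<Longrightarrow> mesh n > 0"
  using t by (simp add: mesh_def)

lemma mesh_tendsto: "mesh \<longlonglongrightarrow> 0"
  unfolding mesh_def by (rule lim_const_over_n)

lemma mesh_at_right: "filterlim mesh (at_right 0) sequentially"
  by (rule tendsto_imp_filterlim_at_right[OF mesh_tendsto])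
    (use mesh_pos in \<open>auto simp: eventually_sequentially\<close>)

lemma mesh_count_le: "r \<ge> 0 \<Longrightarrow> mesh n * real (count n r) \<le> r"
  and mesh_count_ge: "r \<ge> 0 \<Longrightarrow> n \<ge> 1 \<Longrightarrow> r - mesh n \<le> mesh n * real (count n r)"
proof -
  assume r: "r \<ge> 0"
  then have "real (count n r) = of_int \<lfloor>real n * (r / t)\<rfloor>"
    using t by (simp add: count_def)
  then have c: "real (count n r) \<le> real n * (r / t)" "real n * (r / t) - 1 \<le> real (count n r)"
    by linarith+
  show "mesh n * real (count n r) \<le> r"
  proof (cases "n = 0")
    case True
    then show ?thesis using r by (simp add: mesh_def)
  next
    case False
    have "mesh n * real (count n r) \<le> mesh n * (real n * (r / t))"
      using c(1) mesh_nonneg by (rule mult_left_mono)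
    also have "\<dots> = r" using False t by (simp add: mesh_def)
    finally show ?thesis .
  qed
  assume n: "n \<ge> 1"
  have "r - mesh n = mesh n * (real n * (r / t) - 1)"
    using n t by (simp add: mesh_def algebra_simps)
  also have "\<dots> \<le> mesh n * real (count n r)"
    using c(2) mesh_nonneg by (rule mult_left_mono)
  finally show "r - mesh n \<le> mesh n * real (count n r)" .
qed

lemma mesh_count_tendsto:
  assumes "r \<ge> 0"
  shows "(\<lambda>n. mesh n * real (count n r)) \<longlonglongrightarrow> r"
proof (rule tendsto_sandwich)
  show "(\<lambda>n. r - mesh n) \<longlonglongrightarrow> r"
    using tendsto_diff[OF tendsto_const mesh_tendsto] by simp
  show "\<forall>\<^sub>F n in sequentially. r - mesh n \<le> mesh n * real (count n r)"
    using mesh_count_ge[OF assms] by (auto simp: eventually_sequentially)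
qed (use assms mesh_count_le in auto)

lemma count_mono: "r \<le> r' \<Longrightarrow> count n r \<le> count n r'"
  unfolding count_def using t by (intro nat_mono floor_mono mult_left_mono divide_right_mono) auto

definition dqb :: real where "dqb = (SOME B. \<forall>n. norm (dq (mesh n) f) \<le> B)"

lemma dq_mesh_tendsto: "(\<lambda>n. dq (mesh n) f) \<longlonglongrightarrow> Z f"
  by (rule filterlim_compose[OF dq_tendsto[OF f] mesh_at_right])

lemma dqb: "norm (dq (mesh n) f) \<le> dqb"
proof -
  have "\<exists>B. \<forall>n. norm (dq (mesh n) f) \<le> B"
    using convergent_imp_Bseq[OF convergentI[OF dq_mesh_tendsto]] by (auto simp: Bseq_def)
  then have "\<forall>n. norm (dq (mesh n) f) \<le> dqb"
    unfolding dqb_def by (rule someI_ex)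
  then show ?thesis by blast
qed

lemma orb_bound: "0 \<le> r \<Longrightarrow> r \<le> S \<Longrightarrow> norm (orb n r) \<le> bnd S * norm f"
  unfolding orb_def using mesh_nonneg order_trans[OF mesh_count_le] by (intro norm_iter_le) auto

lemma dq_orb_bound:
  assumes "0 \<le> r" "r \<le> S"
  shows "norm (dq (mesh n) (orb n r)) \<le> bnd S * dqb"
proof -
  have "dq (mesh n) (orb n r) = iter (mesh n) (count n r) (dq (mesh n) f)"
    by (simp add: orb_def dq_def blinfun.scaleR_right blinfun.diff_right blinfun_power_commute)
  moreover have "norm (iter (mesh n) (count n r) (dq (mesh n) f)) \<le> bnd S * norm (dq (mesh n) f)"
    using assms mesh_nonneg order_trans[OF mesh_count_le] by (intro norm_iter_le) auto
  moreover have "bnd S * norm (dq (mesh n) f) \<le> bnd S * dqb"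
    using bnd_ge_1[of S] assms by (intro mult_left_mono dqb) auto
  ultimately show ?thesis by simp
qed

definition ufilter :: "nat filter" where
  "ufilter = (SOME G. fine_filter G \<and> G \<le> sequentially)"

lemma ufilter: "fine_filter ufilter" "ufilter \<le> sequentially"
proof -
  have "fine_filter ufilter \<and> ufilter \<le> sequentially"
    unfolding ufilter_def by (rule someI_ex[OF exists_fine_filter[OF sequentially_bot]])
  then show "fine_filter ufilter" "ufilter \<le> sequentially" by auto
qed

lemma ufilter_bot: "ufilter \<noteq> bot"
  by (rule fine_filter_nontrivial[OF ufilter(1)])

lemma tendsto_ufilter: "X \<longlonglongrightarrow> l \<Longrightarrow> (X \<longlongrightarrow> l) ufilter"
  by (rule tendsto_mono[OF ufilter(2)])

lemma eventually_ufilter: "eventually P sequentially \<Longrightarrow> eventually P ufilter"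
  by (rule filter_leD[OF ufilter(2)])

definition weak_sol :: "real \<Rightarrow> 'a" where
  "weak_sol r = (SOME y. \<forall>\<phi> :: 'a \<Rightarrow>\<^sub>L real. ((\<lambda>n. \<phi> (orb n r)) \<longlongrightarrow> \<phi> y) ufilter)"

text \<open>The weak limit of the difference quotients along the orbits. It is chosen at each
  \<open>r\<close> separately; only its bound, its membership in the graph and its pairing with
  \<open>dual_domain\<close> are used.\<close>

definition weak_der :: "real \<Rightarrow> 'a" where
  "weak_der r = (SOME y. \<forall>\<phi> :: 'a \<Rightarrow>\<^sub>L real. ((\<lambda>n. \<phi> (dq (mesh n) (orb n r))) \<longlongrightarrow> \<phi> y) ufilter)"

lemma weak_sol:
  fixes \<phi> :: "'a \<Rightarrow>\<^sub>L real"
  assumes r: "r \<ge> 0"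
  shows "((\<lambda>n. \<phi> (orb n r)) \<longlongrightarrow> \<phi> (weak_sol r)) ufilter"
  using someI_ex[OF weak_limit_exists[OF refl ufilter(1), where x = "\<lambda>n. orb n r", OF orb_bound[OF r order_refl]]]
  unfolding weak_sol_def by blast

lemma weak_der:
  fixes \<phi> :: "'a \<Rightarrow>\<^sub>L real"
  assumes r: "r \<ge> 0"
  shows "((\<lambda>n. \<phi> (dq (mesh n) (orb n r))) \<longlongrightarrow> \<phi> (weak_der r)) ufilter"
  using someI_ex[OF weak_limit_exists[OF refl ufilter(1), where x = "\<lambda>n. dq (mesh n) (orb n r)", OF dq_orb_bound[OF r order_refl]]]
  unfolding weak_der_def by blast

lemma weak_sol_0: "weak_sol 0 = f"
proof (rule functional_eqI)
  fix \<phi> :: "'a \<Rightarrow>\<^sub>L real"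
  have "orb n 0 = f" for n
    by (simp add: orb_def count_def)
  with weak_sol[of 0 \<phi>] have "((\<lambda>n. \<phi> f) \<longlongrightarrow> \<phi> (weak_sol 0)) ufilter"
    by simp
  then show "\<phi> (weak_sol 0) = \<phi> f"
    by (rule tendsto_unique[OF ufilter_bot _ tendsto_const])
qed

lemma weak_der_bound:
  assumes "0 \<le> r" "r \<le> S"
  shows "norm (weak_der r) \<le> bnd S * dqb"
  by (rule weak_limit_norm_le[OF weak_der[OF assms(1)] ufilter_bot])
    (use dq_orb_bound[OF assms] in auto)

text \<open>Rounding makes the elapsed time exceed \<open>r - q\<close> by at most one step. The
  discrete Lipschitz bound thus has an error that vanishes in the limit, and the norm is weakly
  lower semicontinuous.\<close>

lemma weak_sol_lipschitz_le:
  assumes "0 \<le> q" "q \<le> r" "r \<le> S"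
  shows "norm (weak_sol r - weak_sol q) \<le> bnd S * bnd S * dqb * (r - q)"
proof (rule field_le_epsilon)
  fix e :: real assume e: "e > 0"
  define C where "C = bnd S * bnd S * dqb"
  have S0: "0 \<le> S" using assms by simp
  have "0 \<le> dqb" using dqb[of 0] norm_ge_zero order_trans by blast
  then have C: "C \<ge> 0"
    using bnd_ge_1[OF S0] by (simp add: C_def)
  have "(\<lambda>n. C * (r - q + mesh n)) \<longlonglongrightarrow> C * (r - q + 0)"
    by (intro tendsto_intros mesh_tendsto)
  then have "\<forall>\<^sub>F n in sequentially. C * (r - q + mesh n) < C * (r - q) + e"
    using e by (intro order_tendstoD) auto
  then have "\<forall>\<^sub>F n in sequentially. norm (orb n r - orb n q) \<le> C * (r - q) + e"
    using eventually_ge_at_top[of 1]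
  proof eventually_elim
    case (elim n)
    define l where "l = count n r - count n q"
    have cr: "count n r = count n q + l"
      using count_mono[OF assms(2), of n] by (simp add: l_def)
    have "mesh n * real (count n q + l) \<le> S"
      using mesh_count_le[of r n] assms unfolding cr by linarith
    then have "norm (orb n r - orb n q) \<le> bnd S * (mesh n * real l * (bnd S * norm (dq (mesh n) f)))"
      unfolding orb_def cr by (rule norm_iter_shift_diff_le[OF mesh_pos[OF elim(2)]])
    also have "\<dots> \<le> bnd S * (mesh n * real l * (bnd S * dqb))"
      using bnd_ge_1[OF S0] mesh_nonneg[of n] by (intro mult_left_mono dqb) auto
    also have "\<dots> = C * (mesh n * real l)"
      by (simp add: C_def algebra_simps)
    also have "mesh n * real l \<le> r - q + mesh n"
      using mesh_count_le[of r n] mesh_count_ge[of q n] assms elim(2)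
      by (simp add: cr algebra_simps)
    then have "C * (mesh n * real l) \<le> C * (r - q + mesh n)"
      using C by (rule mult_left_mono)
    finally show ?case using elim(1) by simp
  qed
  then have ev: "\<forall>\<^sub>F n in ufilter. norm (orb n r - orb n q) \<le> C * (r - q) + e"
    by (rule eventually_ufilter)
  have "((\<lambda>n. \<phi> (orb n r - orb n q)) \<longlongrightarrow> \<phi> (weak_sol r - weak_sol q)) ufilter" for \<phi> :: "'a \<Rightarrow>\<^sub>L real"
    unfolding blinfun.diff_right using assms by (intro tendsto_intros weak_sol) auto
  from weak_limit_norm_le[OF this ufilter_bot ev]
  show "norm (weak_sol r - weak_sol q) \<le> C * (r - q) + e" .
qed

lemma weak_sol_lipschitz:
  assumes "0 \<le> q" "0 \<le> r" "q \<le> S" "r \<le> S"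
  shows "norm (weak_sol r - weak_sol q) \<le> bnd S * bnd S * dqb * \<bar>r - q\<bar>"
  using weak_sol_lipschitz_le[of q r S] weak_sol_lipschitz_le[of r q S] assms
  by (cases "q \<le> r") (auto simp: norm_minus_commute)

lemma weak_sol_continuous: "continuous_on {0..} weak_sol"
proof (rule continuous_onI)
  fix r e :: real assume r: "r \<in> {0..}" and e: "e > 0"
  define L where "L = bnd (r + 1) * bnd (r + 1) * dqb + 1"
  have "0 \<le> dqb" using dqb[of 0] norm_ge_zero order_trans by blast
  then have L: "L > 0"
    using bnd_ge_1[of "r + 1"] r by (simp add: L_def add_nonneg_pos)
  have "dist (weak_sol q) (weak_sol r) \<le> e" if q: "q \<in> {0..}" "dist q r < min 1 (e / L)" for q
  proof -
    have "norm (weak_sol q - weak_sol r) \<le> bnd (r + 1) * bnd (r + 1) * dqb * \<bar>q - r\<bar>"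
      using q r by (intro weak_sol_lipschitz) (auto simp: dist_real_def)
    also have "\<dots> \<le> L * \<bar>q - r\<bar>"
      by (simp add: L_def algebra_simps)
    also have "\<dots> \<le> L * (e / L)"
      using q L by (intro mult_left_mono) (auto simp: dist_real_def)
    finally show ?thesis using L by (simp add: dist_norm)
  qed
  then show "\<exists>d>0. \<forall>q\<in>{0..}. dist q r < d \<longrightarrow> dist (weak_sol q) (weak_sol r) \<le> e"
    using L e by (intro exI[of _ "min 1 (e / L)"]) auto
qed

text \<open>After the difference quotient is moved to the functional, a norm convergent sequence of
  functionals is applied to a bounded, weakly convergent sequence of points.\<close>

lemma dual_weak_der:
  assumes \<psi>: "((\<lambda>h. dual_dq h \<psi>) \<longlongrightarrow> \<psi>') (at_right 0)" and r: "r \<ge> 0"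
  shows "\<psi> (weak_der r) = \<psi>' (weak_sol r)"
proof (rule tendsto_unique[OF ufilter_bot weak_der[OF r]])
  have "(\<lambda>n. dual_dq (mesh n) \<psi>) \<longlonglongrightarrow> \<psi>'"
    by (rule filterlim_compose[OF \<psi> mesh_at_right])
  then have lim: "(\<lambda>n. norm (dual_dq (mesh n) \<psi> - \<psi>') * (bnd r * norm f)) \<longlonglongrightarrow> 0"
    by (intro tendsto_mult_left_zero tendsto_norm_zero LIM_zero)
  have bound: "norm (blinfun_apply (dual_dq (mesh n) \<psi> - \<psi>') (orb n r))
      \<le> norm (dual_dq (mesh n) \<psi> - \<psi>') * (bnd r * norm f)" for n
    by (rule order_trans[OF norm_blinfun mult_left_mono[OF orb_bound]]) (use r in auto)
  have "(\<lambda>n. blinfun_apply (dual_dq (mesh n) \<psi> - \<psi>') (orb n r)) \<longlonglongrightarrow> 0"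
    by (rule Lim_null_comparison[OF always_eventually[OF allI[OF bound]] lim])
  from tendsto_add[OF tendsto_ufilter[OF this] weak_sol[OF r, of \<psi>']]
  show "((\<lambda>n. \<psi> (dq (mesh n) (orb n r))) \<longlongrightarrow> \<psi>' (weak_sol r)) ufilter"
    by (simp add: blinfun.diff_left dual_dq_apply)
qed

text \<open>The points supplied by (iv) have the same weak limit as the orbit, and their bounded
  images under \<open>Z\<close> have a weak limit \<open>y\<close>; closed subspaces being weakly
  closed, \<open>(weak_sol r, y)\<close> lies in \<open>Gb\<close>. Each \<open>\<psi>\<close> in
  the dense \<open>dual_domain\<close> takes the value \<open>\<psi>' (weak_sol r)\<close> both at
  \<open>y\<close> and at \<open>weak_der r\<close>, so these agree.\<close>

lemma weak_graph:
  assumes r: "r \<ge> 0"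
  shows "(weak_sol r, weak_der r) \<in> Gb"
proof -
  obtain g where g: "\<And>n. n \<ge> 1 \<Longrightarrow> g n \<in> D"
    "(\<lambda>n. norm (orb n r - g n)) \<longlonglongrightarrow> 0" "bounded ((\<lambda>n. Z (g n)) ` {1..})"
    using orbit[of "r / t"] r t unfolding orb_def mesh_def count_def by auto
  obtain B where B: "\<And>n. n \<ge> 1 \<Longrightarrow> norm (Z (g n)) \<le> B"
    using g(3) by (auto simp: bounded_iff)
  \<comment> \<open>Nothing is known about \<open>g 0\<close>, but the existence of weak limits asks
    for a bound at every index; the value at 0 is irrelevant to the filter.\<close>
  define z where "z n = (if n = 0 then 0 else Z (g n))" for n
  have "norm (z n) \<le> \<bar>B\<bar>" for n
    using B[of n] by (auto simp: z_def)
  then obtain y where y: "\<And>\<phi> :: 'a \<Rightarrow>\<^sub>L real. ((\<lambda>n. \<phi> (z n)) \<longlongrightarrow> \<phi> y) ufilter"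
    using weak_limit_exists[OF refl ufilter(1)] by blast
  have ge1: "\<forall>\<^sub>F n in ufilter. n \<ge> 1"
    by (rule eventually_ufilter[OF eventually_ge_at_top])
  have g_lim: "((\<lambda>n. \<phi> (g n)) \<longlongrightarrow> \<phi> (weak_sol r)) ufilter" for \<phi> :: "'a \<Rightarrow>\<^sub>L real"
  proof -
    have "(\<lambda>n. orb n r - g n) \<longlonglongrightarrow> 0"
      using g(2) by (rule tendsto_norm_zero_cancel)
    from blinfun.tendsto[OF tendsto_const[of \<phi>] this] have "(\<lambda>n. \<phi> (orb n r - g n)) \<longlonglongrightarrow> 0"
      by simp
    from tendsto_diff[OF weak_sol[OF r, of \<phi>] tendsto_ufilter[OF this]] show ?thesis
      by (simp add: blinfun.diff_right)
  qed
  have "(weak_sol r, y) \<in> Gb"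
  proof (rule hahn_banach_closed_relation[OF subspace_Gb closed_Gb])
    fix \<phi> \<psi> :: "'a \<Rightarrow>\<^sub>L real"
    assume ann: "\<forall>(x, y)\<in>Gb. \<phi> x + \<psi> y = 0"
    have "\<forall>\<^sub>F n in ufilter. \<phi> (g n) + \<psi> (z n) = 0"
      using ge1 by eventually_elim (use ann g(1) graph_Gb in \<open>force simp: z_def\<close>)
    then have "((\<lambda>n. \<phi> (g n) + \<psi> (z n)) \<longlongrightarrow> 0) ufilter"
      by (rule tendsto_eventually)
    then show "\<phi> (weak_sol r) + \<psi> y = 0"
      using tendsto_unique[OF ufilter_bot tendsto_add[OF g_lim y]] by blast
  qed
  moreover have "\<psi> y = \<psi> (weak_der r)" if \<psi>: "\<psi> \<in> dual_domain" for \<psi>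
  proof -
    obtain \<psi>' where \<psi>': "((\<lambda>h. dual_dq h \<psi>) \<longlongrightarrow> \<psi>') (at_right 0)"
      using \<psi> by (auto simp: dual_domain_def)
    have "\<forall>\<^sub>F n in ufilter. \<psi>' (g n) = \<psi> (z n)"
      using ge1 by eventually_elim (use dual_derivative_on_D[OF \<psi>'] g(1) in \<open>auto simp: z_def\<close>)
    then have "((\<lambda>n. \<psi> (z n)) \<longlongrightarrow> \<psi>' (weak_sol r)) ufilter"
      by (rule Lim_transform_eventually[OF g_lim])
    then show ?thesis
      using tendsto_unique[OF ufilter_bot y] dual_weak_der[OF \<psi>' r] by metis
  qed
  have "\<phi> y = \<phi> (weak_der r)" for \<phi> :: "'a \<Rightarrow>\<^sub>L real"
  proof -
    have "\<phi> \<in> closure dual_domain" using dual_dense by simp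
    then obtain \<psi> where \<psi>: "\<And>n. \<psi> n \<in> dual_domain" "\<psi> \<longlonglongrightarrow> \<phi>"
      by (auto simp: closure_sequential)
    have "(\<lambda>n. \<psi> n y) \<longlonglongrightarrow> \<phi> y" "(\<lambda>n. \<psi> n (weak_der r)) \<longlonglongrightarrow> \<phi> (weak_der r)"
      by (intro blinfun.tendsto \<psi> tendsto_const)+
    moreover have "\<psi> n y = \<psi> n (weak_der r)" for n
      using \<open>\<And>\<psi>. \<psi> \<in> dual_domain \<Longrightarrow> \<psi> y = \<psi> (weak_der r)\<close> \<psi>(1) by blast
    ultimately show ?thesis
      using LIMSEQ_unique by simp
  qed
  then have "y = weak_der r" by (rule functional_eqI)
  ultimately show ?thesis by simp
qed

text \<open>The discrete expansion passes to the weak limit and leaves a remainder quadratic in the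
  elapsed time, which is differentiability. Only functionals from \<open>dual_domain\<close> admit
  this argument.\<close>

lemma dual_weak_sol_derivative:
  assumes \<psi>: "\<psi> \<in> dual_domain" and r: "r \<ge> 0"
  shows "((\<lambda>r. \<psi> (weak_sol r)) has_vector_derivative \<psi> (weak_der r)) (at r within {0..})"
proof -
  obtain \<psi>' where \<psi>': "((\<lambda>h. dual_dq h \<psi>) \<longlongrightarrow> \<psi>') (at_right 0)"
    using \<psi> by (auto simp: dual_domain_def)
  define S where "S = r + 1"
  define L where "L = bnd S * bnd S * dqb"
  have S0: "0 \<le> S" using r by (simp add: S_def)
  have quad: "\<bar>\<psi> (weak_sol p) - \<psi> (weak_sol q) - (p - q) * \<psi>' (weak_sol q)\<bar> \<le> norm \<psi>' * L * (p - q)\<^sup>2"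
    if "0 \<le> q" "q \<le> p" "p \<le> S" for p q
  proof -
    define l where "l n = count n p - count n q" for n
    have cp: "count n p = count n q + l n" for n
      using count_mono[OF that(2), of n] by (simp add: l_def)
    have hl: "(\<lambda>n. mesh n * real (l n)) \<longlonglongrightarrow> p - q"
      using tendsto_diff[OF mesh_count_tendsto[of p] mesh_count_tendsto[of q]] that
      by (simp add: cp algebra_simps)
    have "((\<lambda>n. \<bar>\<psi> (orb n p) - \<psi> (orb n q) - mesh n * real (l n) * \<psi>' (orb n q)\<bar>)
        \<longlongrightarrow> \<bar>\<psi> (weak_sol p) - \<psi> (weak_sol q) - (p - q) * \<psi>' (weak_sol q)\<bar>) ufilter"
      using that by (intro tendsto_intros weak_sol tendsto_ufilter[OF hl]) auto
    moreover have "(\<lambda>n. dual_dq (mesh n) \<psi>) \<longlonglongrightarrow> \<psi>'"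
      by (rule filterlim_compose[OF \<psi>' mesh_at_right])
    then have "(\<lambda>n. norm (dual_dq (mesh n) \<psi> - \<psi>')) \<longlonglongrightarrow> 0"
      by (intro tendsto_norm_zero LIM_zero)
    then have "(\<lambda>n. mesh n * real (l n) * (norm (dual_dq (mesh n) \<psi> - \<psi>') * (bnd S * norm f)
        + norm \<psi>' * (bnd S * (mesh n * real (l n) * (bnd S * dqb)))))
        \<longlonglongrightarrow> (p - q) * (0 * (bnd S * norm f) + norm \<psi>' * (bnd S * ((p - q) * (bnd S * dqb))))"
      by (intro tendsto_intros hl)
    then have "((\<lambda>n. mesh n * real (l n) * (norm (dual_dq (mesh n) \<psi> - \<psi>') * (bnd S * norm f)
        + norm \<psi>' * (bnd S * (mesh n * real (l n) * (bnd S * dqb)))))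
        \<longlongrightarrow> norm \<psi>' * L * (p - q)\<^sup>2) ufilter"
      by (intro tendsto_ufilter) (simp add: L_def power2_eq_square mult_ac)
    moreover have "\<forall>\<^sub>F n in ufilter. \<bar>\<psi> (orb n p) - \<psi> (orb n q) - mesh n * real (l n) * \<psi>' (orb n q)\<bar>
        \<le> mesh n * real (l n) * (norm (dual_dq (mesh n) \<psi> - \<psi>') * (bnd S * norm f)
        + norm \<psi>' * (bnd S * (mesh n * real (l n) * (bnd S * dqb))))"
    proof (rule eventually_ufilter[OF eventually_mono[OF eventually_ge_at_top[of 1]]])
      fix n :: nat assume n: "1 \<le> n"
      have "mesh n * real (count n q + l n) \<le> S"
        using mesh_count_le[of p n] that unfolding cp by linarith
      from functional_expansion[OF mesh_pos[OF n] this, of \<psi> f \<psi>']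
      have "\<bar>\<psi> (orb n p) - \<psi> (orb n q) - mesh n * real (l n) * \<psi>' (orb n q)\<bar>
        \<le> mesh n * real (l n) * (norm (dual_dq (mesh n) \<psi> - \<psi>') * (bnd S * norm f)
        + norm \<psi>' * (bnd S * (mesh n * real (l n) * (bnd S * norm (dq (mesh n) f)))))"
        unfolding orb_def cp .
      also have "\<dots> \<le> mesh n * real (l n) * (norm (dual_dq (mesh n) \<psi> - \<psi>') * (bnd S * norm f)
        + norm \<psi>' * (bnd S * (mesh n * real (l n) * (bnd S * dqb))))"
        using bnd_ge_1[OF S0] mesh_nonneg[of n] by (intro mult_left_mono add_left_mono dqb) auto
      finally show "\<bar>\<psi> (orb n p) - \<psi> (orb n q) - mesh n * real (l n) * \<psi>' (orb n q)\<bar>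
        \<le> mesh n * real (l n) * (norm (dual_dq (mesh n) \<psi> - \<psi>') * (bnd S * norm f)
        + norm \<psi>' * (bnd S * (mesh n * real (l n) * (bnd S * dqb))))" .
    qed
    ultimately show ?thesis
      by (intro tendsto_le[OF ufilter_bot])
  qed
  have "((\<lambda>r. \<psi> (weak_sol r)) has_vector_derivative \<psi>' (weak_sol r)) (at r within {0..})"
  proof (rule has_vector_derivative_quadratic)
    fix p assume p: "p \<in> {0..}" "\<bar>p - r\<bar> \<le> 1"
    show "norm (\<psi> (weak_sol p) - \<psi> (weak_sol r) - (p - r) *\<^sub>R \<psi>' (weak_sol r)) \<le> 2 * (norm \<psi>' * L) * (p - r)\<^sup>2"
    proof (cases "r \<le> p")
      case True
      have "0 \<le> norm \<psi>' * L * (p - r)\<^sup>2"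
        using order_trans[OF abs_ge_zero quad[of r p]] True p r by (simp add: S_def)
      then show ?thesis
        using quad[of r p] True p r by (simp add: S_def)
    next
      case False
      \<comment> \<open>To the left of \<open>r\<close> the expansion is based at the earlier time
        \<open>p\<close>. Moving the slope from \<open>p\<close> to \<open>r\<close> costs a second
        quadratic term, by the Lipschitz bound: hence the factor 2.\<close>
      have "\<bar>\<psi> (weak_sol r) - \<psi> (weak_sol p) - (r - p) * \<psi>' (weak_sol p)\<bar> \<le> norm \<psi>' * L * (r - p)\<^sup>2"
        using False p by (intro quad) (auto simp: S_def)
      moreover have "\<bar>(r - p) * \<psi>' (weak_sol p - weak_sol r)\<bar> \<le> norm \<psi>' * L * (r - p)\<^sup>2"
      proof -
        have "\<bar>\<psi>' (weak_sol p - weak_sol r)\<bar> \<le> norm \<psi>' * norm (weak_sol p - weak_sol r)"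
          using norm_blinfun[of \<psi>' "weak_sol p - weak_sol r"] by simp
        also have "\<dots> \<le> norm \<psi>' * (L * \<bar>p - r\<bar>)"
          unfolding L_def using False p r by (intro mult_left_mono weak_sol_lipschitz) (auto simp: S_def)
        finally have "\<bar>r - p\<bar> * \<bar>\<psi>' (weak_sol p - weak_sol r)\<bar> \<le> \<bar>r - p\<bar> * (norm \<psi>' * (L * \<bar>p - r\<bar>))"
          by (rule mult_left_mono) simp
        moreover have "\<bar>p - r\<bar> = r - p" "\<bar>r - p\<bar> = r - p" using False by simp_all
        ultimately show ?thesis
          by (simp only: abs_mult power2_eq_square mult_ac)
      qed
      moreover have "\<psi> (weak_sol p) - \<psi> (weak_sol r) - (p - r) * \<psi>' (weak_sol r)
        = - (\<psi> (weak_sol r) - \<psi> (weak_sol p) - (r - p) * \<psi>' (weak_sol p)) - (r - p) * \<psi>' (weak_sol p - weak_sol r)"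
        by (simp add: blinfun.diff_right algebra_simps)
      ultimately show ?thesis
        by (simp add: power2_commute[of r p])
    qed
  qed
  then show ?thesis
    using dual_weak_der[OF \<psi>' r] by simp
qed

section \<open>Moving averages as classical solutions\<close>

definition prim :: "real \<Rightarrow> 'a" where "prim r = integral {0..r} weak_sol"

definition avg :: "real \<Rightarrow> real \<Rightarrow> 'a" where
  "avg \<delta> r = (1 / \<delta>) *\<^sub>R (prim (r + \<delta>) - prim r)"

definition avg_der :: "real \<Rightarrow> real \<Rightarrow> 'a" where
  "avg_der \<delta> r = (1 / \<delta>) *\<^sub>R (weak_sol (r + \<delta>) - weak_sol r)"

lemma prim_derivative:
  assumes r: "r \<ge> 0"
  shows "(prim has_vector_derivative weak_sol r) (at r within {0..})"
proof -
  have "(prim has_vector_derivative weak_sol r) (at r within {0..r + 1})"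
    unfolding prim_def using r
    by (intro integral_has_vector_derivative continuous_on_subset[OF weak_sol_continuous]) auto
  moreover have "at r within {0..r + 1} = at r within {0..}"
    using r by (intro at_within_nhd[of r "{..<r + 1}"]) auto
  ultimately show ?thesis by simp
qed

lemma avg_derivative:
  assumes "\<delta> > 0" "r \<ge> 0"
  shows "(avg \<delta> has_vector_derivative avg_der \<delta> r) (at r within {0..})"
proof -
  have "(prim has_vector_derivative weak_sol (r + \<delta>)) (at (r + \<delta>) within (\<lambda>r. r + \<delta>) ` {0..})"
    using assms by (intro has_vector_derivative_within_subset[OF prim_derivative]) auto
  moreover have "((\<lambda>r. r + \<delta>) has_vector_derivative 1) (at r within {0..})"
    by (auto intro!: derivative_eq_intros simp: has_real_derivative_iff_has_vector_derivative[symmetric])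
  ultimately have "((prim \<circ> (\<lambda>r. r + \<delta>)) has_vector_derivative 1 *\<^sub>R weak_sol (r + \<delta>)) (at r within {0..})"
    by (intro vector_diff_chain_within)
  then have "((\<lambda>r. prim (r + \<delta>)) has_vector_derivative weak_sol (r + \<delta>)) (at r within {0..})"
    by (simp add: o_def)
  from bounded_linear.has_vector_derivative[OF bounded_linear_scaleR_right
      has_vector_derivative_diff[OF this prim_derivative[OF assms(2)]], of "1 / \<delta>"]
  show ?thesis
    unfolding avg_def[abs_def] avg_der_def .
qed

text \<open>The composition of \<open>\<theta>\<close> with \<open>weak_sol\<close> is not known to
  be differentiable, so \<open>\<theta>\<close> is replaced by some \<open>\<psi>\<close> from
  \<open>dual_domain\<close>. Since \<open>(\<phi>, \<theta>)\<close> annihilates the graph, the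
  derivative of \<open>\<phi> (prim q) + \<psi> (weak_sol q)\<close> is
  \<open>(\<psi> - \<theta>) (weak_der q)\<close>, uniformly small as \<open>\<psi>\<close> tends to
  \<open>\<theta>\<close>. The mean value inequality thus stands in for integrating
  \<open>weak_der\<close>.\<close>

lemma avg_graph:
  assumes \<delta>: "\<delta> > 0" and r: "r \<ge> 0"
  shows "(avg \<delta> r, avg_der \<delta> r) \<in> Gb"
proof (rule hahn_banach_closed_relation[OF subspace_Gb closed_Gb])
  fix \<phi> \<theta> :: "'a \<Rightarrow>\<^sub>L real"
  assume ann: "\<forall>(x, y)\<in>Gb. \<phi> x + \<theta> y = 0"
  define S where "S = r + \<delta>"
  define L where "L = bnd S * dqb"
  have bound: "\<bar>\<phi> (prim S - prim r) + \<psi> (weak_sol S - weak_sol r)\<bar> \<le> norm (\<psi> - \<theta>) * (3 * L * \<delta>)"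
    if \<psi>: "\<psi> \<in> dual_domain" for \<psi>
  proof -
    have triangle: "norm X \<le> a + b" if "norm (X - Y) \<le> b" "norm Y \<le> a" for X Y a b :: real
      using norm_triangle_sub[of X Y] that by linarith
    let ?d = "\<lambda>q. blinfun_apply (\<psi> - \<theta>) (weak_der q)"
    have d: "norm (?d q) \<le> norm (\<psi> - \<theta>) * L" if "q \<in> {r..S}" for q
      unfolding L_def using that r
      by (intro order_trans[OF norm_blinfun mult_left_mono[OF weak_der_bound]]) auto
    have der: "((\<lambda>q. \<phi> (prim q) + \<psi> (weak_sol q)) has_vector_derivative ?d q) (at q within {r..S})"
      if q: "q \<in> {r..S}" for q
    proof -
      have q0: "q \<ge> 0" using q r by simp
      have "((\<lambda>q. \<phi> (prim q) + \<psi> (weak_sol q)) has_vector_derivative \<phi> (weak_sol q) + \<psi> (weak_der q))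
          (at q within {0..})"
        by (intro has_vector_derivative_add dual_weak_sol_derivative[OF \<psi> q0]
            bounded_linear.has_vector_derivative[OF blinfun.bounded_linear_right prim_derivative[OF q0]])
      moreover have "\<phi> (weak_sol q) + \<psi> (weak_der q) = ?d q"
        using ann weak_graph[OF q0] by (auto simp: blinfun.diff_left)
      ultimately have "((\<lambda>q. \<phi> (prim q) + \<psi> (weak_sol q)) has_vector_derivative ?d q) (at q within {0..})"
        by (simp only:)
      then show ?thesis
        by (rule has_vector_derivative_within_subset) (use r in auto)
    qed
    \<comment> \<open>Linearisation at \<open>r\<close> costs twice the bound on the derivative, and
      the linear term costs it once more: hence the factor 3.\<close>
    have "norm (\<phi> (prim S) + \<psi> (weak_sol S) - (\<phi> (prim r) + \<psi> (weak_sol r)) - (S - r) *\<^sub>R ?d r)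
        \<le> norm (S - r) * (2 * (norm (\<psi> - \<theta>) * L))"
    proof (rule vector_differentiable_bound_linearization[where S = "{r..S}" and f' = ?d
            and f = "\<lambda>q. \<phi> (prim q) + \<psi> (weak_sol q)" and ?x0.0 = r])
      fix q assume q: "q \<in> {r..S}"
      then have "r \<in> {r..S}" by simp
      then show "norm (?d q - ?d r) \<le> 2 * (norm (\<psi> - \<theta>) * L)"
        using norm_triangle_ineq4[of "?d q" "?d r"] d[OF q] d[of r] by linarith
    qed (use der \<delta> in \<open>auto simp: closed_segment_eq_real_ivl S_def\<close>)
    moreover have "norm ((S - r) *\<^sub>R ?d r) \<le> norm (S - r) * (norm (\<psi> - \<theta>) * L)"
      unfolding norm_scaleR real_norm_def[of "S - r"]
      using \<delta> d[of r] by (intro mult_left_mono) (auto simp: S_def)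
    moreover have "norm (S - r) = \<delta>" using \<delta> by (simp add: S_def)
    ultimately have "norm (\<phi> (prim S) + \<psi> (weak_sol S) - (\<phi> (prim r) + \<psi> (weak_sol r)))
        \<le> \<delta> * (norm (\<psi> - \<theta>) * L) + \<delta> * (2 * (norm (\<psi> - \<theta>) * L))"
      unfolding \<open>norm (S - r) = \<delta>\<close> by (intro triangle)
    also have "\<dots> = norm (\<psi> - \<theta>) * (3 * L * \<delta>)"
      by (simp add: algebra_simps)
    also have "\<phi> (prim S) + \<psi> (weak_sol S) - (\<phi> (prim r) + \<psi> (weak_sol r))
        = \<phi> (prim S - prim r) + \<psi> (weak_sol S - weak_sol r)"
      by (simp add: blinfun.diff_right)
    finally show ?thesis by simp
  qed
  have "\<theta> \<in> closure dual_domain" using dual_dense by simp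
  then obtain \<psi> where \<psi>: "\<And>n. \<psi> n \<in> dual_domain" "\<psi> \<longlonglongrightarrow> \<theta>"
    by (auto simp: closure_sequential)
  have "(\<lambda>n. \<bar>\<phi> (prim S - prim r) + \<psi> n (weak_sol S - weak_sol r)\<bar>)
      \<longlonglongrightarrow> \<bar>\<phi> (prim S - prim r) + \<theta> (weak_sol S - weak_sol r)\<bar>"
    by (intro tendsto_intros \<psi>)
  moreover have "(\<lambda>n. norm (\<psi> n - \<theta>) * (3 * L * \<delta>)) \<longlonglongrightarrow> 0"
    using \<psi>(2) by (intro tendsto_mult_left_zero tendsto_norm_zero LIM_zero)
  ultimately have "\<bar>\<phi> (prim S - prim r) + \<theta> (weak_sol S - weak_sol r)\<bar> \<le> 0"
    by (rule LIMSEQ_le) (use bound[OF \<psi>(1)] in blast)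
  then have *: "\<phi> (prim S - prim r) + \<theta> (weak_sol S - weak_sol r) = 0"
    by simp
  have "\<phi> (avg \<delta> r) + \<theta> (avg_der \<delta> r) = (1 / \<delta>) * (\<phi> (prim S - prim r) + \<theta> (weak_sol S - weak_sol r))"
    unfolding avg_def avg_der_def S_def
    by (simp only: blinfun.scaleR_right distrib_left real_scaleR_def)
  with * show "\<phi> (avg \<delta> r) + \<theta> (avg_der \<delta> r) = 0"
    by simp
qed

lemma avg_classical:
  assumes \<delta>: "\<delta> > 0"
  shows "classical_solution (avg \<delta>) (avg_der \<delta>)"
  unfolding classical_solution_def
proof (intro conjI allI impI)
  have "continuous_on {0..} (\<lambda>r. weak_sol (r + \<delta>))"
    using \<delta> by (intro continuous_on_compose2[OF weak_sol_continuous] continuous_intros) auto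
  then show "continuous_on {0..} (avg_der \<delta>)"
    unfolding avg_der_def[abs_def] by (intro continuous_intros weak_sol_continuous)
qed (use \<delta> avg_graph avg_derivative in auto)

text \<open>By the Lipschitz bound and \<open>weak_sol 0 = f\<close>, the average over
  \<open>[0, \<delta>]\<close> stays within \<open>L * \<delta>\<close> of \<open>f\<close>.\<close>

lemma classical_initial_closure: "f \<in> closure classical_initial"
  unfolding closure_approachable
proof (intro allI impI)
  fix e :: real assume e: "e > 0"
  define L where "L = bnd 1 * bnd 1 * dqb + 1"
  have "0 \<le> dqb" using dqb[of 0] norm_ge_zero order_trans by blast
  then have L: "L > 0"
    using bnd_ge_1[of 1] by (simp add: L_def add_nonneg_pos)
  define \<delta> where "\<delta> = min 1 (e / (2 * L))"
  have \<delta>: "0 < \<delta>" "\<delta> \<le> 1" "L * \<delta> \<le> e / 2"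
    using e L by (auto simp: \<delta>_def min_def field_simps)
  have "norm (prim \<delta> - prim 0 - (\<delta> - 0) *\<^sub>R weak_sol 0) \<le> norm (\<delta> - 0) * (L * \<delta>)"
  proof (rule vector_differentiable_bound_linearization[where S = "{0..\<delta>}" and f' = weak_sol
        and f = prim and ?x0.0 = 0])
    fix r assume r: "r \<in> {0..\<delta>}"
    then show "(prim has_vector_derivative weak_sol r) (at r within {0..\<delta>})"
      by (intro has_vector_derivative_within_subset[OF prim_derivative]) auto
    have "norm (weak_sol r - weak_sol 0) \<le> bnd 1 * bnd 1 * dqb * \<bar>r - 0\<bar>"
      using r \<delta> by (intro weak_sol_lipschitz) auto
    also have "\<dots> \<le> L * \<bar>r - 0\<bar>"
      by (intro mult_right_mono) (auto simp: L_def)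
    also have "\<dots> \<le> L * \<delta>"
      using r L by (intro mult_left_mono) auto
    finally show "norm (weak_sol r - weak_sol 0) \<le> L * \<delta>" .
  qed (use \<delta> in \<open>auto simp: closed_segment_eq_real_ivl\<close>)
  then have le: "norm (prim \<delta> - prim 0 - \<delta> *\<^sub>R f) \<le> \<delta> * (L * \<delta>)"
    using \<delta> by (simp add: weak_sol_0)
  have "avg \<delta> 0 - f = (1 / \<delta>) *\<^sub>R (prim \<delta> - prim 0 - \<delta> *\<^sub>R f)"
    using \<delta> by (simp add: avg_def scaleR_diff_right)
  then have "norm (avg \<delta> 0 - f) = norm (prim \<delta> - prim 0 - \<delta> *\<^sub>R f) / \<delta>"
    using \<delta> by simp
  also have "\<dots> \<le> L * \<delta>"
    using le \<delta> by (simp add: pos_divide_le_eq mult.commute)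
  finally have "dist (avg \<delta> 0) f < e"
    using \<delta> e by (simp add: dist_norm)
  moreover have "avg \<delta> 0 \<in> classical_initial"
    using avg_classical[OF \<delta>(1)] by (auto simp: classical_initial_def)
  ultimately show "\<exists>y\<in>classical_initial. dist y f < e" by blast
qed

end

section \<open>Strongly continuous semigroups\<close>

text \<open>By Baire's theorem, if every open set \<open>V m\<close> were dense, a common point
  would have an unbounded sequence of images. A ball that misses some \<open>V m\<close> bounds all
  \<open>A n\<close>.\<close>

lemma uniform_boundedness:
  fixes A :: "nat \<Rightarrow> 'a::banach \<Rightarrow>\<^sub>L 'b::real_normed_vector"
  assumes bdd: "\<And>x. \<exists>B. \<forall>n. norm (A n x) \<le> B"
  shows "\<exists>C. \<forall>n. norm (A n) \<le> C"
proof -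
  define V where "V m = (\<Union>n. {x. norm (A n x) > real m})" for m :: nat
  have open_V: "open (V m)" for m
    unfolding V_def by (intro open_UN ballI open_Collect_less continuous_intros)
  have "\<exists>m. closure (V m) \<noteq> UNIV"
  proof (rule ccontr)
    assume "\<not> ?thesis"
    then have dense: "closure (V m) = UNIV" for m by blast
    have "euclidean closure_of (\<Inter> (range V)) = topspace (euclidean :: 'a topology)"
      by (rule Baire_category)
        (use open_V dense in \<open>auto simp: completely_metrizable_space_euclidean\<close>)
    then have "\<Inter> (range V) \<noteq> {}"
      by (metis closure_of_empty empty_not_UNIV topspace_euclidean)
    then obtain x where x: "\<And>m. x \<in> V m" by blast
    obtain B where B: "\<And>n. norm (A n x) \<le> B" using bdd by blast
    obtain m :: nat where "B \<le> real m" using real_arch_simple by blast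
    with x[of m] B show False
      unfolding V_def by (auto simp: not_le[symmetric] intro: order_trans)
  qed
  then obtain m x where "x \<notin> closure (V m)" by auto
  then obtain e where e: "e > 0" "\<And>y. y \<in> V m \<Longrightarrow> dist y x \<ge> e"
    by (auto simp: closure_approachable not_less)
  have near: "norm (A n y) \<le> real m" if "norm (y - x) < e" for n y
  proof -
    have "y \<notin> V m"
      using e(2)[of y] that by (auto simp: dist_norm)
    then show ?thesis by (auto simp: V_def not_less)
  qed
  have "norm (A n) \<le> 4 * real m / e" for n
  proof (rule norm_blinfun_bound)
    show "0 \<le> 4 * real m / e" using e by simp
    fix z
    show "norm (A n z) \<le> 4 * real m / e * norm z"
    proof (cases "z = 0")
      case False
      define c where "c = e / (2 * norm z)"
      have c: "c > 0" "c * norm z < e" using e False by (auto simp: c_def)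
      have "norm (A n (x + c *\<^sub>R z)) \<le> real m" "norm (A n x) \<le> real m"
        using c e by (auto intro!: near)
      moreover have "c *\<^sub>R A n z = A n (x + c *\<^sub>R z) - A n x"
        by (simp add: blinfun.add_right blinfun.scaleR_right)
      then have "c * norm (A n z) = norm (A n (x + c *\<^sub>R z) - A n x)"
        using c by (metis abs_of_pos norm_scaleR)
      ultimately have "c * norm (A n z) \<le> 2 * real m"
        using norm_triangle_ineq4[of "A n (x + c *\<^sub>R z)" "A n x"] by linarith
      then show ?thesis
        using e False by (simp add: c_def field_simps)
    qed simp
  qed
  then show ?thesis by blast
qed

lemma norm_integral_le:
  fixes f :: "real \<Rightarrow> 'b::banach"
  assumes h: "h \<ge> 0" and f: "continuous_on {0..h} f"
    and C: "\<And>v. 0 \<le> v \<Longrightarrow> v \<le> h \<Longrightarrow> norm (f v) \<le> C"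
  shows "norm (integral {0..h} f) \<le> C * h"
  using integral_bound[OF h f, of C] C by auto

locale strongly_continuous_semigroup =
  fixes T :: "real \<Rightarrow> 'a::banach \<Rightarrow>\<^sub>L 'a"
  assumes T_0: "T 0 = id_blinfun"
    and T_add: "\<And>r s. r \<ge> 0 \<Longrightarrow> s \<ge> 0 \<Longrightarrow> T (r + s) = T r o\<^sub>L T s"
    and T_lim: "\<And>x. ((\<lambda>s. T s x) \<longlongrightarrow> x) (at_right 0)"
begin

lemma T_0_apply [simp]: "T 0 x = x"
  by (simp add: T_0)

lemma T_add_apply: "r \<ge> 0 \<Longrightarrow> s \<ge> 0 \<Longrightarrow> T (r + s) x = T r (T s x)"
  by (simp add: T_add)

text \<open>Otherwise the norms blow up along times tending to 0, while strong convergence bounds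
  each orbit, against uniform boundedness.\<close>

lemma bounded_near_0: "\<exists>\<delta>>0. \<exists>C. \<forall>s\<in>{0..\<delta>}. norm (T s) \<le> C"
proof (rule ccontr)
  assume unbounded: "\<not> ?thesis"
  have "\<exists>s. 0 \<le> s \<and> s \<le> 1 / real (Suc n) \<and> norm (T s) > real n + 1" for n
  proof (rule ccontr)
    assume "\<not> ?thesis"
    then have "\<forall>s\<in>{0..1 / real (Suc n)}. norm (T s) \<le> real n + 1"
      by (auto simp: not_less)
    moreover have "1 / real (Suc n) > 0" by simp
    ultimately show False using unbounded by blast
  qed
  then obtain s where s: "\<And>n. 0 \<le> s n" "\<And>n. s n \<le> 1 / real (Suc n)" "\<And>n. norm (T (s n)) > real n + 1"
    by metis
  \<comment> \<open>The strong limit is taken over positive times; time 0 is excluded because the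
    norm is at most one there.\<close>
  have "s n \<noteq> 0" for n
  proof
    assume "s n = 0"
    then have "norm (T (s n)) \<le> 1"
      by (simp add: T_0 norm_blinfun_id_le)
    with s(3)[of n] show False by simp
  qed
  then have pos: "s n > 0" for n
    using s(1)[of n] by (simp add: order.not_eq_order_implies_strict)
  have lim0: "(\<lambda>n. 1 / real (Suc n)) \<longlonglongrightarrow> 0"
    using LIMSEQ_inverse_real_of_nat by (simp add: inverse_eq_divide)
  have "s \<longlonglongrightarrow> 0"
    by (rule tendsto_sandwich[OF always_eventually always_eventually tendsto_const lim0]) (use s in auto)
  then have lim: "filterlim s (at_right 0) sequentially"
    using pos by (intro tendsto_imp_filterlim_at_right) auto
  have "\<exists>B. \<forall>n. norm (T (s n) x) \<le> B" for x
  proof -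
    have "(\<lambda>n. T (s n) x) \<longlonglongrightarrow> x"
      by (rule filterlim_compose[OF T_lim lim])
    then have "Bseq (\<lambda>n. T (s n) x)"
      by (intro convergent_imp_Bseq convergentI)
    then show ?thesis by (auto simp: Bseq_def)
  qed
  then obtain C where C: "\<And>n. norm (T (s n)) \<le> C"
    using uniform_boundedness[of "\<lambda>n. T (s n)"] by blast
  obtain n :: nat where "C \<le> real n" using real_arch_simple by blast
  with C[of n] s(3)[of n] show False by linarith
qed

lemma growth: "\<exists>M a. M \<ge> 1 \<and> a \<ge> 0 \<and> (\<forall>s\<ge>0. norm (T s) \<le> M * exp (a * s))"
proof -
  obtain \<delta> C0 where \<delta>: "\<delta> > 0" and C0: "\<And>s. s \<in> {0..\<delta>} \<Longrightarrow> norm (T s) \<le> C0"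
    using bounded_near_0 by blast
  define C where "C = max 1 C0"
  have C: "C \<ge> 1" "\<And>s. 0 \<le> s \<Longrightarrow> s \<le> \<delta> \<Longrightarrow> norm (T s) \<le> C"
    using C0 by (force simp: C_def)+
  have pow: "norm (T (real n * \<delta>)) \<le> C ^ n" for n
  proof (induction n)
    case 0
    then show ?case by (simp add: T_0 norm_blinfun_id_le)
  next
    case (Suc n)
    have "T (real (Suc n) * \<delta>) = T \<delta> o\<^sub>L T (real n * \<delta>)"
      using T_add[of \<delta> "real n * \<delta>"] \<delta> by (simp add: algebra_simps)
    then have "norm (T (real (Suc n) * \<delta>)) \<le> norm (T \<delta>) * norm (T (real n * \<delta>))"
      by (simp add: norm_blinfun_compose)
    also have "\<dots> \<le> C * C ^ n"
      using C \<delta> Suc by (intro mult_mono) auto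
    finally show ?case by simp
  qed
  \<comment> \<open>Chosen so that \<open>C ^ n\<close> equals
    \<open>exp (a * (real n * \<delta>))\<close>.\<close>
  define a where "a = ln C / \<delta>"
  have a: "a \<ge> 0" using C \<delta> by (simp add: a_def)
  have "norm (T s) \<le> C * exp (a * s)" if s: "s \<ge> 0" for s
  proof -
    define n where "n = nat \<lfloor>s / \<delta>\<rfloor>"
    have "real n = of_int \<lfloor>s / \<delta>\<rfloor>" using s \<delta> by (simp add: n_def)
    then have "real n \<le> s / \<delta>" "s / \<delta> \<le> real n + 1" by linarith+
    then have n: "real n * \<delta> \<le> s" "s - real n * \<delta> \<le> \<delta>"
      using \<delta> by (simp_all add: field_simps)
    have "T s = T (s - real n * \<delta>) o\<^sub>L T (real n * \<delta>)"
      using T_add[of "s - real n * \<delta>" "real n * \<delta>"] n \<delta> by simp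
    then have "norm (T s) \<le> norm (T (s - real n * \<delta>)) * norm (T (real n * \<delta>))"
      by (simp add: norm_blinfun_compose)
    also have "\<dots> \<le> C * C ^ n"
      using C n pow by (intro mult_mono) auto
    also have "C ^ n = exp (a * (real n * \<delta>))"
      using C \<delta> by (simp add: a_def exp_of_nat_mult mult.commute)
    also have "C * exp (a * (real n * \<delta>)) \<le> C * exp (a * s)"
      using C a n by (intro mult_left_mono) (auto intro: mult_left_mono)
    finally show ?thesis .
  qed
  with C a show ?thesis by blast
qed

lemma bounded_on: "\<exists>C\<ge>1. \<forall>s. 0 \<le> s \<longrightarrow> s \<le> S \<longrightarrow> norm (T s) \<le> C"
proof -
  obtain M a where Ma: "M \<ge> 1" "a \<ge> 0" "\<forall>s\<ge>0. norm (T s) \<le> M * exp (a * s)"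
    using growth by blast
  have "norm (T s) \<le> max 1 (M * exp (a * S))" if "0 \<le> s" "s \<le> S" for s
  proof -
    have "M * exp (a * s) \<le> M * exp (a * S)"
      using Ma that by (intro mult_left_mono) (auto intro: mult_left_mono)
    with Ma(3) that show ?thesis by (meson max.coboundedI2 order_trans)
  qed
  then show ?thesis by (intro exI[of _ "max 1 (M * exp (a * S))"]) auto
qed

lemma orbit_diff:
  assumes "0 \<le> q" "q \<le> r"
  shows "T r x - T q x = T q (T (r - q) x - x)"
  using T_add_apply[of q "r - q" x] assms by (simp add: blinfun.diff_right)

lemma orbit_continuous: "continuous_on {0..} (\<lambda>r. T r x)"
proof (rule continuous_onI)
  fix r e :: real assume r: "r \<in> {0..}" and e: "e > 0"
  obtain C where C: "C \<ge> 1" "\<And>s. 0 \<le> s \<Longrightarrow> s \<le> r + 1 \<Longrightarrow> norm (T s) \<le> C"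
    using bounded_on by blast
  have "\<forall>\<^sub>F s in at_right 0. dist (T s x) x < e / C"
    using e C by (intro tendstoD T_lim) auto
  then obtain b where b: "b > 0" "\<And>s. 0 < s \<Longrightarrow> s < b \<Longrightarrow> dist (T s x) x < e / C"
    by (auto simp: eventually_at_right_field)
  have near: "norm (T q x - T p x) \<le> e" if "0 \<le> p" "p < q" "q - p < b" "q \<le> r + 1" for p q
  proof -
    have "norm (T p (T (q - p) x - x)) \<le> norm (T p) * norm (T (q - p) x - x)"
      by (rule norm_blinfun)
    also have "\<dots> \<le> C * (e / C)"
      using C(2)[of p] b(2)[of "q - p"] that C(1) by (intro mult_mono) (auto simp: dist_norm)
    finally show ?thesis using that C(1) by (simp add: orbit_diff)
  qed
  have "dist (T q x) (T r x) \<le> e" if "q \<in> {0..}" "dist q r < min 1 b" for q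
    using near[of q r] near[of r q] that r e
    by (cases q r rule: linorder_cases) (auto simp: dist_norm dist_real_def norm_minus_commute)
  then show "\<exists>d>0. \<forall>q\<in>{0..}. dist q r < d \<longrightarrow> dist (T q x) (T r x) \<le> e"
    using b(1) by (intro exI[of _ "min 1 b"]) auto
qed

lemma generator_iff: "(x, y) \<in> generator T \<longleftrightarrow> ((\<lambda>h. (1 / h) *\<^sub>R (T h x - x)) \<longlongrightarrow> y) (at_right 0)"
  by (simp add: generator_def strong_derivative0_def)

lemma generator_orbit:
  assumes xy: "(x, y) \<in> generator T" and r: "r \<ge> 0"
  shows "(T r x, T r y) \<in> generator T"
proof -
  have "((\<lambda>h. T r ((1 / h) *\<^sub>R (T h x - x))) \<longlongrightarrow> T r y) (at_right 0)"
    using xy by (intro blinfun.tendsto tendsto_const) (simp add: generator_iff)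
  moreover have "\<forall>\<^sub>F h in at_right 0. T r ((1 / h) *\<^sub>R (T h x - x)) = (1 / h) *\<^sub>R (T h (T r x) - T r x)"
    using eventually_at_right_less
  proof eventually_elim
    case (elim h)
    then have "T r (T h x) = T h (T r x)"
      using r T_add_apply[of r h x] T_add_apply[of h r x] by (simp add: add.commute)
    then show ?case by (simp add: blinfun.scaleR_right blinfun.diff_right)
  qed
  ultimately show ?thesis
    unfolding generator_iff by (rule Lim_transform_eventually)
qed

text \<open>The expansion is always made at the earlier time \<open>min q r\<close>, because
  \<open>T\<close> runs forward only. For \<open>q < r\<close> this leaves \<open>T q y\<close> in
  place of \<open>T r y\<close>, which continuity of the orbit of \<open>y\<close> absorbs.\<close>

lemma orbit_derivative:
  assumes xy: "(x, y) \<in> generator T" and r: "r \<ge> 0"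
  shows "((\<lambda>s. T s x) has_vector_derivative T r y) (at r within {0..})"
  unfolding has_vector_derivative_def has_derivative_within
proof
  show "bounded_linear (\<lambda>h. h *\<^sub>R T r y)" by (rule bounded_linear_scaleR_left)
  obtain C where C: "C \<ge> 1" "\<And>s. 0 \<le> s \<Longrightarrow> s \<le> r + 1 \<Longrightarrow> norm (T s) \<le> C"
    using bounded_on by blast
  define R where "R h = norm ((1 / h) *\<^sub>R (T h x - x) - y)" for h
  have R: "(R \<longlongrightarrow> 0) (at_right 0)"
    unfolding R_def using xy by (intro tendsto_norm_zero LIM_zero) (simp add: generator_iff)
  have expand: "norm (T p (T h x - x - h *\<^sub>R y)) \<le> h * (C * R h)" if "0 \<le> p" "p \<le> r + 1" "h > 0" for p h
  proof -
    have "T h x - x - h *\<^sub>R y = h *\<^sub>R ((1 / h) *\<^sub>R (T h x - x) - y)"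
      using that by (simp add: scaleR_diff_right)
    then have eq: "norm (T h x - x - h *\<^sub>R y) = h * R h"
      using that by (simp add: R_def)
    have "norm (T p (T h x - x - h *\<^sub>R y)) \<le> C * norm (T h x - x - h *\<^sub>R y)"
      using C(2)[of p] that by (intro order_trans[OF norm_blinfun] mult_right_mono) auto
    then show ?thesis by (simp add: eq mult.left_commute)
  qed
  let ?E = "\<lambda>q. (1 / norm (q - r)) *\<^sub>R (T q x - (T r x + (q - r) *\<^sub>R T r y))"
  show "(?E \<longlongrightarrow> 0) (at r within {0..})"
  proof (rule Lim_null_comparison)
    have "((\<lambda>q. T (min q r) y) \<longlongrightarrow> T (min r r) y) (at r within {0..})"
      using r by (intro continuous_on_tendsto_compose[OF orbit_continuous] tendsto_intros)
        (auto simp: eventually_at_filter)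
    then have "((\<lambda>q. norm (T (min q r) y - T r y)) \<longlongrightarrow> 0) (at r within {0..})"
      by (intro tendsto_norm_zero LIM_zero) simp
    moreover have "filterlim (\<lambda>q. \<bar>q - r\<bar>) (at_right 0) (at r within {0..})"
    proof (rule tendsto_imp_filterlim_at_right)
      show "((\<lambda>q. \<bar>q - r\<bar>) \<longlongrightarrow> 0) (at r within {0..})"
        by (intro tendsto_rabs_zero LIM_zero tendsto_ident_at)
    qed (auto simp: eventually_at_filter)
    then have "((\<lambda>q. R \<bar>q - r\<bar>) \<longlongrightarrow> 0) (at r within {0..})"
      by (rule filterlim_compose[OF R])
    then have "((\<lambda>q. C * R \<bar>q - r\<bar>) \<longlongrightarrow> 0) (at r within {0..})"
      by (rule tendsto_mult_right_zero)
    ultimately show "((\<lambda>q. C * R \<bar>q - r\<bar> + norm (T (min q r) y - T r y)) \<longlongrightarrow> 0) (at r within {0..})"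
      by (rule tendsto_add_zero[rotated])
    have "\<forall>\<^sub>F q in at r within {0..}. q \<ge> 0 \<and> q \<noteq> r"
      by (auto simp: eventually_at_filter)
    moreover have "\<forall>\<^sub>F q in at r within {0..}. dist q r < 1"
      by (rule tendstoD[OF tendsto_ident_at]) simp
    ultimately show "\<forall>\<^sub>F q in at r within {0..}. norm (?E q) \<le> C * R \<bar>q - r\<bar> + norm (T (min q r) y - T r y)"
    proof eventually_elim
      case (elim q)
      define h where "h = \<bar>q - r\<bar>"
      have h: "h > 0" using elim by (simp add: h_def)
      have "norm (T q x - (T r x + (q - r) *\<^sub>R T r y)) \<le> h * (C * R h) + h * norm (T (min q r) y - T r y)"
      proof (cases "q > r")
        case True
        then have "T q x - (T r x + (q - r) *\<^sub>R T r y) = T r (T h x - x - h *\<^sub>R y)"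
          using orbit_diff[of r q x] r
          by (simp add: h_def blinfun.diff_right blinfun.add_right blinfun.scaleR_right algebra_simps)
        moreover have "norm (T r (T h x - x - h *\<^sub>R y)) \<le> h * (C * R h)"
          using r h by (intro expand) auto
        ultimately show ?thesis using h True by simp
      next
        case False
        then have q: "q < r" "h = r - q" using elim by (auto simp: h_def)
        have "T q x - (T r x + (q - r) *\<^sub>R T r y)
            = - T q (T h x - x - h *\<^sub>R y) - h *\<^sub>R (T q y - T r y)"
        proof -
          have "T r x = T q x + T q (T h x - x)"
            unfolding q(2) using orbit_diff[of q r x] q(1) elim by (simp add: algebra_simps)
          moreover have "(q - r) *\<^sub>R T r y = - (h *\<^sub>R T r y)"
            using q(2) by (simp flip: scaleR_minus_left)
          ultimately show ?thesis
            by (simp add: blinfun.diff_right blinfun.scaleR_right scaleR_diff_right)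
        qed
        then have "norm (T q x - (T r x + (q - r) *\<^sub>R T r y))
            \<le> norm (T q (T h x - x - h *\<^sub>R y)) + norm (h *\<^sub>R (T q y - T r y))"
          using norm_triangle_ineq4[of "- T q (T h x - x - h *\<^sub>R y)" "h *\<^sub>R (T q y - T r y)"]
          by (simp only: norm_minus_cancel)
        moreover have "norm (T q (T h x - x - h *\<^sub>R y)) \<le> h * (C * R h)"
          using elim q h by (intro expand) auto
        ultimately show ?thesis using h q by simp
      qed
      then have "norm (T q x - (T r x + (q - r) *\<^sub>R T r y)) \<le> h * (C * R h + norm (T (min q r) y - T r y))"
        by (simp only: distrib_left)
      moreover have "norm (?E q) = norm (T q x - (T r x + (q - r) *\<^sub>R T r y)) / h"
        by (simp only: norm_scaleR) (simp add: h_def)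
      ultimately show ?case
        using h unfolding h_def[symmetric] by (simp only: pos_divide_le_eq mult.commute)
    qed
  qed
qed

section \<open>Time integrals of orbits\<close>

lemma orbit_integrable: "0 \<le> a \<Longrightarrow> (\<lambda>v. T v x) integrable_on {a..b}"
  by (intro integrable_continuous_real continuous_on_subset[OF orbit_continuous]) auto

definition orbit_integral :: "real \<Rightarrow> 'a \<Rightarrow>\<^sub>L 'a" where
  "orbit_integral h = Blinfun (\<lambda>x. integral {0..h} (\<lambda>v. T v x))"

lemma orbit_integral_apply: "h \<ge> 0 \<Longrightarrow> orbit_integral h x = integral {0..h} (\<lambda>v. T v x)"
proof -
  assume h: "h \<ge> 0"
  obtain C where C: "C \<ge> 1" "\<And>s. 0 \<le> s \<Longrightarrow> s \<le> h \<Longrightarrow> norm (T s) \<le> C"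
    using bounded_on by blast
  have "bounded_linear (\<lambda>x. integral {0..h} (\<lambda>v. T v x))"
  proof (rule bounded_linear_intro[where K = "C * h"])
    fix x y c
    show "integral {0..h} (\<lambda>v. T v (x + y)) = integral {0..h} (\<lambda>v. T v x) + integral {0..h} (\<lambda>v. T v y)"
      unfolding blinfun.add_right by (intro integral_add orbit_integrable) auto
    show "integral {0..h} (\<lambda>v. T v (c *\<^sub>R x)) = c *\<^sub>R integral {0..h} (\<lambda>v. T v x)"
      unfolding blinfun.scaleR_right by (rule integral_cmul)
    have "norm (integral {0..h} (\<lambda>v. T v x)) \<le> (C * norm x) * h"
    proof (rule norm_integral_le[OF h])
      show "continuous_on {0..h} (\<lambda>v. T v x)"
        by (rule continuous_on_subset[OF orbit_continuous]) auto
      fix v assume "0 \<le> v" "v \<le> h"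
      then show "norm (T v x) \<le> C * norm x"
        using C(2)[of v] by (intro order_trans[OF norm_blinfun] mult_right_mono) auto
    qed
    then show "norm (integral {0..h} (\<lambda>v. T v x)) \<le> norm x * (C * h)"
      by (simp add: mult_ac)
  qed
  then show ?thesis by (simp add: orbit_integral_def bounded_linear_Blinfun_apply)
qed

lemma orbit_integral_bound:
  fixes A :: "'a \<Rightarrow> 'b::banach"
  assumes h: "h \<ge> 0" and B: "\<And>v. 0 \<le> v \<Longrightarrow> v \<le> h \<Longrightarrow> norm (A (T v x) - z) \<le> B"
    and A: "bounded_linear A"
  shows "norm (A (orbit_integral h x) - h *\<^sub>R z) \<le> B * h"
proof -
  have int: "(\<lambda>v. A (T v x)) integrable_on {0..h}"
    using integrable_linear[OF orbit_integrable[of 0 x h] A] by (simp add: o_def)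
  have "A (orbit_integral h x) = integral {0..h} (\<lambda>v. A (T v x))"
    using integral_linear[OF orbit_integrable[of 0 x h] A] h
    by (simp add: orbit_integral_apply o_def)
  then have "A (orbit_integral h x) - h *\<^sub>R z = integral {0..h} (\<lambda>v. A (T v x) - z)"
    using h by (simp add: integral_diff[OF int integrable_const_ivl])
  moreover have "norm (integral {0..h} (\<lambda>v. A (T v x) - z)) \<le> B * h"
  proof (rule norm_integral_le[OF h])
    show "continuous_on {0..h} (\<lambda>v. A (T v x) - z)"
      by (intro continuous_intros bounded_linear.continuous_on[OF A]
          continuous_on_subset[OF orbit_continuous]) auto
  qed (use B in auto)
  ultimately show ?thesis by simp
qed

lemma orbit_integral_linear:
  assumes h: "h \<ge> 0" and A: "bounded_linear A"
    and comm: "\<And>v. 0 \<le> v \<Longrightarrow> A (T v x) = T v (A x)"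
  shows "A (orbit_integral h x) = orbit_integral h (A x)"
proof -
  have "A (orbit_integral h x) = integral {0..h} (\<lambda>v. A (T v x))"
    using integral_linear[OF orbit_integrable[of 0 x h] A] h
    by (simp add: orbit_integral_apply o_def)
  also have "\<dots> = integral {0..h} (\<lambda>v. T v (A x))"
    using comm by (intro integral_cong) auto
  finally show ?thesis using h by (simp add: orbit_integral_apply)
qed

lemma T_commute: "r \<ge> 0 \<Longrightarrow> s \<ge> 0 \<Longrightarrow> T r (T s x) = T s (T r x)"
  using T_add_apply[of r s x] T_add_apply[of s r x] by (simp add: add.commute)

lemma orbit_integral_T_commute:
  "h \<ge> 0 \<Longrightarrow> r \<ge> 0 \<Longrightarrow> T r (orbit_integral h x) = orbit_integral h (T r x)"
  by (intro orbit_integral_linear blinfun.bounded_linear_right T_commute)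

text \<open>Both sides are the integral over \<open>[0, r + h]\<close> minus those over
  \<open>[0, r]\<close> and \<open>[0, h]\<close>. The exchange of \<open>r\<close> and
  \<open>h\<close> makes the left side of order \<open>r\<close>, even in norm.\<close>

lemma orbit_integral_shift:
  assumes h: "h \<ge> 0" and r: "r \<ge> 0"
  shows "T r (orbit_integral h x) - orbit_integral h x = orbit_integral r (T h x - x)"
proof -
  have shift: "orbit_integral c (T d x) = orbit_integral (d + c) x - orbit_integral d x"
    if "c \<ge> 0" "d \<ge> 0" for c d
  proof -
    have "integral {0..c} (\<lambda>v. T v (T d x)) = integral {0..c} ((\<lambda>v. T v x) \<circ> (+) d)"
      using that by (intro integral_cong) (auto simp: T_add_apply[symmetric] add.commute)
    also have "\<dots> = integral {d..d + c} (\<lambda>v. T v x)"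
    proof (rule integral_unique)
      have "((\<lambda>v. T v x) has_integral integral {d..d + c} (\<lambda>v. T v x)) {0 + d..c + d}"
        using integrable_integral[OF orbit_integrable[OF that(2), of x "d + c"]] by (simp add: add.commute)
      then show "((\<lambda>v. T v x) \<circ> (+) d has_integral integral {d..d + c} (\<lambda>v. T v x)) {0..c}"
        by (simp only: has_integral_shift_Icc_real)
    qed
    also have "\<dots> = integral {0..d + c} (\<lambda>v. T v x) - integral {0..d} (\<lambda>v. T v x)"
      using Henstock_Kurzweil_Integration.integral_combine[of 0 d "d + c" "\<lambda>v. T v x"] that orbit_integrable
      by (simp add: algebra_simps)
    finally show ?thesis using that by (simp add: orbit_integral_apply)
  qed
  have "T r (orbit_integral h x) = orbit_integral (r + h) x - orbit_integral r x"
    using shift[OF h r] h r by (simp add: orbit_integral_T_commute)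
  moreover have "orbit_integral r (T h x) = orbit_integral (h + r) x - orbit_integral h x"
    using shift[OF r h] .
  ultimately show ?thesis by (simp add: blinfun.diff_right add.commute)
qed

lemma orbit_integral_mean_tendsto:
  "((\<lambda>h. (1 / h) *\<^sub>R orbit_integral h x) \<longlongrightarrow> x) (at_right 0)"
proof (rule tendstoI)
  fix e :: real assume e: "e > 0"
  have "\<forall>\<^sub>F s in at_right 0. dist (T s x) x < e / 2"
    using e by (intro tendstoD T_lim) auto
  then obtain b where b: "b > 0" "\<And>s. 0 < s \<Longrightarrow> s < b \<Longrightarrow> dist (T s x) x < e / 2"
    by (auto simp: eventually_at_right_field)
  have "\<forall>\<^sub>F h in at_right 0. h < b" using b(1) by (rule eventually_at_right_0_less)
  then show "\<forall>\<^sub>F h in at_right 0. dist ((1 / h) *\<^sub>R orbit_integral h x) x < e"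
    using eventually_at_right_less
  proof eventually_elim
    case (elim h)
    have "norm (orbit_integral h x - h *\<^sub>R x) \<le> e / 2 * h"
    proof (rule orbit_integral_bound[where A = "\<lambda>x. x"])
      fix v assume "0 \<le> v" "v \<le> h"
      then show "norm (T v x - x) \<le> e / 2"
        using b(2)[of v] e elim by (cases "v = 0") (auto simp: dist_norm)
    qed (use elim in auto)
    moreover have "(1 / h) *\<^sub>R orbit_integral h x - x = (1 / h) *\<^sub>R (orbit_integral h x - h *\<^sub>R x)"
      using elim by (simp add: scaleR_diff_right)
    then have "norm ((1 / h) *\<^sub>R orbit_integral h x - x) = norm (orbit_integral h x - h *\<^sub>R x) / h"
      using elim by simp
    ultimately have "norm ((1 / h) *\<^sub>R orbit_integral h x - x) \<le> e / 2"
      using elim by (simp add: pos_divide_le_eq)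
    then show ?case using e by (simp add: dist_norm)
  qed
qed

lemma blinfun_power_semigroup:
  assumes r: "r \<ge> 0"
  shows "blinfun_power (T r) k = T (real k * r)"
proof (rule blinfun_eqI)
  show "blinfun_power (T r) k x = T (real k * r) x" for x
  proof (induction k)
    case (Suc k)
    then show ?case
      using T_add_apply[of r "real k * r" x] r by (simp add: algebra_simps)
  qed simp
qed

lemma norm_orbit_integral_le:
  assumes C: "\<And>v. 0 \<le> v \<Longrightarrow> v \<le> h \<Longrightarrow> norm (T v) \<le> C" and h: "h \<ge> 0"
  shows "norm (orbit_integral h x) \<le> C * norm x * h"
proof -
  have "norm (orbit_integral h x - h *\<^sub>R 0) \<le> (C * norm x) * h"
  proof (rule orbit_integral_bound[where A = "\<lambda>x. x", OF h])
    fix v assume "0 \<le> v" "v \<le> h"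
    then show "norm (T v x - 0) \<le> C * norm x"
      using C[of v] by (simp, intro order_trans[OF norm_blinfun] mult_right_mono) auto
  qed simp
  then show ?thesis by simp
qed

lemma orbit_integral_twice_tendsto:
  "((\<lambda>h. (1 / h\<^sup>2) *\<^sub>R orbit_integral h (orbit_integral h x)) \<longlongrightarrow> x) (at_right 0)"
proof -
  obtain C where C: "C \<ge> 1" "\<And>s. 0 \<le> s \<Longrightarrow> s \<le> 1 \<Longrightarrow> norm (T s) \<le> C"
    using bounded_on by blast
  let ?y = "\<lambda>h. (1 / h) *\<^sub>R orbit_integral h x"
  have "((\<lambda>h. (1 / h) *\<^sub>R orbit_integral h (?y h - x)) \<longlongrightarrow> 0) (at_right 0)"
  proof (rule Lim_null_comparison)
    show "((\<lambda>h. C * norm (?y h - x)) \<longlongrightarrow> 0) (at_right 0)"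
      by (intro tendsto_mult_right_zero tendsto_norm_zero LIM_zero orbit_integral_mean_tendsto)
    have "\<forall>\<^sub>F h in at_right 0. h < (1::real)"
      by (rule eventually_at_right_0_less) simp
    then show "\<forall>\<^sub>F h in at_right 0. norm ((1 / h) *\<^sub>R orbit_integral h (?y h - x)) \<le> C * norm (?y h - x)"
      using eventually_at_right_less
    proof eventually_elim
      case (elim h)
      have "norm (orbit_integral h (?y h - x)) \<le> C * norm (?y h - x) * h"
        using elim C(2) by (intro norm_orbit_integral_le) auto
      moreover have "norm ((1 / h) *\<^sub>R orbit_integral h (?y h - x)) = norm (orbit_integral h (?y h - x)) / h"
        unfolding norm_scaleR using elim by simp
      ultimately show ?case
        using elim by (simp only: pos_divide_le_eq)
    qed
  qed
  from tendsto_add[OF this orbit_integral_mean_tendsto[of x]]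
  have "((\<lambda>h. (1 / h) *\<^sub>R orbit_integral h (?y h - x) + ?y h) \<longlongrightarrow> x) (at_right 0)"
    by simp
  then show ?thesis
    by (simp add: blinfun.diff_right blinfun.scaleR_right scaleR_diff_right power2_eq_square)
qed

text \<open>With a single V_h, the quotient would be \<phi> o (V_r / r) o (T_h - I), which in
  general converges only pointwise as r tends to 0. The second integral repairs this: V_h (T_v - I)
  = V_v (T_h - I) is O(v) in operator norm, so the quotient converges in the norm of the
  dual.\<close>

lemma orbit_integral_adjoint_derivative:
  fixes \<phi> :: "'a \<Rightarrow>\<^sub>L 'b::real_normed_vector"
  assumes h: "h > 0"
  defines "\<psi> \<equiv> \<phi> o\<^sub>L (orbit_integral h o\<^sub>L orbit_integral h)"
  shows "((\<lambda>r. (1 / r) *\<^sub>R ((\<psi> o\<^sub>L T r) - \<psi>)) \<longlongrightarrow> \<phi> o\<^sub>L (orbit_integral h o\<^sub>L (T h - id_blinfun))) (at_right 0)"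
    (is "(?Q \<longlongrightarrow> ?\<eta>) _")
proof -
  obtain C where C: "C \<ge> 1" "\<And>s. 0 \<le> s \<Longrightarrow> s \<le> max 1 h \<Longrightarrow> norm (T s) \<le> C"
    using bounded_on by blast
  let ?V = "orbit_integral h"
  \<comment> \<open>One factor \<open>C + 1\<close> for each of the two differences
    \<open>T h - I\<close> and one \<open>C\<close> for the integral over
    \<open>[0, v]\<close>.\<close>
  define K where "K = norm \<phi> * (C * ((C + 1) * (C + 1)))"
  have Th: "norm (T h z - z) \<le> (C + 1) * norm z" for z
  proof -
    have "norm (T h z) \<le> C * norm z"
      using C(2)[of h] h by (intro order_trans[OF norm_blinfun] mult_right_mono) auto
    then show ?thesis
      using norm_triangle_ineq4[of "T h z" z] by (simp add: distrib_right)
  qed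
  have est: "norm (?Q r - ?\<eta>) \<le> K * r" if r: "0 < r" "r < 1" for r
  proof (rule norm_blinfun_bound)
    show "0 \<le> K * r" using C r by (simp add: K_def)
    fix x
    define z where "z = T h x - x"
    have V: "norm (?V (T v z) - ?V z) \<le> C * ((C + 1) * (C + 1)) * r * norm x" if v: "0 \<le> v" "v \<le> r" for v
    proof -
      have "?V (T v z) - ?V z = orbit_integral v (T h z - z)"
        using orbit_integral_shift[of h v z] orbit_integral_T_commute[of h v z] h v by simp
      moreover have "norm (orbit_integral v (T h z - z)) \<le> C * norm (T h z - z) * v"
        using v r C(2) by (intro norm_orbit_integral_le) auto
      moreover have "C * norm (T h z - z) * v \<le> C * ((C + 1) * ((C + 1) * norm x)) * r"
      proof -
        have "norm (T h z - z) \<le> (C + 1) * ((C + 1) * norm x)"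
          using C(1) Th[of x] by (intro order_trans[OF Th[of z]] mult_left_mono) (auto simp: z_def)
        then show ?thesis
          using C(1) v by (intro mult_mono) auto
      qed
      ultimately show ?thesis by (simp add: mult_ac)
    qed
    have "norm (?V (orbit_integral r z) - r *\<^sub>R ?V z) \<le> (C * ((C + 1) * (C + 1)) * r * norm x) * r"
      using r V by (intro orbit_integral_bound blinfun.bounded_linear_right) auto
    then have "norm \<phi> * norm (?V (orbit_integral r z) - r *\<^sub>R ?V z)
        \<le> norm \<phi> * ((C * ((C + 1) * (C + 1)) * r * norm x) * r)"
      by (rule mult_left_mono) simp
    then have 1: "norm (\<phi> (?V (orbit_integral r z) - r *\<^sub>R ?V z)) \<le> (K * r * norm x) * r"
      using norm_blinfun[of \<phi> "?V (orbit_integral r z) - r *\<^sub>R ?V z"] by (simp add: K_def mult_ac)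
    have "?V (T r x) - ?V x = orbit_integral r z"
      using orbit_integral_shift[of h r x] orbit_integral_T_commute[of h r x] h r by (simp add: z_def)
    then have eq: "\<psi> (T r x) - \<psi> x = \<phi> (?V (orbit_integral r z))"
      by (simp add: \<psi>_def flip: blinfun.diff_right)
    have "blinfun_apply (?Q r - ?\<eta>) x = (1 / r) *\<^sub>R (\<psi> (T r x) - \<psi> x) - \<phi> (?V z)"
      by (simp add: z_def blinfun.diff_left blinfun.scaleR_left)
    also have "\<dots> = (1 / r) *\<^sub>R \<phi> (?V (orbit_integral r z) - r *\<^sub>R ?V z)"
      unfolding eq using r by (simp add: blinfun.diff_right blinfun.scaleR_right scaleR_diff_right)
    finally have "blinfun_apply (?Q r - ?\<eta>) x = (1 / r) *\<^sub>R \<phi> (?V (orbit_integral r z) - r *\<^sub>R ?V z)" .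
    then have "norm (blinfun_apply (?Q r - ?\<eta>) x) = norm (\<phi> (?V (orbit_integral r z) - r *\<^sub>R ?V z)) / r"
      using r by simp
    also have "\<dots> \<le> K * r * norm x"
      using 1 r by (simp add: pos_divide_le_eq)
    finally show "norm (blinfun_apply (?Q r - ?\<eta>) x) \<le> K * r * norm x" .
  qed
  have "((\<lambda>r. ?Q r - ?\<eta>) \<longlongrightarrow> 0) (at_right 0)"
  proof (rule Lim_null_comparison)
    show "((\<lambda>r. K * r) \<longlongrightarrow> 0) (at_right 0)"
      by (intro tendsto_mult_right_zero tendsto_ident_at)
    have "\<forall>\<^sub>F r in at_right 0. r < (1::real)"
      by (rule eventually_at_right_0_less) simp
    then show "\<forall>\<^sub>F r in at_right 0. norm (?Q r - ?\<eta>) \<le> K * r"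
      using eventually_at_right_less by eventually_elim (rule est)
  qed
  then show ?thesis by (rule LIM_zero_cancel)
qed

end

lemma C0_semigroup_strongly_continuous:
  "C0_semigroup smul T \<Longrightarrow> strongly_continuous_semigroup T"
  by unfold_locales (auto simp: C0_semigroup_def)

section \<open>The weak-* topology\<close>

lemma topspace_weak_star [simp]: "topspace (weak_star_topology smul) = dual_space smul"
  by (simp add: weak_star_topology_def topspace_pullback_topology)

text \<open>Pointwise convergence is convergence in the product topology, from which the weak-*
  topology is pulled back.\<close>

lemma weak_star_closure_of_sequence:
  assumes \<psi>: "\<And>n :: nat. \<psi> n \<in> S" and S: "S \<subseteq> dual_space smul" and \<phi>: "\<phi> \<in> dual_space smul"
    and lim: "\<And>x. (\<lambda>n. blinfun_apply (\<psi> n) x) \<longlonglongrightarrow> blinfun_apply \<phi> x"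
  shows "\<phi> \<in> weak_star_topology smul closure_of S"
  unfolding in_closure_of
proof (intro conjI allI impI, simp add: \<phi>)
  fix U assume "\<phi> \<in> U \<and> openin (weak_star_topology smul) U"
  then obtain W where W: "open W" "U = blinfun_apply -` W \<inter> dual_space smul" "blinfun_apply \<phi> \<in> W"
    by (auto simp: weak_star_topology_def openin_pullback_topology)
  have "limitin (product_topology (\<lambda>_. euclidean) UNIV) (\<lambda>n. blinfun_apply (\<psi> n)) (blinfun_apply \<phi>) sequentially"
    using lim by (simp add: limitin_componentwise)
  then have "(\<lambda>n. blinfun_apply (\<psi> n)) \<longlonglongrightarrow> blinfun_apply \<phi>"
    by (simp add: euclidean_product_topology)
  then have "\<forall>\<^sub>F n in sequentially. blinfun_apply (\<psi> n) \<in> W"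
    using W(1,3) by (rule topological_tendstoD)
  then obtain n where "blinfun_apply (\<psi> n) \<in> W"
    using eventually_happens'[OF sequentially_bot] by blast
  then show "\<exists>y. y \<in> S \<and> y \<in> U"
    using W \<psi> S by blast
qed

text \<open>The functionals not vanishing at \<open>x\<close> form a weak-* open set; were it
  nonempty, a dense set would meet it.\<close>

lemma weak_star_dense_separates:
  assumes dense: "weak_star_topology smul closure_of S = dual_space smul"
    and x: "\<And>\<psi>. \<psi> \<in> S \<Longrightarrow> blinfun_apply \<psi> x = 0" and \<phi>: "\<phi> \<in> dual_space smul"
  shows "blinfun_apply \<phi> x = 0"
proof (rule ccontr)
  assume nz: "blinfun_apply \<phi> x \<noteq> 0"
  define U where "U = blinfun_apply -` ((\<lambda>g. g x) -` (- {0})) \<inter> dual_space smul"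
  have "open ((\<lambda>g. g x) -` (- {0}) :: ('a \<Rightarrow> 'b) set)"
    by (intro open_vimage continuous_on_product_coordinates) auto
  then have "openin (weak_star_topology smul) U"
    unfolding U_def weak_star_topology_def openin_pullback_topology by auto
  moreover have "\<phi> \<in> U" using nz \<phi> by (simp add: U_def)
  moreover have "\<phi> \<in> weak_star_topology smul closure_of S" using \<phi> dense by simp
  ultimately obtain \<psi> where "\<psi> \<in> S" "\<psi> \<in> U"
    unfolding in_closure_of by blast
  with x show False by (simp add: U_def)
qed

section \<open>Chernoff families\<close>

text \<open>Orbits starting in \<open>D\<close> are classical solutions, which the scheme follows.
  Stability extends the limit to all \<open>f\<close>, and boundedness of \<open>T s\<close>
  identifies it.\<close>

lemma (in stable_scheme) semigroup_limit_at:
  assumes T: "strongly_continuous_semigroup T" and gen: "generator T = Gb" and s: "s \<ge> 0"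
  shows "limit_at f s (T s f)"
proof -
  interpret strongly_continuous_semigroup T by fact
  have D: "limit_at x s (T s x)" if "x \<in> D" for x
  proof -
    have xZ: "(x, Z x) \<in> generator T"
      using graph_Gb[OF that] by (simp add: gen)
    have "classical_solution (\<lambda>r. T r x) (\<lambda>r. T r (Z x))"
      unfolding classical_solution_def
      using orbit_continuous orbit_derivative[OF xZ] generator_orbit[OF xZ] by (simp add: gen)
    from classical_solution_limit_at[OF this s] show ?thesis by simp
  qed
  then have "D \<subseteq> {f. \<exists>x. limit_at f s x}" by blast
  then have "f \<in> closure {f. \<exists>x. limit_at f s x}"
    using closure_mono dense_D by blast
  then obtain y where y: "limit_at f s y"
    using limit_at_exists_closure[OF s] by blast
  have "f \<in> closure D" using dense_D by simp
  then obtain g where g: "\<And>n. g n \<in> D" "g \<longlonglongrightarrow> f"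
    by (auto simp: closure_sequential)
  have "(\<lambda>n. T s (g n) - y) \<longlonglongrightarrow> 0"
  proof (rule Lim_null_comparison[OF always_eventually])
    show "\<forall>n. norm (T s (g n) - y) \<le> bnd s * norm (g n - f)"
      using limit_at_norm[OF limit_at_diff[OF D[OF g(1)] y] s] by blast
    show "(\<lambda>n. bnd s * norm (g n - f)) \<longlonglongrightarrow> 0"
      using g(2) by (intro tendsto_mult_right_zero tendsto_norm_zero LIM_zero)
  qed
  then have "(\<lambda>n. T s (g n)) \<longlonglongrightarrow> y" by (rule LIM_zero_cancel)
  moreover have "(\<lambda>n. T s (g n)) \<longlonglongrightarrow> T s f"
    by (intro blinfun.tendsto tendsto_const g)
  ultimately have "y = T s f" by (rule LIMSEQ_unique)
  with y show ?thesis by simp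
qed

lemma (in stable_scheme) limit_at_power_tendsto:
  assumes f: "limit_at f s x" and s: "s > 0"
  shows "(\<lambda>n. iter (s / real n) n f) \<longlonglongrightarrow> x"
proof -
  \<comment> \<open>The index is shifted because \<open>limit_at\<close> requires positive step
    sizes, and \<open>s / 0\<close> is 0.\<close>
  have "(\<lambda>j. iter (s / real (Suc j)) (Suc j) f) \<longlonglongrightarrow> x"
  proof (rule limit_atD[OF f])
    show "(\<lambda>j. s / real (Suc j)) \<longlonglongrightarrow> 0"
      using lim_const_over_n[of s] by (rule LIMSEQ_Suc)
    show "(\<lambda>j. s / real (Suc j) * real (Suc j)) \<longlonglongrightarrow> s"
      by simp
  qed (use s in simp)
  then show ?thesis
    by (rule LIMSEQ_imp_Suc)
qed

lemma chernoff_family_stable_scheme: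
  assumes smul: "rc_normed_space smul" and Z: "linear_operator smul D Z" and D: "closure D = UNIV"
    and F: "chernoff_family smul D Z t F"
  shows "\<exists>M a. stable_scheme F D Z M a"
proof -
  interpret rc_normed_space smul by fact
  obtain a M where F0: "F 0 = id_blinfun" and M: "M \<ge> 1"
    and pow: "\<And>n m s. n \<ge> 1 \<Longrightarrow> s \<ge> 0 \<Longrightarrow>
      norm (blinfun_power (F (s / real n)) m) \<le> M * exp (a * s * (real m / real n))"
    using F unfolding chernoff_family_def power_bound_def by blast
  have "stable_scheme F D Z M (max a 0)"
  proof
    fix h :: real and k assume h: "h \<ge> 0"
    \<comment> \<open>This is (i) with \<open>n = 1\<close> and \<open>s = h\<close>; then the rate
      is raised to \<open>max a 0\<close>.\<close>
    have "norm (blinfun_power (F h) k) \<le> M * exp (a * (h * real k))"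
      using pow[of 1 h k] h by (simp add: mult.assoc)
    also have "\<dots> \<le> M * exp (max a 0 * (h * real k))"
      using M h by (intro mult_left_mono) (auto intro: mult_right_mono)
    finally show "norm (blinfun_power (F h) k) \<le> M * exp (max a 0 * (h * real k))" .
  next
    have sub: "module.subspace smul D"
      using Z by (simp add: linear_operator_def)
    then show "real_vector.subspace D"
      unfolding module.subspace_def[OF module_axioms] real_vector.subspace_def
      by (metis smul_of_real)
    show "Z (c *\<^sub>R x) = c *\<^sub>R Z x" if "x \<in> D" for c x
      using Z that by (simp add: linear_operator_def flip: smul_of_real)
    show "((\<lambda>h. (1 / h) *\<^sub>R (F h x - x)) \<longlongrightarrow> Z x) (at_right 0)" if "x \<in> D" for x
      using F that F0
      by (auto simp: chernoff_family_def derivative_extends_def operator_graph_def strong_derivative0_def)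
  qed (use M D Z in \<open>auto simp: linear_operator_def\<close>)
  then show ?thesis by blast
qed

lemma blinfun_adjoint_id [simp]: "blinfun_adjoint id_blinfun \<phi> = \<phi>"
  by (rule blinfun_eqI) (simp add: blinfun_adjoint_def)

text \<open>Real parts of functionals in the scalar-valued domain lie in the real
  \<open>dual_domain\<close>. A point killed by the latter is killed by the former, hence by the
  whole dual through weak-* density, so it is 0. Reflexivity turns this separation into norm
  density.\<close>

lemma chernoff_family_dual_dense:
  assumes smul: "rc_normed_space (smul :: 'k::rc_field \<Rightarrow> 'a::banach \<Rightarrow> 'a)"
    and refl: "reflexive_space (scaleR :: real \<Rightarrow> 'a \<Rightarrow> 'a)"
    and F: "chernoff_family smul D Z t F" and scheme: "stable_scheme F D Z M a"
  shows "closure (stable_scheme.dual_domain F) = UNIV"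
proof -
  interpret rc_normed_space smul by fact
  interpret stable_scheme F D Z M a by fact
  have F0: "F 0 = id_blinfun"
    using F by (simp add: chernoff_family_def power_bound_def)
  define S where "S = Domain (strong_derivative0 (dual_space smul) (\<lambda>s. blinfun_adjoint (F s) :: ('a \<Rightarrow>\<^sub>L 'k) \<Rightarrow> _))"
  have S: "weak_star_topology smul closure_of S = dual_space smul"
    using F by (simp add: S_def chernoff_family_def adjoint_derivative_dense_def)
  have re: "rc_re_blinfun \<psi> \<in> dual_domain" if "\<psi> \<in> S" for \<psi>
  proof -
    from that obtain \<eta> where "(\<psi>, \<eta>) \<in> strong_derivative0 (dual_space smul) (\<lambda>s. blinfun_adjoint (F s))"
      unfolding S_def by (rule DomainE)
    then have "((\<lambda>h. (1 / h) *\<^sub>R (blinfun_adjoint (F h) \<psi> - blinfun_adjoint (F 0) \<psi>)) \<longlongrightarrow> \<eta>) (at_right 0)"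
      by (simp add: strong_derivative0_def)
    then have "((\<lambda>h. rc_re_blinfun ((1 / h) *\<^sub>R (blinfun_adjoint (F h) \<psi> - blinfun_adjoint (F 0) \<psi>))) \<longlongrightarrow> rc_re_blinfun \<eta>) (at_right 0)"
      by (rule bounded_linear.tendsto[OF bounded_linear_rc_re_blinfun])
    moreover have "rc_re_blinfun ((1 / h) *\<^sub>R (blinfun_adjoint (F h) \<psi> - blinfun_adjoint (F 0) \<psi>)) = dual_dq h (rc_re_blinfun \<psi>)" for h
      by (rule blinfun_eqI)
        (simp add: blinfun_adjoint_def dual_dq_def F0 blinfun.scaleR_left blinfun.diff_left rc_re_scaleR rc_re_diff)
    ultimately show ?thesis
      by (auto simp: dual_domain_def)
  qed
  show ?thesis
  proof (rule separating_subspace_dense[OF refl subspace_dual_domain])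
    fix x assume x: "\<forall>\<psi>\<in>dual_domain. \<psi> x = 0"
    have S_zero: "blinfun_apply \<psi> x = 0" if \<psi>: "\<psi> \<in> S" for \<psi>
    proof (rule rc_eqI)
      fix c
      \<comment> \<open>Closedness under scalar multiples recovers \<open>\<psi> x\<close> from the
        vanishing real parts of all \<open>c * \<psi> x\<close>.\<close>
      have closed: "blinfun_mult_right c o\<^sub>L \<psi> \<in> S" for c
      proof -
        from \<psi> obtain \<eta> where "(\<psi>, \<eta>) \<in> strong_derivative0 (dual_space smul) (\<lambda>s. blinfun_adjoint (F s))"
          unfolding S_def by (rule DomainE)
        then have \<psi>_dual: "\<psi> \<in> dual_space smul" and \<eta>: "\<eta> \<in> dual_space smul"
          "((\<lambda>h. (1 / h) *\<^sub>R (blinfun_adjoint (F h) \<psi> - blinfun_adjoint (F 0) \<psi>)) \<longlongrightarrow> \<eta>) (at_right 0)"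
          by (simp_all add: strong_derivative0_def)
        have "((\<lambda>h. blinfun_mult_right c o\<^sub>L ((1 / h) *\<^sub>R (blinfun_adjoint (F h) \<psi> - blinfun_adjoint (F 0) \<psi>)))
            \<longlongrightarrow> blinfun_mult_right c o\<^sub>L \<eta>) (at_right 0)"
          by (intro bounded_bilinear.tendsto[OF bounded_bilinear_blinfun_compose] tendsto_const \<eta>)
        moreover have "blinfun_mult_right c o\<^sub>L ((1 / h) *\<^sub>R (blinfun_adjoint (F h) \<psi> - blinfun_adjoint (F 0) \<psi>))
            = (1 / h) *\<^sub>R (blinfun_adjoint (F h) (blinfun_mult_right c o\<^sub>L \<psi>) - blinfun_adjoint (F 0) (blinfun_mult_right c o\<^sub>L \<psi>))" for h
          by (rule blinfun_eqI)
            (simp add: blinfun_adjoint_def blinfun.scaleR_left blinfun.diff_left right_diff_distrib scaleR_conv_of_real)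
        ultimately have "(blinfun_mult_right c o\<^sub>L \<psi>, blinfun_mult_right c o\<^sub>L \<eta>)
            \<in> strong_derivative0 (dual_space smul) (\<lambda>s. blinfun_adjoint (F s) :: ('a \<Rightarrow>\<^sub>L 'k) \<Rightarrow> _)"
          using smul_dual_space[OF \<psi>_dual] smul_dual_space[OF \<eta>(1)] by (simp add: strong_derivative0_def)
        then show ?thesis by (auto simp: S_def)
      qed
      show "rc_re (c * blinfun_apply \<psi> x) = rc_re (c * 0)"
        using x re[OF closed[of c]] by (auto simp: rc_re_def)
    qed
    have zero: "blinfun_apply \<phi> x = 0" if "\<phi> \<in> dual_space smul" for \<phi> :: "'a \<Rightarrow>\<^sub>L 'k"
      by (rule weak_star_dense_separates[OF S S_zero that])
    show "x = 0"
    proof (rule functional_eqI)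
      fix u :: "'a \<Rightarrow>\<^sub>L real"
      obtain \<phi> where "\<phi> \<in> dual_space smul" "\<forall>x. rc_re (blinfun_apply \<phi> x) = u x"
        using dual_space_real_part by blast
      then show "u x = u 0"
        using zero[of \<phi>] by (metis blinfun.zero_right)
    qed
  qed
qed

lemma chernoff_family_generates:
  assumes smul: "rc_normed_space (smul :: 'k::rc_field \<Rightarrow> 'a::banach \<Rightarrow> 'a)"
    and refl: "reflexive_space (scaleR :: real \<Rightarrow> 'a \<Rightarrow> 'a)"
    and Z: "linear_operator smul D Z" and D: "closure D = UNIV" and t: "t > 0"
    and F: "chernoff_family smul D Z t F"
  shows "\<exists>T. generates smul (closure (operator_graph D Z)) T"
proof -
  obtain M a where scheme: "stable_scheme F D Z M a"
    using chernoff_family_stable_scheme[OF smul Z D F] by blast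
  interpret stable_scheme F D Z M a by fact
  obtain A where A: "A \<subseteq> D" "closure A = UNIV"
    and orbits: "\<forall>f\<in>A. \<forall>s\<ge>0. \<exists>g :: nat \<Rightarrow> 'a. (\<forall>n\<ge>1. g n \<in> D) \<and>
        (\<lambda>n. norm (iter (t / real n) (nat \<lfloor>real n * s\<rfloor>) f - g n)) \<longlonglongrightarrow> 0 \<and>
        bounded ((\<lambda>n. Z (g n)) ` {1..})"
    using F unfolding chernoff_family_def approximate_orbits_def by blast
  have "A \<subseteq> closure classical_initial"
  proof
    fix f assume f: "f \<in> A"
    interpret approximate_orbit F D Z M a t f
      using refl chernoff_family_dual_dense[OF smul refl F scheme] t f A(1) orbits
      by unfold_locales auto
    show "f \<in> closure classical_initial" by (rule classical_initial_closure)
  qed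
  then have "closure classical_initial = UNIV"
    using A(2) closure_mono closure_closure by blast
  then have "generates smul Gb limit_semigroup"
    using smul F by (intro limit_semigroup_generates) (auto simp: chernoff_family_def)
  then show ?thesis
    unfolding Gb_def by blast
qed

lemma chernoff_family_converges:
  assumes smul: "rc_normed_space (smul :: 'k::rc_field \<Rightarrow> 'a::banach \<Rightarrow> 'a)" and Z: "linear_operator smul D Z" and D: "closure D = UNIV"
    and F: "chernoff_family smul D Z t F"
    and T: "generates smul (closure (operator_graph D Z)) T" and s: "s > 0"
  shows "(\<lambda>n. blinfun_apply (blinfun_power (F (s / real n)) n) f) \<longlonglongrightarrow> T s f"
proof -
  obtain M a where "stable_scheme F D Z M a"
    using chernoff_family_stable_scheme[OF smul Z D F] by blast
  then interpret stable_scheme F D Z M a .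
  have "strongly_continuous_semigroup T" "generator T = Gb"
    using T by (auto simp: generates_def Gb_def intro: C0_semigroup_strongly_continuous)
  then have "limit_at f s (T s f)"
    using s by (intro semigroup_limit_at) auto
  then show ?thesis
    using s by (rule limit_at_power_tendsto)
qed

section \<open>The converse: a semigroup as its own Chernoff family\<close>

lemma semigroup_adjoint_derivative_dense:
  assumes smul: "rc_normed_space (smul :: 'k::rc_field \<Rightarrow> 'a::banach \<Rightarrow> 'a)"
    and T: "C0_semigroup smul T"
  shows "adjoint_derivative_dense smul T"
proof -
  interpret rc_normed_space smul by fact
  interpret strongly_continuous_semigroup T
    by (rule C0_semigroup_strongly_continuous[OF T])
  define S where "S = Domain (strong_derivative0 (dual_space smul) (\<lambda>s. blinfun_adjoint (T s) :: ('a \<Rightarrow>\<^sub>L 'k) \<Rightarrow> _))"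
  have T_smul: "T s (smul c x) = smul c (T s x)" if "s \<ge> 0" for s c x
    using T that by (auto simp: C0_semigroup_def bounded_operators_def)
  have V_smul: "orbit_integral h (smul c x) = smul c (orbit_integral h x)" if "h \<ge> 0" for h c x
    using orbit_integral_linear[OF that bounded_linear_smul[of c], of x] T_smul by simp
  have "\<phi> \<in> weak_star_topology smul closure_of S" if \<phi>: "\<phi> \<in> dual_space smul" for \<phi> :: "'a \<Rightarrow>\<^sub>L 'k"
  proof (rule weak_star_closure_of_sequence)
    let ?h = "\<lambda>n. 1 / real (Suc n)"
    \<comment> \<open>Each of the two integrals is of order \<open>?h n\<close>; this factor
      normalises their product to tend strongly to the identity.\<close>
    let ?\<phi> = "\<lambda>n. (1 / (?h n)\<^sup>2) *\<^sub>R \<phi>"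
    let ?\<psi> = "\<lambda>n. ?\<phi> n o\<^sub>L (orbit_integral (?h n) o\<^sub>L orbit_integral (?h n))"
    have scaled: "?\<phi> n \<in> dual_space smul" for n
      using \<phi> by (simp add: dual_space_def blinfun.scaleR_left)
    show "?\<psi> n \<in> S" for n
    proof -
      let ?\<eta> = "?\<phi> n o\<^sub>L (orbit_integral (?h n) o\<^sub>L (T (?h n) - id_blinfun))"
      have "?\<psi> n \<in> dual_space smul" "?\<eta> \<in> dual_space smul"
        using scaled[of n] by (auto simp: dual_space_def V_smul T_smul blinfun.diff_left
            simp flip: scale_right_diff_distrib)
      then have "(?\<psi> n, ?\<eta>) \<in> strong_derivative0 (dual_space smul) (\<lambda>s. blinfun_adjoint (T s))"
        using orbit_integral_adjoint_derivative[of "?h n" "?\<phi> n"]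
        by (simp add: strong_derivative0_def T_0 del: of_nat_Suc) (simp add: blinfun_adjoint_def)
      then show ?thesis unfolding S_def by blast
    qed
    show "S \<subseteq> dual_space smul"
      by (auto simp: S_def strong_derivative0_def)
    show "\<phi> \<in> dual_space smul" by fact
    fix x
    have "filterlim ?h (at_right 0) sequentially"
      using LIMSEQ_inverse_real_of_nat
      by (intro tendsto_imp_filterlim_at_right) (auto simp: inverse_eq_divide)
    from filterlim_compose[OF orbit_integral_twice_tendsto this]
    have "(\<lambda>n. \<phi> ((1 / (?h n)\<^sup>2) *\<^sub>R orbit_integral (?h n) (orbit_integral (?h n) x))) \<longlonglongrightarrow> \<phi> x"
      by (intro blinfun.tendsto tendsto_const)
    then show "(\<lambda>n. blinfun_apply (?\<psi> n) x) \<longlonglongrightarrow> blinfun_apply \<phi> x"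
      by (simp add: blinfun.scaleR_left blinfun.scaleR_right)
  qed
  moreover have "weak_star_topology smul closure_of S \<subseteq> dual_space smul"
    using closure_of_subset_topspace[of "weak_star_topology smul" S] by simp
  ultimately show ?thesis
    unfolding adjoint_derivative_dense_def S_def by blast
qed

text \<open>The orbit of \<open>f\<close> stays in the domain of the closure but may leave
  \<open>D\<close>. Approximation in the graph keeps \<open>g n\<close> in \<open>D\<close>: its
  first coordinate must converge to the orbit, while an error of size 1 in the second is enough for
  boundedness.\<close>

lemma semigroup_approximate_orbits:
  assumes T: "strongly_continuous_semigroup T" and gen: "generator T = closure (operator_graph D Z)"
    and D: "module.subspace smul D" "closure D = UNIV" and t: "t > 0"
  shows "approximate_orbits smul D Z t T"
  unfolding approximate_orbits_def
proof (intro exI[of _ D] conjI ballI allI impI D order_refl)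
  interpret strongly_continuous_semigroup T by fact
  fix f and s :: real assume f: "f \<in> D" and s: "s \<ge> 0"
  obtain C where C: "C \<ge> 1" "\<And>r. 0 \<le> r \<Longrightarrow> r \<le> s * t \<Longrightarrow> norm (T r) \<le> C"
    using bounded_on by blast
  \<comment> \<open>The time actually reached after rounding; it never exceeds \<open>s * t\<close>,
    so one bound \<open>C\<close> serves all \<open>n\<close>.\<close>
  define r where "r n = real (nat \<lfloor>real n * s\<rfloor>) * (t / real n)" for n
  have r: "0 \<le> r n" "r n \<le> s * t" for n
  proof -
    show "0 \<le> r n" using t by (simp add: r_def)
    have "real (nat \<lfloor>real n * s\<rfloor>) \<le> real n * s" using s by simp
    then have "r n \<le> (real n * s) * (t / real n)"
      unfolding r_def using t by (intro mult_right_mono) auto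
    also have "\<dots> \<le> s * t" using s t by (cases "n = 0") auto
    finally show "r n \<le> s * t" .
  qed
  have fZ: "(f, Z f) \<in> generator T"
    using f closure_subset unfolding gen by (force simp: operator_graph_def)
  have "\<exists>d\<in>D. dist (T (r n) f) d < 1 / real (Suc n) \<and> dist (T (r n) (Z f)) (Z d) < 1" for n
  proof -
    let ?p = "(T (r n) f, T (r n) (Z f))"
    have "?p \<in> closure (operator_graph D Z)"
      using generator_orbit[OF fZ r(1)] by (simp add: gen)
    then obtain q where q: "q \<in> operator_graph D Z" "dist q ?p < 1 / real (Suc n)"
      unfolding closure_approachable by (metis of_nat_0_less_iff zero_less_Suc zero_less_divide_1_iff)
    from q(1) obtain d where d: "d \<in> D" "q = (d, Z d)"
      by (auto simp: operator_graph_def)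
    have "1 / real (Suc n) \<le> 1" by simp
    then have "dist d (T (r n) f) < 1 / real (Suc n)" "dist (Z d) (T (r n) (Z f)) < 1"
      using q(2) dist_fst_le[of q ?p] dist_snd_le[of q ?p] unfolding d(2) fst_conv snd_conv by linarith+
    with d(1) show ?thesis
      by (auto simp: dist_commute)
  qed
  then obtain g where g: "\<And>n. g n \<in> D" "\<And>n. dist (T (r n) f) (g n) < 1 / real (Suc n)"
    "\<And>n. dist (T (r n) (Z f)) (Z (g n)) < 1"
    by metis
  have iter: "blinfun_power (T (t / real n)) (nat \<lfloor>real n * s\<rfloor>) = T (r n)" for n
    using t by (simp add: blinfun_power_semigroup r_def)
  show "\<exists>g. (\<forall>n\<ge>1. g n \<in> D) \<and>
      (\<lambda>n. norm (blinfun_power (T (t / real n)) (nat \<lfloor>real n * s\<rfloor>) f - g n)) \<longlonglongrightarrow> 0 \<and>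
      bounded ((\<lambda>n. Z (g n)) ` {1..})"
  proof (intro exI[of _ g] conjI allI impI g(1))
    have lim: "(\<lambda>n. 1 / real (Suc n)) \<longlonglongrightarrow> 0"
      using LIMSEQ_inverse_real_of_nat by (simp add: inverse_eq_divide)
    show "(\<lambda>n. norm (blinfun_power (T (t / real n)) (nat \<lfloor>real n * s\<rfloor>) f - g n)) \<longlonglongrightarrow> 0"
      unfolding iter
      by (rule tendsto_sandwich[OF always_eventually always_eventually tendsto_const lim])
        (use g(2) in \<open>auto simp: dist_norm less_imp_le simp del: of_nat_Suc\<close>)
    have "norm (Z (g n)) \<le> C * norm (Z f) + 1" for n
    proof -
      have "norm (T (r n) (Z f)) \<le> C * norm (Z f)"
        using C(2)[OF r] by (intro order_trans[OF norm_blinfun] mult_right_mono) auto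
      then show ?thesis
        using g(3)[of n] norm_triangle_sub[of "Z (g n)" "T (r n) (Z f)"]
        by (simp add: dist_norm norm_minus_commute)
    qed
    then show "bounded ((\<lambda>n. Z (g n)) ` {1..})"
      by (auto simp: bounded_iff)
  qed
qed

lemma semigroup_chernoff_family:
  assumes smul: "rc_normed_space (smul :: 'k::rc_field \<Rightarrow> 'a::banach \<Rightarrow> 'a)"
    and Z: "linear_operator smul D Z" and D: "closure D = UNIV" and t: "t > 0"
    and T: "generates smul (closure (operator_graph D Z)) T"
  shows "chernoff_family smul D Z t T"
  unfolding chernoff_family_def
proof (intro conjI)
  have C0: "C0_semigroup smul T" and gen: "generator T = closure (operator_graph D Z)"
    using T by (auto simp: generates_def)
  show "\<forall>s\<ge>0. T s \<in> bounded_operators smul"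
    using C0 by (simp add: C0_semigroup_def)
  interpret strongly_continuous_semigroup T
    by (rule C0_semigroup_strongly_continuous[OF C0])
  show "power_bound T"
  proof -
    obtain M a where Ma: "M \<ge> 1" "a \<ge> 0" "\<forall>s\<ge>0. norm (T s) \<le> M * exp (a * s)"
      using growth by blast
    have "norm (blinfun_power (T (s / real n)) m) \<le> M * exp (a * s * (real m / real n))"
      if "n \<ge> 1" "s \<ge> 0" for n m :: nat and s :: real
      using Ma(3)[rule_format, of "real m * (s / real n)"] that
      by (simp add: blinfun_power_semigroup mult_ac)
    with Ma(1) T_0 show ?thesis
      unfolding power_bound_def by blast
  qed
  show "derivative_extends T D Z"
    unfolding derivative_extends_def generator_def[symmetric] gen by (rule closure_subset)
  show "adjoint_derivative_dense smul T"
    by (rule semigroup_adjoint_derivative_dense[OF smul C0])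
  show "approximate_orbits smul D Z t T"
    using Z by (intro semigroup_approximate_orbits[OF strongly_continuous_semigroup_axioms gen _ D t])
      (simp add: linear_operator_def)
qed

lemma single_valued_generator: "single_valued (generator T)"
  unfolding single_valued_def generator_def strong_derivative0_def
  by (auto intro: tendsto_unique[OF trivial_limit_at_right_real])

theorem corollary5p3:
  fixes smul :: "'k::rc_field \<Rightarrow> 'a::banach \<Rightarrow> 'a"
    and D :: "'a set" and Z :: "'a \<Rightarrow> 'a" and t :: real
  assumes "rc_normed_space smul"
    and "(reflexive_space smul \<and> separable_space (euclidean :: 'a topology)) \<or> hilbert_space smul"
    and "linear_operator smul D Z"
    and "closure D = UNIV"
    and "t > 0"
  shows "((closable (operator_graph D Z) \<and> (\<exists>T. generates smul (closure (operator_graph D Z)) T))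
            \<longleftrightarrow> (\<exists>F. chernoff_family smul D Z t F))
         \<and> (\<forall>F. chernoff_family smul D Z t F \<longrightarrow>
              (\<forall>T. generates smul (closure (operator_graph D Z)) T \<longrightarrow>
                 (\<forall>s>0. \<forall>f. (\<lambda>n. blinfun_apply (blinfun_power (F (s / real n)) n) f)
                              \<longlonglongrightarrow> blinfun_apply (T s) f)))"
proof -
  have refl: "reflexive_space (scaleR :: real \<Rightarrow> 'a \<Rightarrow> 'a)"
    using assms(2) rc_normed_space.real_reflexive[OF assms(1)]
      hilbert_space_reflexive[OF real_hilbert_space[OF assms(1)]] by blast
  have closable: "closable (operator_graph D Z)" if "generates smul (closure (operator_graph D Z)) T" for T
    using that single_valued_generator[of T] by (simp add: closable_def generates_def)
  have "\<exists>T. generates smul (closure (operator_graph D Z)) T" if "chernoff_family smul D Z t F" for F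
    using chernoff_family_generates[OF assms(1) refl assms(3-5) that] .
  moreover have "\<exists>F. chernoff_family smul D Z t F" if "generates smul (closure (operator_graph D Z)) T" for T
    using semigroup_chernoff_family[OF assms(1,3,4,5) that] by blast
  ultimately show ?thesis
    using closable chernoff_family_converges[OF assms(1,3,4)] by blast
qed

end
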